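(* Let $X=\{X_n\}_{n\ge0}$ be a simple random walk on $\mathbb Z$ with $X_0=0$, and let $Y=\{Y_n\}_{n\ge0}$ be a Markov chain on $\mathbb Z$, independent of $X$, with $Y_0=0$ and transition probabilities $p(0,0)=\tfrac12$, $p(0,1)=p(0,-1)=\tfrac14$, and $p(y,y+1)=p(y,y-1)=\tfrac12$ for $y\ne0$. Let $L_k=\sum_{i=0}^{k-1}\mathbf 1_{\{Y_i=0,\,Y_{i+1}=0\}}$ be the number of loops at $0$ performed by $Y$ up to time $k$ (so that $(X_{L_n},Y_n)_{n\ge0}$ is a realization of the simple random walk on the 2-dimensional comb started at $(0,0)$). Extend $X$, $Y$ and $L$ to continuous time by linear interpolation. Then, as $n\to\infty$, $$\left(\frac{X_{L_{nt}}}{\sqrt[4]{n}},\frac{Y_{nt}}{\sqrt n}\right)_{t\ge0}\ \stackrel{\mathrm{Law}}{\longrightarrow}\ \left(W_{L_t^0(B)},B_t\right)_{t\ge0},$$ where $W$ and $B$ are two independent standard Brownian motions (started at $0$) and $L_t^0(B)$ is the local time at $0$ of $B$ up to time $t$.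
   Context: The 2-dimensional comb is the graph obtained from $\mathbb Z^2$ by removing all horizontal edges off the $x$-axis; its simple random walk moves to a uniformly chosen neighbour at each step. $X_{L_{nt}}$ denotes the linearly interpolated process $X$ evaluated at the (linearly interpolated) time $L_{nt}$. Convergence in law is that of continuous $\mathbb R^2$-valued processes on $[0,\infty)$ with the topology of uniform convergence on compact intervals. The Brownian local time has the usual normalization $L_t^0(B)=\lim_{\varepsilon\to0}\frac1{2\varepsilon}\int_0^t\mathbf 1_{\{|B_s|\le\varepsilon\}}\,ds$. *)

theory Defs
  imports "HOL-Probability.Probability"
begin

section \<open>Convergence in law of continuous processes\<close>

text \<open>The path space \<open>C([0,\<infinity>), E)\<close>. Paths are total functions on the reals, pinned to
  \<open>undefined\<close> at negative times so that equality of paths is equality on \<open>[0,\<infinity>)\<close>.\<close>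

definition cpaths :: "(real \<Rightarrow> 'e::metric_space) set" where
  "cpaths = {f \<in> extensional {0..}. continuous_on {0..} f}"

definition locally_uniform_open :: "(real \<Rightarrow> 'e::metric_space) set \<Rightarrow> bool" where
  "locally_uniform_open U \<longleftrightarrow> U \<subseteq> cpaths \<and>
     (\<forall>f\<in>U. \<exists>T \<epsilon>. \<epsilon> > 0 \<and> {g \<in> cpaths. \<forall>t\<in>{0..T}. dist (f t) (g t) < \<epsilon>} \<subseteq> U)"

definition path_topology :: "(real \<Rightarrow> 'e::metric_space) topology" where
  "path_topology = topology locally_uniform_open"

lemma istopology_locally_uniform_open:
  "istopology (locally_uniform_open :: (real \<Rightarrow> 'e::metric_space) set \<Rightarrow> bool)"
  unfolding istopology_def
proof (intro conjI allI impI)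
  fix S U :: "(real \<Rightarrow> 'e) set"
  assume S: "locally_uniform_open S" and U: "locally_uniform_open U"
  show "locally_uniform_open (S \<inter> U)"
    unfolding locally_uniform_open_def
  proof (intro conjI ballI)
    show "S \<inter> U \<subseteq> cpaths" using S by (auto simp: locally_uniform_open_def)
    fix f assume "f \<in> S \<inter> U"
    then have "f \<in> S" "f \<in> U" by auto
    obtain T1 e1 where e1: "e1 > 0"
      and 1: "{g \<in> cpaths. \<forall>t\<in>{0..T1}. dist (f t) (g t) < e1} \<subseteq> S"
      using S \<open>f \<in> S\<close> unfolding locally_uniform_open_def by fast
    obtain T2 e2 where e2: "e2 > 0"
      and 2: "{g \<in> cpaths. \<forall>t\<in>{0..T2}. dist (f t) (g t) < e2} \<subseteq> U"
      using U \<open>f \<in> U\<close> unfolding locally_uniform_open_def by fast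
    have "{g \<in> cpaths. \<forall>t\<in>{0..max T1 T2}. dist (f t) (g t) < min e1 e2} \<subseteq> S \<inter> U"
    proof
      fix g assume g: "g \<in> {g \<in> cpaths. \<forall>t\<in>{0..max T1 T2}. dist (f t) (g t) < min e1 e2}"
      then have "\<forall>t\<in>{0..T1}. dist (f t) (g t) < e1" "\<forall>t\<in>{0..T2}. dist (f t) (g t) < e2"
        by (simp_all add: max.coboundedI1 max.coboundedI2)
      with g 1 2 show "g \<in> S \<inter> U" by blast
    qed
    moreover have "min e1 e2 > 0" using e1 e2 by simp
    ultimately show "\<exists>T \<epsilon>. \<epsilon> > 0 \<and> {g \<in> cpaths. \<forall>t\<in>{0..T}. dist (f t) (g t) < \<epsilon>} \<subseteq> S \<inter> U"
      by blast
  qed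
next
  fix K :: "(real \<Rightarrow> 'e) set set"
  assume K: "\<forall>S\<in>K. locally_uniform_open S"
  show "locally_uniform_open (\<Union>K)"
    unfolding locally_uniform_open_def
  proof (intro conjI ballI)
    show "\<Union>K \<subseteq> cpaths" using K by (auto simp: locally_uniform_open_def)
    fix f assume "f \<in> \<Union>K"
    then obtain S where "S \<in> K" "f \<in> S" by blast
    then obtain T \<epsilon> where "\<epsilon> > 0" "{g \<in> cpaths. \<forall>t\<in>{0..T}. dist (f t) (g t) < \<epsilon>} \<subseteq> S"
      using K unfolding locally_uniform_open_def by fast
    with \<open>S \<in> K\<close> show "\<exists>T \<epsilon>. \<epsilon> > 0 \<and> {g \<in> cpaths. \<forall>t\<in>{0..T}. dist (f t) (g t) < \<epsilon>} \<subseteq> \<Union>K"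
      by blast
  qed
qed

lemma openin_path_topology: "openin path_topology = locally_uniform_open"
  unfolding path_topology_def by (rule topology_inverse'[OF istopology_locally_uniform_open])

lemma topspace_path_topology: "topspace (path_topology :: (real \<Rightarrow> 'e::metric_space) topology) = cpaths"
proof -
  have "locally_uniform_open (cpaths :: (real \<Rightarrow> 'e) set)"
    unfolding locally_uniform_open_def by (auto intro: exI[of _ 1])
  moreover have "U \<subseteq> cpaths" if "locally_uniform_open U" for U :: "(real \<Rightarrow> 'e) set"
    using that unfolding locally_uniform_open_def by (rule conjunct1)
  ultimately show ?thesis
    unfolding topspace_def openin_path_topology by blast
qed

definition borel_sets_of :: "'c topology \<Rightarrow> 'c measure" where
  "borel_sets_of T = sigma (topspace T) {U. openin T U}"

text \<open>Being a random element (Borel measurability) is part of the definition, so that none of the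
  expectations below is the junk value of the integral of a non-measurable function.\<close>

definition converges_in_law ::
  "'c topology \<Rightarrow> 'a measure \<Rightarrow> (nat \<Rightarrow> 'a \<Rightarrow> 'c) \<Rightarrow> 'b measure \<Rightarrow> ('b \<Rightarrow> 'c) \<Rightarrow> bool" where
  "converges_in_law T M Z N Z' \<longleftrightarrow>
     (\<forall>n. Z n \<in> M \<rightarrow>\<^sub>M borel_sets_of T) \<and> Z' \<in> N \<rightarrow>\<^sub>M borel_sets_of T \<and>
     (\<forall>\<phi> :: 'c \<Rightarrow> real. continuous_map T euclideanreal \<phi> \<and> bounded (\<phi> ` topspace T) \<longrightarrow>
        (\<lambda>n. \<integral>\<omega>. \<phi> (Z n \<omega>) \<partial>M) \<longlonglongrightarrow> (\<integral>\<omega>. \<phi> (Z' \<omega>) \<partial>N))"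

section \<open>The discrete processes\<close>

definition markov_chain :: "'a measure \<Rightarrow> (int \<Rightarrow> int \<Rightarrow> real) \<Rightarrow> (nat \<Rightarrow> 'a \<Rightarrow> int) \<Rightarrow> bool" where
  "markov_chain M p Z \<longleftrightarrow>
     (\<forall>n. Z n \<in> M \<rightarrow>\<^sub>M count_space UNIV) \<and>
     (\<forall>n z y. \<P>(\<omega> in M. \<forall>i\<le>n. Z i \<omega> = z i) > 0 \<longrightarrow>
        \<P>(\<omega> in M. Z (Suc n) \<omega> = y \<bar> \<forall>i\<le>n. Z i \<omega> = z i) = p (z n) y)"

definition srw_kernel :: "int \<Rightarrow> int \<Rightarrow> real" where
  "srw_kernel x y = (if y = x + 1 \<or> y = x - 1 then 1/2 else 0)"

definition lazy_at_0_kernel :: "int \<Rightarrow> int \<Rightarrow> real" where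
  "lazy_at_0_kernel x y =
     (if x = 0 then (if y = 0 then 1/2 else if y = 1 \<or> y = -1 then 1/4 else 0)
      else srw_kernel x y)"

definition loops_at_0 :: "(nat \<Rightarrow> int) \<Rightarrow> nat \<Rightarrow> nat" where
  "loops_at_0 y k = (\<Sum>i<k. of_bool (y i = 0 \<and> y (Suc i) = 0))"

text \<open>Only used at times \<open>t \<ge> 0\<close>, where \<open>nat \<lfloor>t\<rfloor>\<close> does not truncate.\<close>

definition lin_interp :: "(nat \<Rightarrow> real) \<Rightarrow> real \<Rightarrow> real" where
  "lin_interp f t =
     (let k = nat \<lfloor>t\<rfloor> in f k + (t - real k) * (f (Suc k) - f k))"

definition indep_chains :: "'a measure \<Rightarrow> (nat \<Rightarrow> 'a \<Rightarrow> int) \<Rightarrow> (nat \<Rightarrow> 'a \<Rightarrow> int) \<Rightarrow> bool" where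
  "indep_chains M X Y \<longleftrightarrow>
     prob_space.indep_var M
       (\<Pi>\<^sub>M i\<in>UNIV. count_space UNIV) (\<lambda>\<omega> i. X i \<omega>)
       (\<Pi>\<^sub>M i\<in>UNIV. count_space UNIV) (\<lambda>\<omega> i. Y i \<omega>)"

section \<open>Brownian motion and its local time\<close>

definition standard_brownian_motion :: "'b measure \<Rightarrow> (real \<Rightarrow> 'b \<Rightarrow> real) \<Rightarrow> bool" where
  "standard_brownian_motion N B \<longleftrightarrow>
     (\<forall>t\<ge>0. B t \<in> borel_measurable N) \<and>
     (\<forall>\<omega>\<in>space N. continuous_on {0..} (\<lambda>t. B t \<omega>)) \<and>
     (AE \<omega> in N. B 0 \<omega> = 0) \<and>
     (\<forall>s t. 0 \<le> s \<and> s < t \<longrightarrow>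
        distributed N lborel (\<lambda>\<omega>. B t \<omega> - B s \<omega>) (normal_density 0 (sqrt (t - s)))) \<and>
     (\<forall>(t :: nat \<Rightarrow> real) n. 0 \<le> t 0 \<and> mono t \<longrightarrow>
        prob_space.indep_vars N (\<lambda>_. borel) (\<lambda>i \<omega>. B (t (Suc i)) \<omega> - B (t i) \<omega>) {..<n})"

definition indep_processes :: "'b measure \<Rightarrow> (real \<Rightarrow> 'b \<Rightarrow> real) \<Rightarrow> (real \<Rightarrow> 'b \<Rightarrow> real) \<Rightarrow> bool" where
  "indep_processes N W B \<longleftrightarrow>
     prob_space.indep_var N
       (\<Pi>\<^sub>M t\<in>{0..}. borel) (\<lambda>\<omega>. \<lambda>t\<in>{0..}. W t \<omega>)
       (\<Pi>\<^sub>M t\<in>{0..}. borel) (\<lambda>\<omega>. \<lambda>t\<in>{0..}. B t \<omega>)"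

text \<open>\<open>L\<close> is the local time at \<open>0\<close> of \<open>B\<close>. The defining limit exists only almost surely; as usual,
  local time means the version of it with continuous nonnegative paths, which this predicate
  determines up to indistinguishability.\<close>

definition local_time_at_0 :: "'b measure \<Rightarrow> (real \<Rightarrow> 'b \<Rightarrow> real) \<Rightarrow> (real \<Rightarrow> 'b \<Rightarrow> real) \<Rightarrow> bool" where
  "local_time_at_0 N B L \<longleftrightarrow>
     (\<forall>t\<ge>0. L t \<in> borel_measurable N) \<and>
     (\<forall>\<omega>\<in>space N. continuous_on {0..} (\<lambda>t. L t \<omega>) \<and> (\<forall>t\<ge>0. L t \<omega> \<ge> 0)) \<and>
     (\<forall>t\<ge>0. AE \<omega> in N.
        ((\<lambda>\<epsilon>. 1 / (2 * \<epsilon>) * (LBINT s:{0..t}. indicator {s. \<bar>B s \<omega>\<bar> \<le> \<epsilon>} s))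
           \<longlongrightarrow> L t \<omega>) (at_right 0))"

end

theory Submission
  imports Defs
begin

text \<open>Write \<open>l\<^sub>n(t) = L\<^sub>n\<^sub>t / sqrt n\<close> for the clock of the loops and \<open>x\<^sub>n\<close>, \<open>y\<^sub>n\<close> for the walks \<open>X\<close> and \<open>Y\<close>
  under diffusive scaling, \<open>X\<close> being scaled on the time scale \<open>sqrt n\<close> and \<open>Y\<close> on the time scale \<open>n\<close>.
  Since the fourth root of \<open>n\<close> is \<open>sqrt (sqrt n)\<close>, the process of the theorem is exactly
  \<open>(x\<^sub>n(l\<^sub>n(t)), y\<^sub>n(t))\<close>. As \<open>X\<close> and \<open>Y\<close> are independent, \<open>(x\<^sub>n, y\<^sub>n)\<close> converges in law to \<open>(W, B)\<close>;
  what is left is to see that the clock \<open>l\<^sub>n\<close> is almost a functional of \<open>y\<^sub>n\<close>, and to pass to the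
  limit in this functional.

  The clock. Both \<open>\<bar>Y\<bar>\<close> and the number of loops drift by \<open>1/2\<close> at each visit to the origin, so that
  \<open>\<bar>Y\<^sub>k\<bar> - L\<^sub>k\<close> is a martingale. A second one is a tent function \<open>f(Y\<^sub>k)\<close>, a smoothing of \<open>\<bar>Y\<bar>\<close> on
  \<open>[-a, a]\<close>, minus \<open>1 / (2 (a + 1))\<close> times the occupation time of \<open>[-a, a]\<close>. Their difference moves only
  while \<open>Y\<close> is in \<open>[-a, a]\<close>, hence its second moment at time \<open>n\<close> is of order \<open>a sqrt n\<close>
  (\<open>loop_martingale_maximal\<close>). For \<open>a\<close> about \<open>\<epsilon> sqrt n\<close> and \<open>\<epsilon>\<close> small this is small compared to
  \<open>n\<close>, and the clock is close, uniformly on compact time intervals, to the normalised time which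
  \<open>y\<^sub>n\<close> spends in \<open>[-\<epsilon>, \<epsilon>]\<close>. Replacing the indicator of this interval by a continuous plateau
  gives a continuous functional of the path, the smooth occupation time (\<open>loop_clock_approximation\<close>).

  Passage to the limit. For fixed \<open>\<epsilon>\<close> the time change of the first coordinate by the smooth occupation
  time of the second is continuous on the path space, so that it can be applied to the convergence
  of \<open>(x\<^sub>n, y\<^sub>n)\<close>. As \<open>\<epsilon>\<close> tends to \<open>0\<close>, the smooth occupation time of \<open>B\<close> converges to its local time:
  at each rational time by the definition of the latter, and then locally uniformly because the
  functions are monotone and the limit is continuous. As the approximation of the clock is uniform in
  large \<open>n\<close>, both limits combine (\<open>comb_pair_converges\<close>).

  Donsker's theorem for \<open>(x\<^sub>n, y\<^sub>n)\<close>. Convergence in law is tested on functionals that are Lipschitz for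
  the uniform distance up to some horizon (\<open>converges_in_lawI_lipschitz\<close>). The fourth moments of the
  increments bound the oscillation of the walks and so allow to replace them by polygons determined by
  finitely many increments. These become independent Gaussian variables: away from the origin each step
  multiplies the characteristic function of an increment by \<open>cos \<theta>\<close>, and the visits to the origin, of
  which there are about \<open>sqrt n\<close>, are too few to matter (\<open>weighted_increment_limit\<close>). Conditioning on
  the past and the independence of the walks then give the limits of all products of functions of
  single increments, and these determine the limits of Lipschitz functions of all increments
  (\<open>tendsto_integral_of_products\<close>).\<close>

section \<open>Functionals and random elements of the path space\<close>

definition horizon_lipschitz :: "real \<Rightarrow> real \<Rightarrow> ((real \<Rightarrow> 'e::metric_space) \<Rightarrow> real) \<Rightarrow> bool" where
  "horizon_lipschitz T K \<phi> \<longleftrightarrow> 0 \<le> T \<and> 0 \<le> K \<and>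
     (\<forall>f\<in>cpaths. \<forall>g\<in>cpaths. \<forall>\<delta>. (\<forall>t\<in>{0..T}. dist (f t) (g t) \<le> \<delta>) \<longrightarrow> \<bar>\<phi> f - \<phi> g\<bar> \<le> K * \<delta>)"

lemma horizon_lipschitzD:
  assumes "horizon_lipschitz T K \<phi>" "f \<in> cpaths" "g \<in> cpaths" "\<And>t. 0 \<le> t \<Longrightarrow> t \<le> T \<Longrightarrow> dist (f t) (g t) \<le> \<delta>"
  shows "\<bar>\<phi> f - \<phi> g\<bar> \<le> K * \<delta>"
  using assms unfolding horizon_lipschitz_def by auto

lemma locally_uniform_openD:
  assumes "locally_uniform_open U" "f \<in> U"
  obtains T \<epsilon> where "\<epsilon> > 0" "{g \<in> cpaths. \<forall>t\<in>{0..T}. dist (f t) (g t) < \<epsilon>} \<subseteq> U"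
  using assms unfolding locally_uniform_open_def by fast

lemma continuous_map_path_topology_iff:
  fixes \<phi> :: "(real \<Rightarrow> 'e::metric_space) \<Rightarrow> real"
  shows "continuous_map path_topology euclideanreal \<phi> \<longleftrightarrow>
    (\<forall>f\<in>cpaths. \<forall>e>0. \<exists>T \<epsilon>. \<epsilon> > 0 \<and>
       (\<forall>g\<in>cpaths. (\<forall>t\<in>{0..T}. dist (f t) (g t) < \<epsilon>) \<longrightarrow> \<bar>\<phi> g - \<phi> f\<bar> < e))"
    (is "?l \<longleftrightarrow> ?r")
proof
  assume ?l
  show ?r
  proof (intro ballI allI impI)
    fix f :: "real \<Rightarrow> 'e" and e :: real
    assume f: "f \<in> cpaths" and e: "e > 0"
    have "openin path_topology {g \<in> topspace path_topology. \<phi> g \<in> ball (\<phi> f) e}"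
      using \<open>?l\<close> by (rule openin_continuous_map_preimage) simp
    then have *: "locally_uniform_open {g \<in> cpaths. \<phi> g \<in> ball (\<phi> f) e}"
      by (simp add: openin_path_topology topspace_path_topology)
    have fin: "f \<in> {g \<in> cpaths. \<phi> g \<in> ball (\<phi> f) e}" using f e by simp
    obtain T \<epsilon> where "\<epsilon> > 0"
      "{g \<in> cpaths. \<forall>t\<in>{0..T}. dist (f t) (g t) < \<epsilon>} \<subseteq> {g \<in> cpaths. \<phi> g \<in> ball (\<phi> f) e}"
      by (rule locally_uniform_openD[OF * fin])
    then show "\<exists>T \<epsilon>. \<epsilon> > 0 \<and> (\<forall>g\<in>cpaths. (\<forall>t\<in>{0..T}. dist (f t) (g t) < \<epsilon>) \<longrightarrow> \<bar>\<phi> g - \<phi> f\<bar> < e)"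
      by (intro exI[of _ T] exI[of _ \<epsilon>]) (auto simp: dist_real_def subset_iff abs_minus_commute)
  qed
next
  assume r: ?r
  have "openin path_topology {f \<in> cpaths. \<phi> f \<in> V}" if V: "open V" for V
    unfolding openin_path_topology locally_uniform_open_def
  proof (intro conjI ballI)
    fix f assume f: "f \<in> {f \<in> cpaths. \<phi> f \<in> V}"
    then have "f \<in> cpaths" "\<phi> f \<in> V" by auto
    then obtain e where e: "e > 0" "ball (\<phi> f) e \<subseteq> V" using V by (meson open_contains_ball)
    from r \<open>f \<in> cpaths\<close> e(1) obtain T \<epsilon> where "\<epsilon> > 0"
      and *: "\<And>g. g \<in> cpaths \<Longrightarrow> (\<forall>t\<in>{0..T}. dist (f t) (g t) < \<epsilon>) \<Longrightarrow> \<bar>\<phi> g - \<phi> f\<bar> < e" by blast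
    moreover have "\<phi> g \<in> V" if "g \<in> cpaths" "\<forall>t\<in>{0..T}. dist (f t) (g t) < \<epsilon>" for g
      using *[OF that] e(2) by (auto simp: dist_real_def abs_minus_commute subset_iff)
    ultimately show "\<exists>T \<epsilon>. \<epsilon> > 0 \<and> {g \<in> cpaths. \<forall>t\<in>{0..T}. dist (f t) (g t) < \<epsilon>} \<subseteq> {f \<in> cpaths. \<phi> f \<in> V}"
      by (intro exI[of _ T] exI[of _ \<epsilon>]) auto
  qed auto
  then have "openin path_topology {f \<in> topspace path_topology. \<phi> f \<in> V}" if "openin euclideanreal V" for V
    using that unfolding topspace_path_topology open_openin[symmetric] .
  then show ?l
    unfolding continuous_map_def by (intro conjI allI impI) auto
qed

lemma horizon_lipschitz_continuous:
  assumes "horizon_lipschitz T K \<phi>"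
  shows "continuous_map path_topology euclideanreal \<phi>"
  unfolding continuous_map_path_topology_iff
proof (intro ballI allI impI)
  fix f :: "real \<Rightarrow> 'a" and e :: real assume f: "f \<in> cpaths" and e: "e > 0"
  have K: "K \<ge> 0" using assms by (simp add: horizon_lipschitz_def)
  define \<epsilon> where "\<epsilon> = e / (K + 1)"
  have \<epsilon>: "\<epsilon> > 0" "K * \<epsilon> < e" using e K by (auto simp: \<epsilon>_def field_simps)
  have "\<bar>\<phi> g - \<phi> f\<bar> < e" if "g \<in> cpaths" "\<forall>t\<in>{0..T}. dist (f t) (g t) < \<epsilon>" for g
  proof -
    have "\<bar>\<phi> f - \<phi> g\<bar> \<le> K * \<epsilon>"
      by (rule horizon_lipschitzD[OF assms f that(1)]) (use that in \<open>auto intro: less_imp_le\<close>)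
    with \<epsilon> show ?thesis by linarith
  qed
  then show "\<exists>T \<epsilon>. \<epsilon> > 0 \<and> (\<forall>g\<in>cpaths. (\<forall>t\<in>{0..T}. dist (f t) (g t) < \<epsilon>) \<longrightarrow> \<bar>\<phi> g - \<phi> f\<bar> < e)"
    by (intro exI[of _ T] exI[of _ \<epsilon>] conjI ballI impI \<epsilon>(1))
qed

lemma sets_borel_sets_of: "sets (borel_sets_of T) = sigma_sets (topspace T) {U. openin T U}"
  and space_borel_sets_of: "space (borel_sets_of T) = topspace T"
proof -
  have "{U. openin T U} \<subseteq> Pow (topspace T)" using openin_subset by blast
  then show "sets (borel_sets_of T) = sigma_sets (topspace T) {U. openin T U}"
    and "space (borel_sets_of T) = topspace T" by (simp_all add: borel_sets_of_def)
qed

lemma measurable_continuous_functional: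
  fixes \<phi> :: "'c \<Rightarrow> real"
  assumes "continuous_map T euclideanreal \<phi>"
  shows "\<phi> \<in> borel_measurable (borel_sets_of T)"
proof (rule borel_measurableI)
  fix S :: "real set" assume "open S"
  then have "openin T {x \<in> topspace T. \<phi> x \<in> S}"
    using assms openin_continuous_map_preimage by force
  moreover have "\<phi> -` S \<inter> space (borel_sets_of T) = {x \<in> topspace T. \<phi> x \<in> S}"
    by (auto simp: space_borel_sets_of)
  ultimately show "\<phi> -` S \<inter> space (borel_sets_of T) \<in> sets (borel_sets_of T)"
    by (simp add: sets_borel_sets_of sigma_sets.Basic)
qed

text \<open>The infimal convolutions of a bounded functional with the seminorms \<open>k sup\<^sub>[\<^sub>0\<^sub>,\<^sub>k\<^sub>]\<close> are
  Lipschitz minorants which converge to it wherever it is continuous. They reduce weak convergence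
  to Lipschitz test functionals, which see the path on a bounded time interval only.\<close>

definition lipschitz_minorant :: "((real \<Rightarrow> 'e::metric_space) \<Rightarrow> real) \<Rightarrow> nat \<Rightarrow> (real \<Rightarrow> 'e) \<Rightarrow> real" where
  "lipschitz_minorant \<phi> k f =
     Inf {\<phi> g + real k * \<delta> | g \<delta>. g \<in> cpaths \<and> 0 \<le> \<delta> \<and> (\<forall>t\<in>{0..real k}. dist (f t) (g t) \<le> \<delta>)}"

context
  fixes \<phi> :: "(real \<Rightarrow> 'e::metric_space) \<Rightarrow> real" and C :: real
  assumes bounded: "\<And>f. f \<in> cpaths \<Longrightarrow> \<bar>\<phi> f\<bar> \<le> C"
begin

private definition S where
  "S k f = {\<phi> g + real k * \<delta> | g \<delta>. g \<in> cpaths \<and> 0 \<le> \<delta> \<and> (\<forall>t\<in>{0..real k}. dist (f t) (g t) \<le> \<delta>)}"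

private lemma S_lower: "x \<in> S k f \<Longrightarrow> - C \<le> x"
proof -
  assume "x \<in> S k f"
  then obtain g \<delta> where x: "x = \<phi> g + real k * \<delta>" "g \<in> cpaths" "0 \<le> \<delta>" by (auto simp: S_def)
  then have "real k * \<delta> \<ge> 0" by simp
  with bounded[OF x(2)] x(1) show ?thesis by linarith
qed

private lemma S_bdd: "bdd_below (S k f)"
  using S_lower by (auto simp: bdd_below_def)

private lemma S_self: "f \<in> cpaths \<Longrightarrow> \<phi> f \<in> S k f"
  unfolding S_def by (auto intro!: exI[of _ f] exI[of _ 0])

private lemma minorant_eq: "lipschitz_minorant \<phi> k f = Inf (S k f)"
  by (simp add: lipschitz_minorant_def S_def)

lemma lipschitz_minorant_le: "f \<in> cpaths \<Longrightarrow> lipschitz_minorant \<phi> k f \<le> \<phi> f"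
  unfolding minorant_eq by (intro cInf_lower S_self S_bdd)

lemma lipschitz_minorant_bounded:
  assumes "f \<in> cpaths" shows "\<bar>lipschitz_minorant \<phi> k f\<bar> \<le> C"
proof -
  have "- C \<le> Inf (S k f)" using S_self[OF assms, of k] by (intro cInf_greatest S_lower) auto
  moreover have "lipschitz_minorant \<phi> k f \<le> C"
    using lipschitz_minorant_le[OF assms, of k] bounded[OF assms] by linarith
  ultimately show ?thesis by (simp add: minorant_eq)
qed

lemma horizon_lipschitz_minorant: "horizon_lipschitz (real k) (real k) (lipschitz_minorant \<phi> k)"
proof -
  have one: "Inf (S k g) \<le> Inf (S k f) + real k * \<delta>"
    if f: "f \<in> cpaths" and d: "\<And>t. t \<in> {0..real k} \<Longrightarrow> dist (f t) (g t) \<le> \<delta>" for f g :: "real \<Rightarrow> 'e" and \<delta>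
  proof -
    have "Inf (S k g) - real k * \<delta> \<le> Inf (S k f)"
    proof (rule cInf_greatest)
      show "S k f \<noteq> {}" using S_self[OF f] by blast
      fix x assume "x \<in> S k f"
      then obtain h \<eta> where x: "x = \<phi> h + real k * \<eta>" "h \<in> cpaths" "0 \<le> \<eta>"
        and h: "\<And>t. t \<in> {0..real k} \<Longrightarrow> dist (f t) (h t) \<le> \<eta>" by (auto simp: S_def)
      have "0 \<le> \<delta>" using d[of 0] by (auto intro: order_trans[OF zero_le_dist])
      moreover have "dist (g t) (h t) \<le> \<eta> + \<delta>" if "t \<in> {0..real k}" for t
        using d[OF that] h[OF that] dist_triangle2[of "g t" "h t" "f t"] by (simp add: dist_commute)
      ultimately have "\<phi> h + real k * (\<eta> + \<delta>) \<in> S k g"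
        using x unfolding S_def mem_Collect_eq by (intro exI[of _ h] exI[of _ "\<eta> + \<delta>"]) auto
      then have "Inf (S k g) \<le> \<phi> h + real k * (\<eta> + \<delta>)" by (intro cInf_lower S_bdd)
      then show "Inf (S k g) - real k * \<delta> \<le> x" using x by (simp add: algebra_simps)
    qed
    then show ?thesis by simp
  qed
  show ?thesis
    unfolding horizon_lipschitz_def minorant_eq
  proof (intro conjI ballI allI impI)
    fix f g :: "real \<Rightarrow> 'e" and \<delta> assume f: "f \<in> cpaths" and g: "g \<in> cpaths" and d: "\<forall>t\<in>{0..real k}. dist (f t) (g t) \<le> \<delta>"
    have "Inf (S k g) \<le> Inf (S k f) + real k * \<delta>" using d by (intro one f) auto
    moreover have "Inf (S k f) \<le> Inf (S k g) + real k * \<delta>"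
      using d by (intro one g) (auto simp: dist_commute)
    ultimately show "\<bar>Inf (S k f) - Inf (S k g)\<bar> \<le> real k * \<delta>" by linarith
  qed auto
qed

lemma lipschitz_minorant_tendsto:
  assumes cont: "continuous_map path_topology euclideanreal \<phi>" and f: "f \<in> cpaths"
  shows "(\<lambda>k. lipschitz_minorant \<phi> k f) \<longlonglongrightarrow> \<phi> f"
proof (rule LIMSEQ_I)
  fix e :: real assume e: "e > 0"
  have "e / 2 > 0" using e by simp
  with cont f obtain T \<epsilon> where \<epsilon>: "\<epsilon> > 0"
    and *: "\<And>g. g \<in> cpaths \<Longrightarrow> (\<forall>t\<in>{0..T}. dist (f t) (g t) < \<epsilon>) \<Longrightarrow> \<bar>\<phi> g - \<phi> f\<bar> < e / 2"
    unfolding continuous_map_path_topology_iff by blast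
  obtain k0 where k0: "real k0 \<ge> max T (2 * C / \<epsilon>)" using real_arch_simple by blast
  show "\<exists>n0. \<forall>n\<ge>n0. norm (lipschitz_minorant \<phi> n f - \<phi> f) < e"
  proof (intro exI[of _ k0] allI impI)
    fix k assume "k \<ge> k0"
    with k0 have k: "T \<le> real k" "2 * C / \<epsilon> \<le> real k"
      by (meson of_nat_le_iff max.boundedE order_trans)+
    have "\<phi> f - e / 2 \<le> Inf (S k f)"
    proof (rule cInf_greatest)
      show "S k f \<noteq> {}" using S_self[OF f] by blast
      fix x assume "x \<in> S k f"
      then obtain h \<eta> where x: "x = \<phi> h + real k * \<eta>" "h \<in> cpaths" "0 \<le> \<eta>"
        and h: "\<And>t. t \<in> {0..real k} \<Longrightarrow> dist (f t) (h t) \<le> \<eta>" by (auto simp: S_def)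
      \<comment> \<open>A path within \<open>\<epsilon>\<close> of \<open>f\<close> has nearly the same value as \<open>f\<close>; any other path pays a penalty of
        at least \<open>k * \<epsilon>\<close>, hence \<open>2 * C\<close>, which no difference of two values exceeds.\<close>
      show "\<phi> f - e / 2 \<le> x"
      proof (cases "\<eta> < \<epsilon>")
        case True
        have "\<forall>t\<in>{0..T}. dist (f t) (h t) < \<epsilon>"
        proof
          fix t assume "t \<in> {0..T}"
          then have "dist (f t) (h t) \<le> \<eta>" using k(1) by (intro h) auto
          with True show "dist (f t) (h t) < \<epsilon>" by simp
        qed
        then have "\<bar>\<phi> h - \<phi> f\<bar> < e / 2" by (intro * x)
        moreover have "0 \<le> real k * \<eta>" using x by simp
        ultimately show ?thesis using x by linarith
      next
        case False
        have "2 * C \<le> real k * \<epsilon>" using k(2) \<epsilon> by (simp add: field_simps)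
        also have "\<dots> \<le> real k * \<eta>" using False by (intro mult_left_mono) auto
        finally show ?thesis using x(1) bounded[OF x(2)] bounded[OF f] e by linarith
      qed
    qed
    then show "norm (lipschitz_minorant \<phi> k f - \<phi> f) < e"
      using lipschitz_minorant_le[OF f, of k] e by (simp add: minorant_eq)
  qed
qed

end

lemma random_path_in_cpaths:
  "Z \<in> M \<rightarrow>\<^sub>M borel_sets_of path_topology \<Longrightarrow> \<omega> \<in> space M \<Longrightarrow> Z \<omega> \<in> cpaths"
  using measurable_space[of Z M "borel_sets_of path_topology" \<omega>]
  by (simp add: space_borel_sets_of topspace_path_topology)

lemma integrable_path_functional:
  fixes \<phi> :: "(real \<Rightarrow> 'e::metric_space) \<Rightarrow> real"
  assumes "prob_space M" "Z \<in> M \<rightarrow>\<^sub>M borel_sets_of path_topology"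
    "continuous_map path_topology euclideanreal \<phi>" "\<And>f. f \<in> cpaths \<Longrightarrow> \<bar>\<phi> f\<bar> \<le> C"
  shows "integrable M (\<lambda>\<omega>. \<phi> (Z \<omega>))"
proof -
  interpret prob_space M by fact
  show ?thesis
    using measurable_compose[OF assms(2) measurable_continuous_functional[OF assms(3)]]
      assms(4) random_path_in_cpaths[OF assms(2)]
    by (intro integrable_const_bound[of _ C]) auto
qed

text \<open>Minorants bound the lower limit of the integrals of a functional from below; applied to the negative
  of the functional, the same argument bounds the upper limit from above.\<close>

proposition converges_in_lawI_lipschitz:
  fixes Z :: "nat \<Rightarrow> 'a \<Rightarrow> real \<Rightarrow> 'e::metric_space"
  assumes M: "prob_space M" and N: "prob_space N"
    and Z: "\<And>n. Z n \<in> M \<rightarrow>\<^sub>M borel_sets_of path_topology"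
    and Z': "Z' \<in> N \<rightarrow>\<^sub>M borel_sets_of path_topology"
    and conv: "\<And>\<phi> T K C. horizon_lipschitz T K \<phi> \<Longrightarrow> (\<And>f. f \<in> cpaths \<Longrightarrow> \<bar>\<phi> f\<bar> \<le> C) \<Longrightarrow>
       (\<lambda>n. \<integral>\<omega>. \<phi> (Z n \<omega>) \<partial>M) \<longlonglongrightarrow> (\<integral>\<omega>. \<phi> (Z' \<omega>) \<partial>N)"
  shows "converges_in_law path_topology M Z N Z'"
proof -
  interpret M: prob_space M by fact
  interpret N: prob_space N by fact
  have lower: "\<forall>\<^sub>F n in sequentially. (\<integral>\<omega>. \<phi> (Z n \<omega>) \<partial>M) > (\<integral>\<omega>. \<phi> (Z' \<omega>) \<partial>N) - e"
    if cont: "continuous_map path_topology euclideanreal \<phi>"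
      and bd: "\<And>f. f \<in> cpaths \<Longrightarrow> \<bar>\<phi> f\<bar> \<le> C" and e: "e > 0" for \<phi> C e
  proof -
    let ?m = "lipschitz_minorant \<phi>"
    have lip: "horizon_lipschitz (real k) (real k) (?m k)" for k
      by (rule horizon_lipschitz_minorant[OF bd])
    have mb: "\<bar>?m k f\<bar> \<le> C" if "f \<in> cpaths" for f k
      by (rule lipschitz_minorant_bounded[OF bd that])
    note mc = horizon_lipschitz_continuous[OF lip]
    have "(\<lambda>k. \<integral>\<omega>. ?m k (Z' \<omega>) \<partial>N) \<longlonglongrightarrow> (\<integral>\<omega>. \<phi> (Z' \<omega>) \<partial>N)"
    proof (rule integral_dominated_convergence[where w = "\<lambda>_. C"])
      show "(\<lambda>\<omega>. \<phi> (Z' \<omega>)) \<in> borel_measurable N"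
        by (rule measurable_compose[OF Z' measurable_continuous_functional[OF cont]])
      show "(\<lambda>\<omega>. ?m k (Z' \<omega>)) \<in> borel_measurable N" for k
        by (rule measurable_compose[OF Z' measurable_continuous_functional[OF mc]])
      show "AE \<omega> in N. (\<lambda>k. ?m k (Z' \<omega>)) \<longlonglongrightarrow> \<phi> (Z' \<omega>)"
        by (intro AE_I2 lipschitz_minorant_tendsto[OF bd cont] random_path_in_cpaths[OF Z'])
      show "AE \<omega> in N. norm (?m k (Z' \<omega>)) \<le> C" for k
        using mb random_path_in_cpaths[OF Z'] by (intro AE_I2) auto
    qed simp
    then have "\<forall>\<^sub>F k in sequentially. (\<integral>\<omega>. ?m k (Z' \<omega>) \<partial>N) > (\<integral>\<omega>. \<phi> (Z' \<omega>) \<partial>N) - e / 2"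
      using e by (intro order_tendstoD(1)) auto
    then obtain k where k: "(\<integral>\<omega>. ?m k (Z' \<omega>) \<partial>N) > (\<integral>\<omega>. \<phi> (Z' \<omega>) \<partial>N) - e / 2"
      using eventually_happens'[OF sequentially_bot] by blast
    have "(\<lambda>n. \<integral>\<omega>. ?m k (Z n \<omega>) \<partial>M) \<longlonglongrightarrow> (\<integral>\<omega>. ?m k (Z' \<omega>) \<partial>N)"
      by (rule conv[OF lip mb])
    then have "\<forall>\<^sub>F n in sequentially. (\<integral>\<omega>. ?m k (Z n \<omega>) \<partial>M) > (\<integral>\<omega>. ?m k (Z' \<omega>) \<partial>N) - e / 2"
      using e by (intro order_tendstoD(1)) auto
    then show ?thesis
    proof eventually_elim
      case (elim n)
      have "(\<integral>\<omega>. ?m k (Z n \<omega>) \<partial>M) \<le> (\<integral>\<omega>. \<phi> (Z n \<omega>) \<partial>M)"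
        by (intro integral_mono integrable_path_functional[OF M Z cont bd]
            integrable_path_functional[OF M Z mc mb] lipschitz_minorant_le[OF bd] random_path_in_cpaths[OF Z])
      with elim k show ?case by linarith
    qed
  qed
  show ?thesis
    unfolding converges_in_law_def
  proof (intro conjI allI impI Z Z')
    fix \<phi> :: "(real \<Rightarrow> 'e) \<Rightarrow> real"
    assume "continuous_map path_topology euclideanreal \<phi> \<and> bounded (\<phi> ` topspace path_topology)"
    then have cont: "continuous_map path_topology euclideanreal \<phi>" and "bounded (\<phi> ` cpaths)"
      by (auto simp: topspace_path_topology)
    then obtain C where bd: "\<And>f. f \<in> cpaths \<Longrightarrow> \<bar>\<phi> f\<bar> \<le> C"
      unfolding bounded_iff by (metis imageI real_norm_def)
    have cont': "continuous_map path_topology euclideanreal (\<lambda>f. - \<phi> f)"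
      using cont by (intro continuous_intros)
    have bd': "\<bar>- \<phi> f\<bar> \<le> C" if "f \<in> cpaths" for f using bd[OF that] by simp
    show "(\<lambda>n. \<integral>\<omega>. \<phi> (Z n \<omega>) \<partial>M) \<longlonglongrightarrow> (\<integral>\<omega>. \<phi> (Z' \<omega>) \<partial>N)"
    proof (rule tendstoI)
      fix e :: real assume e: "e > 0"
      have "\<forall>\<^sub>F n in sequentially. (\<integral>\<omega>. \<phi> (Z n \<omega>) \<partial>M) > (\<integral>\<omega>. \<phi> (Z' \<omega>) \<partial>N) - e"
        by (rule lower[OF cont bd e])
      moreover have "\<forall>\<^sub>F n in sequentially. (\<integral>\<omega>. - \<phi> (Z n \<omega>) \<partial>M) > (\<integral>\<omega>. - \<phi> (Z' \<omega>) \<partial>N) - e"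
        by (rule lower[OF cont' bd' e])
      ultimately show "\<forall>\<^sub>F n in sequentially. dist (\<integral>\<omega>. \<phi> (Z n \<omega>) \<partial>M) (\<integral>\<omega>. \<phi> (Z' \<omega>) \<partial>N) < e"
        by eventually_elim (auto simp: dist_real_def)
    qed
  qed
qed

lemma tendsto_integral_path_functional:
  fixes \<phi> :: "(real \<Rightarrow> 'e::metric_space) \<Rightarrow> real"
  assumes "prob_space N" and lip: "horizon_lipschitz T K \<phi>" and bd: "\<And>f. f \<in> cpaths \<Longrightarrow> \<bar>\<phi> f\<bar> \<le> C"
    and Z: "Z \<in> N \<rightarrow>\<^sub>M borel_sets_of path_topology"
    and meas: "\<And>j. (\<lambda>\<omega>. \<phi> (Zj j \<omega>)) \<in> borel_measurable N"
    and cp: "\<And>j \<omega>. \<omega> \<in> space N \<Longrightarrow> Zj j \<omega> \<in> cpaths"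
    and conv: "AE \<omega> in N. \<forall>e>0. \<forall>\<^sub>F j in sequentially. \<forall>t\<in>{0..T}. dist (Zj j \<omega> t) (Z \<omega> t) \<le> e"
  shows "(\<lambda>j. \<integral>\<omega>. \<phi> (Zj j \<omega>) \<partial>N) \<longlonglongrightarrow> (\<integral>\<omega>. \<phi> (Z \<omega>) \<partial>N)"
proof -
  interpret prob_space N by fact
  have K: "K \<ge> 0" using lip by (simp add: horizon_lipschitz_def)
  show ?thesis
  proof (rule integral_dominated_convergence[where w = "\<lambda>_. C"])
    show "(\<lambda>\<omega>. \<phi> (Z \<omega>)) \<in> borel_measurable N"
      by (rule measurable_compose[OF Z measurable_continuous_functional[OF horizon_lipschitz_continuous[OF lip]]])
    show "AE \<omega> in N. (\<lambda>j. \<phi> (Zj j \<omega>)) \<longlonglongrightarrow> \<phi> (Z \<omega>)"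
      using conv AE_space
    proof eventually_elim
      case (elim \<omega>)
      show ?case
      proof (rule tendstoI)
        fix e :: real assume e: "e > 0"
        define d where "d = e / (K + 1)"
        have d: "d > 0" "K * d < e" using e K by (auto simp: d_def field_simps)
        from elim(1) d(1) have "\<forall>\<^sub>F j in sequentially. \<forall>t\<in>{0..T}. dist (Zj j \<omega> t) (Z \<omega> t) \<le> d" by blast
        then show "\<forall>\<^sub>F j in sequentially. dist (\<phi> (Zj j \<omega>)) (\<phi> (Z \<omega>)) < e"
        proof eventually_elim
          case (elim j)
          have "\<bar>\<phi> (Zj j \<omega>) - \<phi> (Z \<omega>)\<bar> \<le> K * d"
            using elim by (intro horizon_lipschitzD[OF lip cp random_path_in_cpaths[OF Z]] \<open>\<omega> \<in> space N\<close>) auto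
          with d show ?case by (simp add: dist_real_def)
        qed
      qed
    qed
    show "AE \<omega> in N. norm (\<phi> (Zj j \<omega>)) \<le> C" for j using bd cp by (intro AE_I2) auto
  qed (auto simp: meas)
qed

lemma abs_integral_diff_le:
  fixes f g :: "'a \<Rightarrow> real"
  assumes "prob_space M" "f \<in> borel_measurable M" "g \<in> borel_measurable M" "A \<in> sets M"
    and f: "\<And>\<omega>. \<omega> \<in> space M \<Longrightarrow> \<bar>f \<omega>\<bar> \<le> C" and g: "\<And>\<omega>. \<omega> \<in> space M \<Longrightarrow> \<bar>g \<omega>\<bar> \<le> C"
    and close: "\<And>\<omega>. \<omega> \<in> space M - A \<Longrightarrow> \<bar>f \<omega> - g \<omega>\<bar> \<le> e" and e: "e \<ge> 0"
  shows "\<bar>(\<integral>\<omega>. f \<omega> \<partial>M) - (\<integral>\<omega>. g \<omega> \<partial>M)\<bar> \<le> e + 2 * C * measure M A"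
proof -
  interpret prob_space M by fact
  note [measurable] = assms(2-4)
  have fi: "integrable M f" and gi: "integrable M g"
    using f g by (auto intro!: integrable_const_bound[of _ C])
  have ind: "integrable M (indicator A :: 'a \<Rightarrow> real)" by (simp add: emeasure_eq_measure)
  have "C \<ge> 0" using not_empty f by (metis abs_ge_zero all_not_in_conv order_trans)
  have "\<bar>(\<integral>\<omega>. f \<omega> \<partial>M) - (\<integral>\<omega>. g \<omega> \<partial>M)\<bar> = \<bar>\<integral>\<omega>. f \<omega> - g \<omega> \<partial>M\<bar>" using fi gi by simp
  also have "\<dots> \<le> (\<integral>\<omega>. \<bar>f \<omega> - g \<omega>\<bar> \<partial>M)" using integral_norm_bound[of M "\<lambda>\<omega>. f \<omega> - g \<omega>"] by simp
  also have "\<dots> \<le> (\<integral>\<omega>. e + 2 * C * indicator A \<omega> \<partial>M)"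
  proof (rule integral_mono)
    fix \<omega> assume w: "\<omega> \<in> space M"
    show "\<bar>f \<omega> - g \<omega>\<bar> \<le> e + 2 * C * indicator A \<omega>"
      using close[of \<omega>] f[OF w] g[OF w] e w by (cases "\<omega> \<in> A") auto
  qed (use fi gi ind in auto)
  also have "\<dots> = e + 2 * C * measure M A"
    using ind by (simp add: prob_space)
  finally show ?thesis .
qed

lemma nat_floor_bounds:
  assumes "0 \<le> (t::real)" shows "real (nat \<lfloor>t\<rfloor>) \<le> t" "t < real (Suc (nat \<lfloor>t\<rfloor>))"
  using assms by linarith+

lemma le_on_interval_if_le_on_rationals:
  fixes h :: "real \<Rightarrow> real"
  assumes "a < b" "continuous_on {a..b} h" "\<And>s. s \<in> {a<..<b} \<inter> \<rat> \<Longrightarrow> h s \<le> e" "t \<in> {a..b}"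
  shows "h t \<le> e"
proof -
  have "closure ({a<..<b} \<inter> \<rat>) = {a..b}"
    using closure_open_Int_superset[of "{a<..<b}" \<rat>] Rats_closure_real closure_greaterThanLessThan[OF assms(1)]
    by simp
  then show ?thesis
    using continuous_le_on_closure[of "{a<..<b} \<inter> \<rat>" h t e] assms by simp
qed

text \<open>The path space is second countable: an open set is the union of the countably many tubes it
  contains, a tube prescribing, up to \<open>1/(i+1)\<close> and with values in a countable dense set, the path on
  each of finitely many consecutive intervals of equal rational length. Tubes are measurable because
  continuity reduces the condition to rational times.\<close>

proposition random_pathI:
  fixes Z :: "'a \<Rightarrow> real \<Rightarrow> 'e::{metric_space, second_countable_topology}"
  assumes cp: "\<And>\<omega>. \<omega> \<in> space M \<Longrightarrow> Z \<omega> \<in> cpaths"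
    and meas: "\<And>t. 0 \<le> t \<Longrightarrow> (\<lambda>\<omega>. Z \<omega> t) \<in> borel_measurable M"
  shows "Z \<in> M \<rightarrow>\<^sub>M borel_sets_of path_topology"
proof -
  define I where "I m j = {real j / real (Suc m) .. real (Suc j) / real (Suc m)}" for m j :: nat
  define tube :: "nat \<Rightarrow> 'e list \<Rightarrow> nat \<Rightarrow> (real \<Rightarrow> 'e) set" where
    "tube m q i = {f \<in> cpaths. \<forall>j<length q. \<forall>t\<in>I m j. dist (f t) (q ! j) \<le> 1 / real (Suc i)}" for m q i
  have tube_sets: "Z -` tube m q i \<inter> space M \<in> sets M" for m q i
  proof -
    have "Z -` tube m q i \<inter> space M =
      {\<omega> \<in> space M. \<forall>j\<in>{..<length q}. \<forall>t\<in>{real j / real (Suc m) <..< real (Suc j) / real (Suc m)} \<inter> \<rat>.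
         dist (Z \<omega> t) (q ! j) \<le> 1 / real (Suc i)}" (is "?l = ?r")
    proof
      show "?l \<subseteq> ?r" by (auto simp: tube_def I_def)
      show "?r \<subseteq> ?l"
      proof
        fix \<omega> assume w: "\<omega> \<in> ?r"
        then have "Z \<omega> \<in> cpaths" using cp by auto
        then have cont: "continuous_on {0..} (Z \<omega>)" by (simp add: cpaths_def)
        have "dist (Z \<omega> t) (q ! j) \<le> 1 / real (Suc i)" if "j < length q" "t \<in> I m j" for j t
        proof (rule le_on_interval_if_le_on_rationals[where h = "\<lambda>t. dist (Z \<omega> t) (q ! j)"
              and a = "real j / real (Suc m)" and b = "real (Suc j) / real (Suc m)"])
          show "real j / real (Suc m) < real (Suc j) / real (Suc m)" by (simp add: divide_strict_right_mono)
          show "continuous_on {real j / real (Suc m)..real (Suc j) / real (Suc m)} (\<lambda>t. dist (Z \<omega> t) (q ! j))"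
            by (intro continuous_intros continuous_on_subset[OF cont]) auto
        qed (use that w in \<open>auto simp: I_def\<close>)
        with w \<open>Z \<omega> \<in> cpaths\<close> show "\<omega> \<in> ?l" by (auto simp: tube_def)
      qed
    qed
    also have "\<dots> \<in> sets M"
    proof -
      have "countable ({real j / real (Suc m)<..<real (Suc j) / real (Suc m)} \<inter> \<rat>)" for j
        using countable_rat by (rule countable_subset[rotated]) auto
      moreover have "(\<lambda>\<omega>. Z \<omega> t) \<in> borel_measurable M"
        if "t \<in> {real j / real (Suc m)<..<real (Suc j) / real (Suc m)} \<inter> \<rat>" for j t
      proof (rule meas)
        have "0 \<le> real j / real (Suc m)" by simp
        moreover have "real j / real (Suc m) < t" using that by (simp del: of_nat_Suc)
        ultimately show "0 \<le> t" by linarith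
      qed
      ultimately have "{\<omega> \<in> space M. \<forall>t\<in>{real j / real (Suc m)<..<real (Suc j) / real (Suc m)} \<inter> \<rat>.
          dist (Z \<omega> t) (q ! j) \<le> 1 / real (Suc i)} \<in> sets M" for j
        by (intro sets.sets_Collect_countable_All') (auto intro!: borel_measurable_le borel_measurable_dist simp del: of_nat_Suc)
      then have "{\<omega> \<in> space M. \<forall>t\<in>{real j / real (Suc m)<..<real (Suc j) / real (Suc m)} \<inter> \<rat>.
          dist (Z \<omega> t) (q ! j) \<le> 1 / real (Suc i)} \<in> sets M" if "j \<in> {..<length q}" for j .
      then show ?thesis by (rule sets.sets_Collect_finite_All[OF _ finite_lessThan])
    qed
    finally show ?thesis .
  qed
  obtain D :: "'e set" where D: "countable D" "\<And>X. open X \<Longrightarrow> X \<noteq> {} \<Longrightarrow> \<exists>d\<in>D. d \<in> X"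
    using countable_dense_setE by blast
  have union: "U = (\<Union>(m, q, i)\<in>{(m, q, i). q \<in> lists D \<and> tube m q i \<subseteq> U}. tube m q i)"
    if U: "openin path_topology U" for U
  proof
    show "U \<subseteq> (\<Union>(m, q, i)\<in>{(m, q, i). q \<in> lists D \<and> tube m q i \<subseteq> U}. tube m q i)"
    proof
      fix f assume f: "f \<in> U"
      have lu: "locally_uniform_open U" using U by (simp add: openin_path_topology)
      then have fc: "f \<in> cpaths" using f by (auto simp: locally_uniform_open_def)
      obtain T \<epsilon> where \<epsilon>: "\<epsilon> > 0" and sub: "{g \<in> cpaths. \<forall>t\<in>{0..T}. dist (f t) (g t) < \<epsilon>} \<subseteq> U"
        by (rule locally_uniform_openD[OF lu f])
      obtain i where i: "1 / real (Suc i) < \<epsilon> / 2" using nat_approx_posE[of "\<epsilon> / 2"] \<epsilon> by auto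
      have "uniformly_continuous_on {0..\<bar>T\<bar> + 2} f"
        using fc by (intro compact_uniformly_continuous) (auto simp: cpaths_def elim!: continuous_on_subset)
      then obtain d where d: "d > 0" and osc: "\<And>s t. s \<in> {0..\<bar>T\<bar> + 2} \<Longrightarrow> t \<in> {0..\<bar>T\<bar> + 2} \<Longrightarrow> dist t s < d \<Longrightarrow>
          dist (f t) (f s) < 1 / real (Suc i) / 2"
        unfolding uniformly_continuous_on_def by (metis divide_pos_pos of_nat_0_less_iff zero_less_Suc zero_less_mult_iff zero_less_numeral zero_less_one)
      obtain m where m: "1 / real (Suc m) < d" using nat_approx_posE[OF d] by auto
      define J where "J = Suc (nat \<lceil>\<bar>T\<bar> * real (Suc m)\<rceil>)"
      have "0 \<le> \<bar>T\<bar> * real (Suc m)" by simp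
      then have J: "\<bar>T\<bar> * real (Suc m) < real J" "real J < \<bar>T\<bar> * real (Suc m) + 2"
        unfolding J_def by linarith+
      have "\<exists>x\<in>D. dist (f (real j / real (Suc m))) x < 1 / real (Suc i) / 2" for j :: nat
        using D(2)[of "ball (f (real j / real (Suc m))) (1 / real (Suc i) / 2)"] by auto
      then obtain x where x: "\<And>j. x j \<in> D" "\<And>j. dist (f (real j / real (Suc m))) (x j) < 1 / real (Suc i) / 2"
        by metis
      define q where "q = map x [0..<J]"
      have ftube: "f \<in> tube m q i"
        unfolding tube_def
      proof (intro CollectI conjI fc allI impI ballI)
        fix j t assume j: "j < length q" and t: "t \<in> I m j"
        then have "j < J" by (simp add: q_def)
        then have qj: "q ! j = x j" by (simp add: q_def)
        have t': "real j / real (Suc m) \<le> t" "t \<le> real (Suc j) / real (Suc m)" using t by (auto simp: I_def)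
        have "real (Suc j) \<le> real J" using \<open>j < J\<close> by linarith
        then have "real (Suc j) / real (Suc m) \<le> (\<bar>T\<bar> * real (Suc m) + 2) / real (Suc m)"
          using J(2) by (intro divide_right_mono) auto
        also have "\<dots> \<le> \<bar>T\<bar> + 2" by (simp add: field_simps)
        finally have jT: "real (Suc j) / real (Suc m) \<le> \<bar>T\<bar> + 2" .
        have "0 \<le> real j / real (Suc m)" by simp
        moreover from this have "0 \<le> t" using t' by linarith
        moreover have "real j / real (Suc m) \<le> \<bar>T\<bar> + 2" using jT t' by linarith
        moreover have "dist t (real j / real (Suc m)) < d"
        proof -
          have "t - real j / real (Suc m) \<le> 1 / real (Suc m)" using t'(2) by (simp add: add_divide_distrib)
          with m t'(1) show ?thesis by (simp add: dist_real_def)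
        qed
        ultimately have "dist (f t) (f (real j / real (Suc m))) < 1 / real (Suc i) / 2"
          using t' jT by (intro osc) (auto simp del: of_nat_Suc)
        moreover have "1 / real (Suc i) = 1 / real (Suc i) / 2 + 1 / real (Suc i) / 2" by (simp add: field_simps)
        ultimately show "dist (f t) (q ! j) \<le> 1 / real (Suc i)"
          using x(2)[of j] dist_triangle[of "f t" "x j" "f (real j / real (Suc m))"] unfolding qj by linarith
      qed
      have "tube m q i \<subseteq> {g \<in> cpaths. \<forall>t\<in>{0..T}. dist (f t) (g t) < \<epsilon>}"
      proof (intro subsetI CollectI conjI ballI)
        fix g t assume g: "g \<in> tube m q i" and t: "t \<in> {0..T}"
        define j where "j = nat \<lfloor>t * real (Suc m)\<rfloor>"
        have j: "real j \<le> t * real (Suc m)" "t * real (Suc m) < real (Suc j)"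
          using t nat_floor_bounds[of "t * real (Suc m)"] unfolding j_def by (simp_all del: of_nat_Suc)
        have "t * real (Suc m) \<le> \<bar>T\<bar> * real (Suc m)" using t by (intro mult_right_mono) auto
        with J have "t * real (Suc m) < real J" by linarith
        then have "j < length q" using j by (simp add: q_def)
        moreover have "t \<in> I m j" using j unfolding I_def by (auto simp: field_simps)
        ultimately have "dist (f t) (q ! j) \<le> 1 / real (Suc i)" "dist (g t) (q ! j) \<le> 1 / real (Suc i)"
          using ftube g by (auto simp: tube_def)
        with i dist_triangle2[of "f t" "g t" "q ! j"] show "dist (f t) (g t) < \<epsilon>" by linarith
      qed (auto simp: tube_def)
      with sub have "tube m q i \<subseteq> U" by blast
      moreover have "q \<in> lists D" using x by (auto simp: q_def)
      ultimately show "f \<in> (\<Union>(m, q, i)\<in>{(m, q, i). q \<in> lists D \<and> tube m q i \<subseteq> U}. tube m q i)"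
        using ftube by blast
    qed
  qed blast
  show ?thesis
    unfolding borel_sets_of_def
  proof (rule measurable_measure_of)
    show "{U. openin path_topology U} \<subseteq> Pow (topspace (path_topology :: (real \<Rightarrow> 'e) topology))"
      using openin_subset by blast
    show "Z \<in> space M \<rightarrow> topspace path_topology" using cp by (auto simp: topspace_path_topology)
    fix U :: "(real \<Rightarrow> 'e) set" assume "U \<in> {U. openin path_topology U}"
    then have "Z -` U \<inter> space M =
        (\<Union>(m, q, i)\<in>{(m, q, i). q \<in> lists D \<and> tube m q i \<subseteq> U}. Z -` tube m q i \<inter> space M)"
      by (subst union[of U]) auto
    also have "\<dots> \<in> sets M"
    proof (rule sets.countable_UN'')
      have "countable ((UNIV :: nat set) \<times> lists D \<times> (UNIV :: nat set))" using D(1) by simp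
      then show "countable {(m, q, i). q \<in> lists D \<and> tube m q i \<subseteq> U}"
        by (rule countable_subset[rotated]) auto
    qed (use tube_sets in auto)
    finally show "Z -` U \<inter> space M \<in> sets M" .
  qed
qed

section \<open>Linear interpolation\<close>

lemma lin_interp_of_nat [simp]: "lin_interp f (real k) = f k"
  by (simp add: lin_interp_def)

lemma lin_interp_close:
  assumes t: "0 \<le> t" and "\<bar>f (nat \<lfloor>t\<rfloor>) - y\<bar> \<le> d" "\<bar>f (Suc (nat \<lfloor>t\<rfloor>)) - y\<bar> \<le> d"
  shows "\<bar>lin_interp f t - y\<bar> \<le> d"
proof -
  define k where "k = nat \<lfloor>t\<rfloor>"
  define s where "s = t - real k"
  have s: "0 \<le> s" "s \<le> 1" using nat_floor_bounds[OF t] by (auto simp: s_def k_def)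
  have "lin_interp f t - y = (1 - s) * (f k - y) + s * (f (Suc k) - y)"
    by (simp add: lin_interp_def Let_def s_def[symmetric] k_def[symmetric]) (simp add: algebra_simps)
  also have "\<bar>\<dots>\<bar> \<le> (1 - s) * \<bar>f k - y\<bar> + s * \<bar>f (Suc k) - y\<bar>"
    using s by (auto intro!: order_trans[OF abs_triangle_ineq] simp: abs_mult)
  also have "\<dots> \<le> (1 - s) * d + s * d"
    using s assms by (intro add_mono mult_left_mono) (auto simp: k_def)
  finally show ?thesis by (simp add: algebra_simps)
qed

lemma lin_interp_between:
  assumes t: "0 \<le> t" and "f (nat \<lfloor>t\<rfloor>) \<le> f (Suc (nat \<lfloor>t\<rfloor>))"
  shows "f (nat \<lfloor>t\<rfloor>) \<le> lin_interp f t" "lin_interp f t \<le> f (Suc (nat \<lfloor>t\<rfloor>))"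
proof -
  let ?k = "nat \<lfloor>t\<rfloor>"
  have "0 \<le> (t - real ?k) * (f (Suc ?k) - f ?k)"
    using nat_floor_bounds[OF t] assms by (intro mult_nonneg_nonneg) auto
  moreover have "(t - real ?k) * (f (Suc ?k) - f ?k) \<le> 1 * (f (Suc ?k) - f ?k)"
    using nat_floor_bounds[OF t] assms by (intro mult_right_mono) auto
  ultimately show "f ?k \<le> lin_interp f t" "lin_interp f t \<le> f (Suc ?k)"
    by (auto simp: lin_interp_def Let_def)
qed

text \<open>Every step of the sequence is switched on by a continuous ramp, which makes the continuity of the
  interpolation visible.\<close>

lemma lin_interp_eq_sum:
  assumes "0 \<le> t" "t \<le> real K"
  shows "lin_interp f t = f 0 + (\<Sum>k<K. (f (Suc k) - f k) * max 0 (min 1 (t - real k)))"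
  using assms(2)
proof (induction K)
  case 0
  then have "t = real 0" using assms by simp
  then show ?case by (simp only: lin_interp_of_nat) simp
next
  case (Suc K)
  show ?case
  proof (cases "t \<le> real K")
    case True with Suc show ?thesis by simp
  next
    case False
    then have tK: "real K \<le> t" by simp
    have "(\<Sum>k<K. (f (Suc k) - f k) * max 0 (min 1 (t - real k))) = (\<Sum>k<K. f (Suc k) - f k)"
      using tK by (intro sum.cong refl) auto
    also have "\<dots> = f K - f 0" by (rule sum_lessThan_telescope)
    finally have *: "f 0 + (\<Sum>k<Suc K. (f (Suc k) - f k) * max 0 (min 1 (t - real k))) = f K + (f (Suc K) - f K) * (t - real K)"
      using tK Suc.prems by simp
    show ?thesis
    proof (cases "t = real (Suc K)")
      case True
      then have "lin_interp f t = f (Suc K)" by (simp only: lin_interp_of_nat)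
      with True show ?thesis unfolding * by simp
    next
      case False
      then have "\<lfloor>t\<rfloor> = int K" using tK Suc.prems by (intro floor_unique) auto
      then show ?thesis unfolding * by (simp add: lin_interp_def)
    qed
  qed
qed

lemma continuous_on_lin_interp: "continuous_on {0..} (lin_interp f)"
proof -
  have "continuous_on {0..<real K} (lin_interp f)" for K
  proof (rule continuous_on_eq)
    show "continuous_on {0..<real K} (\<lambda>t. f 0 + (\<Sum>k<K. (f (Suc k) - f k) * max 0 (min 1 (t - real k))))"
      by (intro continuous_intros)
  qed (simp add: lin_interp_eq_sum[of _ K])
  then have *: "continuous (at t within {0..<real K}) (lin_interp f)" if "t \<in> {0..<real K}" for t K
    using that by (simp add: continuous_on_eq_continuous_within)
  show ?thesis
    unfolding continuous_on_eq_continuous_within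
  proof
    fix t :: real assume t: "t \<in> {0..}"
    obtain K where K: "t < real K" using reals_Archimedean2 by blast
    have "at t within {0..} = at t within {0..<real K}"
      using K by (intro at_within_nhd[of _ "{..<real K}"]) auto
    then show "continuous (at t within {0..}) (lin_interp f)"
      using *[of t K] K t by simp
  qed
qed

lemma measurable_lin_interp:
  assumes f: "\<And>k. (\<lambda>\<omega>. f k \<omega>) \<in> borel_measurable M" and t: "t \<in> borel_measurable M"
  shows "(\<lambda>\<omega>. lin_interp (\<lambda>k. f k \<omega>) (t \<omega>)) \<in> borel_measurable M"
proof -
  have k: "(\<lambda>\<omega>. nat \<lfloor>t \<omega>\<rfloor>) \<in> measurable M (count_space UNIV)" using t by measurable
  have 1: "(\<lambda>\<omega>. f (nat \<lfloor>t \<omega>\<rfloor>) \<omega>) \<in> borel_measurable M"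
    by (rule measurable_compose_countable[OF f k])
  have 2: "(\<lambda>\<omega>. f (Suc (nat \<lfloor>t \<omega>\<rfloor>)) \<omega>) \<in> borel_measurable M"
    by (rule measurable_compose_countable[OF f k])
  have 3: "(\<lambda>\<omega>. real (nat \<lfloor>t \<omega>\<rfloor>)) \<in> borel_measurable M" using k by measurable
  show ?thesis
    unfolding lin_interp_def Let_def using 1 2 3 t by measurable
qed

text \<open>Rounding the random time down to the grid of mesh \<open>1/(n+1)\<close> leaves countably many values, at each of
  which the process is measurable; continuity of the paths gives the limit as the mesh goes to \<open>0\<close>.\<close>

lemma measurable_process_at_random_time:
  fixes W :: "real \<Rightarrow> 'a \<Rightarrow> real"
  assumes W: "\<And>s. 0 \<le> s \<Longrightarrow> W s \<in> borel_measurable M" "\<And>\<omega>. \<omega> \<in> space M \<Longrightarrow> continuous_on {0..} (\<lambda>s. W s \<omega>)"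
    and t: "t \<in> borel_measurable M" "\<And>\<omega>. \<omega> \<in> space M \<Longrightarrow> 0 \<le> t \<omega>"
  shows "(\<lambda>\<omega>. W (t \<omega>) \<omega>) \<in> borel_measurable M"
proof (rule borel_measurable_LIMSEQ_metric)
  define s where "s n \<omega> = real (nat \<lfloor>t \<omega> * real (Suc n)\<rfloor>) / real (Suc n)" for n \<omega>
  show "(\<lambda>\<omega>. W (s n \<omega>) \<omega>) \<in> borel_measurable M" for n
  proof -
    have k: "(\<lambda>\<omega>. nat \<lfloor>t \<omega> * real (Suc n)\<rfloor>) \<in> measurable M (count_space UNIV)" using t by measurable
    show ?thesis unfolding s_def
      by (rule measurable_compose_countable[OF _ k, of "\<lambda>k. W (real k / real (Suc n))"]) (intro W, simp)
  qed
  fix \<omega> assume w: "\<omega> \<in> space M"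
  have "(\<lambda>n. s n \<omega>) \<longlonglongrightarrow> t \<omega>"
  proof (rule tendsto_sandwich)
    show "\<forall>\<^sub>F n in sequentially. t \<omega> - 1 / real (Suc n) \<le> s n \<omega>"
    proof (intro always_eventually allI)
      fix n
      have "t \<omega> * real (Suc n) - 1 \<le> real (nat \<lfloor>t \<omega> * real (Suc n)\<rfloor>)"
        using nat_floor_bounds(2)[of "t \<omega> * real (Suc n)"] t(2)[OF w] by simp
      then have "(t \<omega> * real (Suc n) - 1) / real (Suc n) \<le> s n \<omega>"
        unfolding s_def by (intro divide_right_mono) auto
      then show "t \<omega> - 1 / real (Suc n) \<le> s n \<omega>" by (simp add: diff_divide_distrib del: of_nat_Suc)
    qed
    show "\<forall>\<^sub>F n in sequentially. s n \<omega> \<le> t \<omega>"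
    proof (intro always_eventually allI)
      fix n
      show "s n \<omega> \<le> t \<omega>"
        using nat_floor_bounds(1)[of "t \<omega> * real (Suc n)"] t(2)[OF w] by (simp add: s_def divide_le_eq)
    qed
    show "(\<lambda>n. t \<omega> - 1 / real (Suc n)) \<longlonglongrightarrow> t \<omega>"
      using tendsto_diff[OF tendsto_const[of "t \<omega>"] LIMSEQ_inverse_real_of_nat] by (simp add: inverse_eq_divide)
  qed simp
  then show "(\<lambda>n. W (s n \<omega>) \<omega>) \<longlonglongrightarrow> W (t \<omega>) \<omega>"
    using t(2)[OF w] by (intro continuous_on_tendsto_compose[OF W(2)[OF w]]) (auto simp: s_def)
qed

section \<open>Walks that may be lazy at the origin\<close>

definition jump_rate :: "real \<Rightarrow> int \<Rightarrow> real" where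
  "jump_rate c x = (if x = 0 then c else 1/2)"

text \<open>The two walks of the comb differ only in the rate at which they leave the origin: \<open>c = 1/2\<close> for the
  horizontal one and \<open>c = 1/4\<close> for the vertical one. They are treated together.\<close>

definition zero_lazy_kernel :: "real \<Rightarrow> int \<Rightarrow> int \<Rightarrow> real" where
  "zero_lazy_kernel c x y =
     (if y = x + 1 \<or> y = x - 1 then jump_rate c x else if y = x then 1 - 2 * jump_rate c x else 0)"

lemma srw_kernel_eq: "srw_kernel = zero_lazy_kernel (1/2)"
  by (auto simp: fun_eq_iff srw_kernel_def zero_lazy_kernel_def jump_rate_def)

lemma lazy_at_0_kernel_eq: "lazy_at_0_kernel = zero_lazy_kernel (1/4)"
  by (auto simp: fun_eq_iff lazy_at_0_kernel_def srw_kernel_def zero_lazy_kernel_def jump_rate_def)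

text \<open>Adaptedness, without filtrations: functions of the whole trajectory that look at the times up to
  \<open>k\<close> only are automatically measurable, there being countably many trajectories up to time \<open>k\<close>.\<close>

definition depends_upto :: "nat \<Rightarrow> ((nat \<Rightarrow> int) \<Rightarrow> 'b) \<Rightarrow> bool" where
  "depends_upto k g \<longleftrightarrow> (\<forall>z z'. (\<forall>i\<le>k. z i = z' i) \<longrightarrow> g z = g z')"

lemma depends_uptoI: "(\<And>z z'. (\<And>i. i \<le> k \<Longrightarrow> z i = z' i) \<Longrightarrow> g z = g z') \<Longrightarrow> depends_upto k g"
  unfolding depends_upto_def by blast

lemma depends_uptoD: "depends_upto k g \<Longrightarrow> (\<And>i. i \<le> k \<Longrightarrow> z i = z' i) \<Longrightarrow> g z = g z'"
  unfolding depends_upto_def by blast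

lemma depends_upto_mono: "depends_upto k g \<Longrightarrow> k \<le> l \<Longrightarrow> depends_upto l g"
  unfolding depends_upto_def by (meson order_trans)

lemma depends_upto_const: "depends_upto k (\<lambda>_. a)"
  by (simp add: depends_upto_def)

lemma depends_upto_comp2:
  assumes "depends_upto k g1" "depends_upto k g2" shows "depends_upto k (\<lambda>z. f (g1 z) (g2 z))"
proof (rule depends_uptoI)
  fix z z' :: "nat \<Rightarrow> int" assume z: "\<And>i. i \<le> k \<Longrightarrow> z i = z' i"
  have "g1 z = g1 z'" by (rule depends_uptoD[OF assms(1) z])
  moreover have "g2 z = g2 z'" by (rule depends_uptoD[OF assms(2) z])
  ultimately show "f (g1 z) (g2 z) = f (g1 z') (g2 z')" by simp
qed

lemma depends_upto_fun_upd: "depends_upto k g \<Longrightarrow> k < l \<Longrightarrow> g (z(l := y)) = g z"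
  by (rule depends_uptoD[of k g "z(l := y)" z]) auto

lemma depends_upto_update:
  assumes "depends_upto (Suc k) g" "depends_upto k y"
  shows "depends_upto k (\<lambda>z. g (z(Suc k := y z)))"
proof (rule depends_uptoI)
  fix z z' :: "nat \<Rightarrow> int" assume z: "\<And>i. i \<le> k \<Longrightarrow> z i = z' i"
  have "y z = y z'" by (rule depends_uptoD[OF assms(2) z])
  moreover have "(z(Suc k := x)) i = (z'(Suc k := x)) i" if "i \<le> Suc k" for i x
    using z[of i] that by auto
  then have "g (z(Suc k := x)) = g (z'(Suc k := x))" for x
    by (rule depends_uptoD[OF assms(1)])
  ultimately show "g (z(Suc k := y z)) = g (z'(Suc k := y z'))" by metis
qed

text \<open>The conditional expectation, given the walk up to time \<open>k\<close>, of a function of the walk up to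
  time \<open>k + 1\<close>.\<close>

definition step :: "real \<Rightarrow> nat \<Rightarrow> ((nat \<Rightarrow> int) \<Rightarrow> 'b::real_vector) \<Rightarrow> (nat \<Rightarrow> int) \<Rightarrow> 'b" where
  "step c k g z = (1 - 2 * jump_rate c (z k)) *\<^sub>R g (z(Suc k := z k)) +
     jump_rate c (z k) *\<^sub>R (g (z(Suc k := z k + 1)) + g (z(Suc k := z k - 1)))"

lemma depends_upto_step:
  assumes "depends_upto (Suc k) g" shows "depends_upto k (step c k g)"
proof (rule depends_uptoI)
  fix z z' :: "nat \<Rightarrow> int" assume z: "\<And>i. i \<le> k \<Longrightarrow> z i = z' i"
  have "z k = z' k" by (rule z) simp
  moreover have "(z(Suc k := x)) i = (z'(Suc k := x)) i" if "i \<le> Suc k" for i x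
    using z[of i] that by auto
  then have "g (z(Suc k := x)) = g (z'(Suc k := x))" for x
    by (rule depends_uptoD[OF assms])
  ultimately show "step c k g z = step c k g z'" unfolding step_def by metis
qed

text \<open>The lower bound on \<open>c\<close> makes the walk leave the origin fast enough for its expected number of visits
  there up to time \<open>n\<close> to be of order \<open>sqrt n\<close>.\<close>

locale zero_lazy_walk = prob_space M for M :: "'a measure" +
  fixes c :: real and Z :: "nat \<Rightarrow> 'a \<Rightarrow> int"
  assumes c: "1/4 \<le> c" "c \<le> 1/2"
    and chain: "markov_chain M (zero_lazy_kernel c) Z"
    and start: "AE \<omega> in M. Z 0 \<omega> = 0"
begin

abbreviation path :: "'a \<Rightarrow> nat \<Rightarrow> int" where "path \<omega> \<equiv> \<lambda>i. Z i \<omega>"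

abbreviation Ex :: "((nat \<Rightarrow> int) \<Rightarrow> 'b::{banach, second_countable_topology}) \<Rightarrow> 'b" where
  "Ex g \<equiv> (\<integral>\<omega>. g (path \<omega>) \<partial>M)"

lemma jump_rate_bounds: "1/4 \<le> jump_rate c x" "jump_rate c x \<le> 1/2"
  using c by (auto simp: jump_rate_def)

lemma Z_measurable [measurable]: "Z n \<in> M \<rightarrow>\<^sub>M count_space UNIV"
  using chain by (simp add: markov_chain_def)

lemma measurable_past:
  assumes "depends_upto k g" "\<And>z. g z \<in> space N"
  shows "(\<lambda>\<omega>. g (path \<omega>)) \<in> M \<rightarrow>\<^sub>M N"
proof -
  have m: "(\<lambda>\<omega>. map (\<lambda>i. Z i \<omega>) [0..<Suc k]) \<in> M \<rightarrow>\<^sub>M count_space UNIV"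
  proof -
    have "(\<lambda>\<omega>. map (\<lambda>i. Z i \<omega>) [0..<Suc k]) -` {l} \<inter> space M \<in> sets M" for l
    proof (cases "length l = Suc k")
      case True
      then have "(\<lambda>\<omega>. map (\<lambda>i. Z i \<omega>) [0..<Suc k]) -` {l} \<inter> space M = {\<omega> \<in> space M. \<forall>i\<in>{..<Suc k}. Z i \<omega> = l ! i}"
        by (auto simp: list_eq_iff_nth_eq simp del: upt_Suc)
      then show ?thesis by simp
    next
      case False
      then have "(\<lambda>\<omega>. map (\<lambda>i. Z i \<omega>) [0..<Suc k]) -` {l} \<inter> space M = {}" by auto
      then show ?thesis by (simp only: sets.empty_sets)
    qed
    then show ?thesis by (simp add: measurable_count_space_eq2_countable)
  qed
  define g' where "g' l = g (\<lambda>i. if i < length l then l ! i else 0)" for l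
  have "g (path \<omega>) = g' (map (\<lambda>i. Z i \<omega>) [0..<Suc k])" for \<omega>
    unfolding g'_def by (rule depends_uptoD[OF assms(1)]) (auto simp: less_Suc_eq_le simp del: upt_Suc)
  moreover have "g' \<in> count_space UNIV \<rightarrow>\<^sub>M N" using assms(2) by (auto simp: g'_def)
  ultimately show ?thesis using measurable_compose[OF m] by simp
qed

lemma borel_measurable_past:
  "depends_upto k g \<Longrightarrow> (\<lambda>\<omega>. g (path \<omega>) :: 'b::topological_space) \<in> borel_measurable M"
  by (rule measurable_past) auto

lemma sets_past: "depends_upto k P \<Longrightarrow> {\<omega> \<in> space M. P (path \<omega>)} \<in> sets M"
  using measurable_past[of k P "count_space UNIV"] by (simp add: pred_def)

definition cyl :: "nat \<Rightarrow> (nat \<Rightarrow> int) \<Rightarrow> 'a set" where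
  "cyl k z = {\<omega> \<in> space M. \<forall>i\<le>k. Z i \<omega> = z i}"

lemma cyl_sets [measurable]: "cyl k z \<in> sets M"
  unfolding cyl_def by (rule sets_past[of k]) (auto intro!: depends_uptoI)

lemma prob_cyl_Suc: "prob (cyl (Suc k) z) = prob (cyl k z) * zero_lazy_kernel c (z k) (z (Suc k))"
proof (cases "prob (cyl k z) > 0")
  case True
  then have "\<P>(\<omega> in M. Z (Suc k) \<omega> = z (Suc k) \<bar> \<forall>i\<le>k. Z i \<omega> = z i) = zero_lazy_kernel c (z k) (z (Suc k))"
    using chain by (simp add: markov_chain_def cyl_def)
  moreover have "{\<omega> \<in> space M. Z (Suc k) \<omega> = z (Suc k) \<and> (\<forall>i\<le>k. Z i \<omega> = z i)} = cyl (Suc k) z"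
    by (auto simp: cyl_def le_Suc_eq)
  ultimately show ?thesis using True by (simp add: cond_prob_def cyl_def[of k, symmetric] field_simps)
next
  case False
  then have "prob (cyl k z) = 0" by (simp add: zero_less_measure_iff)
  moreover have "prob (cyl (Suc k) z) \<le> prob (cyl k z)"
    by (intro finite_measure_mono) (auto simp: cyl_def)
  ultimately show ?thesis by (simp add: measure_le_0_iff)
qed

text \<open>The trajectories with a long jump at a given time are covered by countably many cylinders, all of
  probability zero.\<close>

lemma AE_step: "AE \<omega> in M. \<forall>k. \<bar>Z (Suc k) \<omega> - Z k \<omega>\<bar> \<le> 1"
proof -
  have "AE \<omega> in M. \<forall>l :: int list. length l = Suc (Suc k) \<and> \<bar>l ! Suc k - l ! k\<bar> > 1 \<longrightarrow> \<omega> \<notin> cyl (Suc k) ((!) l)" for k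
    unfolding AE_all_countable
  proof
    fix l :: "int list"
    show "AE \<omega> in M. length l = Suc (Suc k) \<and> \<bar>l ! Suc k - l ! k\<bar> > 1 \<longrightarrow> \<omega> \<notin> cyl (Suc k) ((!) l)"
    proof (cases "\<bar>l ! Suc k - l ! k\<bar> > 1")
      case True
      then have "prob (cyl (Suc k) ((!) l)) = 0"
        unfolding prob_cyl_Suc by (auto simp: zero_lazy_kernel_def)
      then have "AE \<omega> in M. \<omega> \<notin> cyl (Suc k) ((!) l)"
        by (simp add: AE_iff_measurable[OF cyl_sets] emeasure_eq_measure prob_eq_0 AE_not_in null_setsI)
      then show ?thesis by auto
    qed auto
  qed
  then have "AE \<omega> in M. \<forall>k. \<forall>l :: int list. length l = Suc (Suc k) \<and> \<bar>l ! Suc k - l ! k\<bar> > 1 \<longrightarrow> \<omega> \<notin> cyl (Suc k) ((!) l)"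
    by (simp add: AE_all_countable)
  with AE_space show ?thesis
  proof eventually_elim
    case (elim \<omega>)
    show ?case
    proof (rule allI, rule ccontr)
      fix k assume *: "\<not> \<bar>Z (Suc k) \<omega> - Z k \<omega>\<bar> \<le> 1"
      let ?l = "map (\<lambda>i. Z i \<omega>) [0..<Suc (Suc k)]"
      have l: "?l ! i = Z i \<omega>" if "i \<le> Suc k" for i using that by (simp add: less_Suc_eq_le del: upt_Suc)
      have "\<omega> \<in> cyl (Suc k) ((!) ?l)" using elim(1) l by (auto simp: cyl_def)
      moreover have "length ?l = Suc (Suc k)" by simp
      moreover have "\<bar>?l ! Suc k - ?l ! k\<bar> > 1" using l[of k] l[of "Suc k"] * by simp
      ultimately show False using elim(2) by blast
    qed
  qed
qed

definition regular :: "'a set" where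
  "regular = {\<omega> \<in> space M. Z 0 \<omega> = 0 \<and> (\<forall>k. \<bar>Z (Suc k) \<omega> - Z k \<omega>\<bar> \<le> 1)}"

lemma regular_sets [measurable]: "regular \<in> sets M"
proof -
  have "{\<omega> \<in> space M. Z 0 \<omega> = 0 \<and> \<bar>Z (Suc k) \<omega> - Z k \<omega>\<bar> \<le> 1} \<in> sets M" for k
    by (rule sets_past[of "Suc k" "\<lambda>z. z 0 = 0 \<and> \<bar>z (Suc k) - z k\<bar> \<le> 1"]) (auto intro!: depends_uptoI)
  then have "{\<omega> \<in> space M. \<forall>k. Z 0 \<omega> = 0 \<and> \<bar>Z (Suc k) \<omega> - Z k \<omega>\<bar> \<le> 1} \<in> sets M"
    by (rule sets.sets_Collect_countable_All)
  then show ?thesis by (simp add: regular_def)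
qed

lemma AE_regular: "AE \<omega> in M. \<omega> \<in> regular"
  using start AE_step AE_space by eventually_elim (simp add: regular_def)

lemma prob_not_regular: "prob (space M - regular) = 0"
  using AE_regular by (subst prob_compl) (auto simp: prob_eq_1 regular_sets)

lemma regular_bounded:
  assumes "\<omega> \<in> regular" shows "\<bar>Z k \<omega>\<bar> \<le> int k"
proof (induction k)
  case 0 then show ?case using assms by (simp add: regular_def)
next
  case (Suc k)
  have "\<bar>Z (Suc k) \<omega> - Z k \<omega>\<bar> \<le> 1" using assms by (simp add: regular_def)
  with Suc show ?case by linarith
qed

text \<open>A regular trajectory has finitely many possible pasts up to time \<open>k\<close>, so that expectations of
  functions of the past are finite sums over cylinders.\<close>

definition pasts :: "nat \<Rightarrow> int list set" where
  "pasts k = {l. set l \<subseteq> {- int k..int k} \<and> length l = Suc k}"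

definition extend :: "int list \<Rightarrow> nat \<Rightarrow> int" where
  "extend l i = (if i < length l then l ! i else 0)"

lemma finite_pasts [simp]: "finite (pasts k)"
  unfolding pasts_def by (rule finite_lists_length_eq) simp

lemma past_expansion:
  fixes G :: "(nat \<Rightarrow> int) \<Rightarrow> 'b::real_vector"
  assumes G: "depends_upto k G" and w: "\<omega> \<in> regular"
  shows "G (path \<omega>) = (\<Sum>l\<in>pasts k. indicat_real (cyl k (extend l)) \<omega> *\<^sub>R G (extend l))"
proof -
  define l0 where "l0 = map (\<lambda>i. Z i \<omega>) [0..<Suc k]"
  have nth: "l0 ! i = Z i \<omega>" if "i \<le> k" for i using that by (simp add: l0_def less_Suc_eq_le del: upt_Suc)
  have l0: "l0 \<in> pasts k"
  proof -
    have "Z i \<omega> \<in> {- int k..int k}" if "i < Suc k" for i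
      using regular_bounded[OF w, of i] that by auto
    then show ?thesis by (auto simp: pasts_def l0_def simp del: upt_Suc)
  qed
  have ind: "indicat_real (cyl k (extend l)) \<omega> = (if l = l0 then 1 else 0)" if "l \<in> pasts k" for l
  proof -
    have "\<omega> \<in> cyl k (extend l) \<longleftrightarrow> (\<forall>i\<le>k. Z i \<omega> = l ! i)"
      using w that by (auto simp: cyl_def regular_def extend_def pasts_def)
    also have "\<dots> \<longleftrightarrow> l = l0"
      using that nth by (auto simp: list_eq_iff_nth_eq pasts_def less_Suc_eq_le l0_def simp del: upt_Suc)
    finally show ?thesis by (simp add: indicator_def)
  qed
  have "(\<Sum>l\<in>pasts k. indicat_real (cyl k (extend l)) \<omega> *\<^sub>R G (extend l)) =
      (\<Sum>l\<in>pasts k. if l = l0 then G (extend l) else 0)"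
    using ind by (intro sum.cong) auto
  also have "\<dots> = G (extend l0)" using l0 by simp
  also have "\<dots> = G (path \<omega>)"
    by (rule depends_uptoD[OF G]) (use nth in \<open>auto simp: extend_def l0_def less_Suc_eq_le simp del: upt_Suc\<close>)
  finally show ?thesis by simp
qed

lemma integrable_past:
  fixes g :: "(nat \<Rightarrow> int) \<Rightarrow> 'b::{banach, second_countable_topology}"
  assumes "depends_upto k g" shows "integrable M (\<lambda>\<omega>. g (path \<omega>))"
proof -
  have "integrable M (\<lambda>\<omega>. \<Sum>l\<in>pasts k. indicat_real (cyl k (extend l)) \<omega> *\<^sub>R g (extend l))"
    by (intro Bochner_Integration.integrable_sum integrable_scaleR_left) (auto simp: emeasure_eq_measure)
  then show ?thesis
    using borel_measurable_past[OF assms]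
    by (rule integrable_cong_AE_imp) (use AE_regular past_expansion[OF assms] in auto)
qed

lemma Ex_one_jump:
  fixes G :: "(nat \<Rightarrow> int) \<Rightarrow> 'b::{banach, second_countable_topology}"
  assumes G: "depends_upto k G"
  shows "Ex (\<lambda>z. of_bool (z (Suc k) = z k + d) *\<^sub>R G z) = Ex (\<lambda>z. zero_lazy_kernel c (z k) (z k + d) *\<^sub>R G z)"
proof -
  have "Ex (\<lambda>z. of_bool (z (Suc k) = z k + d) *\<^sub>R G z) =
      (\<integral>\<omega>. (\<Sum>l\<in>pasts k. indicat_real (cyl (Suc k) ((extend l)(Suc k := extend l k + d))) \<omega> *\<^sub>R G (extend l)) \<partial>M)"
  proof (rule integral_cong_AE)
    have "depends_upto (Suc k) (\<lambda>z. of_bool (z (Suc k) = z k + d) *\<^sub>R G z)"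
      using depends_upto_mono[OF G, of "Suc k"]
      by (rule depends_upto_comp2[where f = "(*\<^sub>R)", rotated]) (auto intro!: depends_uptoI)
    then show "(\<lambda>\<omega>. of_bool (Z (Suc k) \<omega> = Z k \<omega> + d) *\<^sub>R G (path \<omega>)) \<in> borel_measurable M"
      by (rule borel_measurable_past)
    show "AE \<omega> in M. of_bool (Z (Suc k) \<omega> = Z k \<omega> + d) *\<^sub>R G (path \<omega>) =
       (\<Sum>l\<in>pasts k. indicat_real (cyl (Suc k) ((extend l)(Suc k := extend l k + d))) \<omega> *\<^sub>R G (extend l))"
      using AE_regular
    proof eventually_elim
      case (elim \<omega>)
      have "indicat_real (cyl (Suc k) ((extend l)(Suc k := extend l k + d))) \<omega> =
          of_bool (Z (Suc k) \<omega> = Z k \<omega> + d) * indicat_real (cyl k (extend l)) \<omega>" for l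
        by (auto simp: cyl_def le_Suc_eq indicator_def)
      then show ?case by (subst past_expansion[OF G elim]) (simp add: scaleR_sum_right)
    qed
  qed (intro borel_measurable_sum borel_measurable_scaleR borel_measurable_const borel_measurable_indicator cyl_sets)
  also have "\<dots> = (\<Sum>l\<in>pasts k. prob (cyl (Suc k) ((extend l)(Suc k := extend l k + d))) *\<^sub>R G (extend l))"
    by (subst Bochner_Integration.integral_sum) (auto simp: emeasure_eq_measure)
  also have "\<dots> = (\<Sum>l\<in>pasts k. prob (cyl k (extend l)) *\<^sub>R zero_lazy_kernel c (extend l k) (extend l k + d) *\<^sub>R G (extend l))"
  proof (intro sum.cong refl)
    fix l
    have "cyl k ((extend l)(Suc k := extend l k + d)) = cyl k (extend l)" by (auto simp: cyl_def)
    then show "prob (cyl (Suc k) ((extend l)(Suc k := extend l k + d))) *\<^sub>R G (extend l) =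
        prob (cyl k (extend l)) *\<^sub>R zero_lazy_kernel c (extend l k) (extend l k + d) *\<^sub>R G (extend l)"
      by (simp add: prob_cyl_Suc)
  qed
  also have "\<dots> = (\<integral>\<omega>. (\<Sum>l\<in>pasts k. indicat_real (cyl k (extend l)) \<omega> *\<^sub>R
      zero_lazy_kernel c (extend l k) (extend l k + d) *\<^sub>R G (extend l)) \<partial>M)"
    by (subst Bochner_Integration.integral_sum) (auto simp: emeasure_eq_measure)
  also have "\<dots> = Ex (\<lambda>z. zero_lazy_kernel c (z k) (z k + d) *\<^sub>R G z)"
  proof (rule integral_cong_AE)
    have dep: "depends_upto k (\<lambda>z. zero_lazy_kernel c (z k) (z k + d) *\<^sub>R G z)"
      using G by (rule depends_upto_comp2[where f = "(*\<^sub>R)", rotated]) (auto intro!: depends_uptoI)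
    then show "(\<lambda>\<omega>. zero_lazy_kernel c (Z k \<omega>) (Z k \<omega> + d) *\<^sub>R G (path \<omega>)) \<in> borel_measurable M"
      by (rule borel_measurable_past)
    show "AE \<omega> in M. (\<Sum>l\<in>pasts k. indicat_real (cyl k (extend l)) \<omega> *\<^sub>R
      zero_lazy_kernel c (extend l k) (extend l k + d) *\<^sub>R G (extend l)) =
       zero_lazy_kernel c (Z k \<omega>) (Z k \<omega> + d) *\<^sub>R G (path \<omega>)"
      using AE_regular by eventually_elim (simp add: past_expansion[OF dep])
  qed (intro borel_measurable_sum borel_measurable_scaleR borel_measurable_const borel_measurable_indicator cyl_sets)
  finally show ?thesis .
qed

text \<open>The Markov property. Splitting the expectation according to the next jump, which is \<open>-1\<close>, \<open>0\<close> or
  \<open>1\<close>, turns a function of the walk up to time \<open>k + 1\<close> into functions of its past.\<close>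

proposition one_step:
  fixes g :: "(nat \<Rightarrow> int) \<Rightarrow> 'b::{banach, second_countable_topology}"
  assumes g: "depends_upto (Suc k) g"
  shows "Ex g = Ex (step c k g)"
proof -
  define G where "G d z = g (z(Suc k := z k + d))" for d z
  have G: "depends_upto k (G d)" for d
    unfolding G_def by (rule depends_upto_update[OF g]) (auto intro!: depends_uptoI)
  have GS: "depends_upto (Suc k) (\<lambda>z. of_bool (z (Suc k) = z k + d) *\<^sub>R G d z)" for d
    using depends_upto_mono[OF G, of "Suc k"]
    by (rule depends_upto_comp2[where f = "(*\<^sub>R)", rotated]) (auto intro!: depends_uptoI)
  have GK: "depends_upto k (\<lambda>z. zero_lazy_kernel c (z k) (z k + d) *\<^sub>R G d z)" for d
    using G by (rule depends_upto_comp2[where f = "(*\<^sub>R)", rotated]) (auto intro!: depends_uptoI)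
  have "Ex g = (\<integral>\<omega>. (\<Sum>d\<in>{-1,0,1}. of_bool (Z (Suc k) \<omega> = Z k \<omega> + d) *\<^sub>R G d (path \<omega>)) \<partial>M)"
  proof (rule integral_cong_AE)
    show "AE \<omega> in M. g (path \<omega>) = (\<Sum>d\<in>{-1,0,1}. of_bool (Z (Suc k) \<omega> = Z k \<omega> + d) *\<^sub>R G d (path \<omega>))"
      using AE_regular
    proof eventually_elim
      case (elim \<omega>)
      define e where "e = Z (Suc k) \<omega> - Z k \<omega>"
      have e: "e \<in> {-1,0,1}" using elim by (auto simp: regular_def e_def dest!: spec[of _ k])
      have "G e (path \<omega>) = g (path \<omega>)"
        unfolding G_def e_def by (rule arg_cong[of _ _ g]) auto
      moreover have "(\<Sum>d\<in>{-1,0,1}. of_bool (Z (Suc k) \<omega> = Z k \<omega> + d) *\<^sub>R G d (path \<omega>)) = G e (path \<omega>)"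
        using e by (auto simp: e_def)
      ultimately show ?case by simp
    qed
  qed (intro borel_measurable_past[OF g] borel_measurable_sum borel_measurable_past[OF GS])+
  also have "\<dots> = (\<Sum>d\<in>{-1,0,1}. Ex (\<lambda>z. of_bool (z (Suc k) = z k + d) *\<^sub>R G d z))"
    by (intro Bochner_Integration.integral_sum integrable_past[OF GS])
  also have "\<dots> = (\<Sum>d\<in>{-1,0,1}. Ex (\<lambda>z. zero_lazy_kernel c (z k) (z k + d) *\<^sub>R G d z))"
    by (intro sum.cong refl Ex_one_jump G)
  also have "\<dots> = (\<integral>\<omega>. (\<Sum>d\<in>{-1,0,1}. zero_lazy_kernel c (Z k \<omega>) (Z k \<omega> + d) *\<^sub>R G d (path \<omega>)) \<partial>M)"
    by (intro Bochner_Integration.integral_sum[symmetric] integrable_past[OF GK])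
  also have "\<dots> = Ex (step c k g)"
    by (intro Bochner_Integration.integral_cong refl) (simp add: step_def zero_lazy_kernel_def G_def scaleR_add_right)
  finally show ?thesis .
qed

end

lemma step_scaleR:
  assumes "depends_upto k G"
  shows "step c k (\<lambda>z. G z *\<^sub>R g z) z = G z *\<^sub>R step c k g z"
proof -
  have "G (z(Suc k := y)) = G z" for y by (rule depends_upto_fun_upd[OF assms]) simp
  then show ?thesis by (simp add: step_def algebra_simps)
qed

section \<open>Occupation times, maximal inequality and moments\<close>

text \<open>The absolute value, smoothed on \<open>[-a, a]\<close> into a discrete parabola. Its drift along the walk with
  \<open>c = 1/4\<close> is \<open>1 / (2 (a + 1))\<close> on this interval, including the origin, and zero elsewhere; hence
  its compensator is proportional to the occupation time of \<open>[-a, a]\<close>.\<close>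

definition tent :: "nat \<Rightarrow> int \<Rightarrow> real" where
  "tent a y = (if \<bar>y\<bar> \<le> int a then \<bar>real_of_int y\<bar> * (\<bar>real_of_int y\<bar> + 1) / (2 * (real a + 1))
     else \<bar>real_of_int y\<bar> - real a / 2)"

lemma tent_inside:
  assumes "\<bar>y\<bar> \<le> int a + 1"
  shows "tent a y = \<bar>real_of_int y\<bar> * (\<bar>real_of_int y\<bar> + 1) / (2 * (real a + 1))"
proof (cases "\<bar>y\<bar> \<le> int a")
  case False
  with assms have "\<bar>y\<bar> = int a + 1" by linarith
  then have "\<bar>real_of_int y\<bar> = real a + 1" by linarith
  then show ?thesis using False by (simp add: tent_def field_simps)
qed (simp add: tent_def)

lemma tent_outside:
  assumes "\<bar>y\<bar> \<ge> int a" shows "tent a y = \<bar>real_of_int y\<bar> - real a / 2"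
proof (cases "\<bar>y\<bar> = int a")
  case True
  then have "\<bar>real_of_int y\<bar> = real a" by linarith
  then show ?thesis using True by (simp add: tent_def field_simps)
qed (use assms in \<open>simp add: tent_def\<close>)

lemma tent_minus [simp]: "tent a (- y) = tent a y"
  by (simp add: tent_def)

lemma tent_bounds: "0 \<le> tent a y" "tent a y \<le> \<bar>real_of_int y\<bar>" "\<bar>real_of_int y\<bar> - real a / 2 \<le> tent a y"
proof -
  have "0 \<le> tent a y \<and> tent a y \<le> \<bar>real_of_int y\<bar> \<and> \<bar>real_of_int y\<bar> - real a / 2 \<le> tent a y"
  proof (cases "\<bar>y\<bar> \<le> int a")
    case True
    define x where "x = \<bar>real_of_int y\<bar>"
    have x: "0 \<le> x" "x \<le> real a" using True by (auto simp: x_def)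
    have t: "tent a y = x * (x + 1) / (2 * (real a + 1))" using True by (simp add: tent_def x_def)
    have "x * (x + 1) \<le> x * (2 * (real a + 1))" using x by (intro mult_left_mono) auto
    then have "tent a y \<le> x" unfolding t by (simp add: divide_le_eq)
    moreover have "(x - real a / 2) * (2 * (real a + 1)) \<le> x * (x + 1)"
    proof -
      have "0 \<le> (real a - x) * (real a - x) + (real a - x)" using x by (intro add_nonneg_nonneg mult_nonneg_nonneg) auto
      then show ?thesis by (simp add: algebra_simps)
    qed
    then have "x - real a / 2 \<le> tent a y" unfolding t by (subst le_divide_eq) auto
    moreover have "0 \<le> tent a y" unfolding t using x by simp
    ultimately show ?thesis by (simp add: x_def)
  next
    case False
    then have "real a < \<bar>real_of_int y\<bar>" by linarith
    with False show ?thesis by (simp add: tent_def)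
  qed
  then show "0 \<le> tent a y" "tent a y \<le> \<bar>real_of_int y\<bar>" "\<bar>real_of_int y\<bar> - real a / 2 \<le> tent a y" by auto
qed

lemma tent_drift:
  assumes "y \<noteq> 0"
  shows "(tent a (y + 1) + tent a (y - 1)) / 2 = tent a y + of_bool (\<bar>y\<bar> \<le> int a) / (2 * (real a + 1))"
proof -
  have pos: "(tent a (y + 1) + tent a (y - 1)) / 2 = tent a y + of_bool (\<bar>y\<bar> \<le> int a) / (2 * (real a + 1))"
    if "y > 0" for y :: int
  proof (cases "y \<le> int a")
    case True
    have t: "tent a (y + 1) = (real_of_int y + 1) * (real_of_int y + 2) / (2 * (real a + 1))"
      "tent a (y - 1) = (real_of_int y - 1) * real_of_int y / (2 * (real a + 1))"
      "tent a y = real_of_int y * (real_of_int y + 1) / (2 * (real a + 1))"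
      using True that by (simp_all add: tent_inside)
    have "((x + 1) * (x + 2) / D + (x - 1) * x / D) / 2 = x * (x + 1) / D + 1 / D" if "D > 0" for x D :: real
      using that by (simp add: field_simps)
    moreover have "of_bool (\<bar>y\<bar> \<le> int a) = (1 :: real)" using True that by simp
    ultimately show ?thesis unfolding t by simp
  next
    case False
    then have "tent a (y + 1) = real_of_int y + 1 - real a / 2" "tent a (y - 1) = real_of_int y - 1 - real a / 2"
      "tent a y = real_of_int y - real a / 2"
      using that by (simp_all add: tent_outside)
    with False that show ?thesis by (simp add: field_simps)
  qed
  show ?thesis
  proof (cases "y > 0")
    case False
    then have "- y > 0" using assms by simp
    moreover have "tent a (- y + 1) = tent a (y - 1)" using tent_minus[of a "y - 1"] by (simp del: tent_minus)
    moreover have "tent a (- y - 1) = tent a (y + 1)"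
      using tent_minus[of a "y + 1"] by (simp only: minus_add_distrib diff_conv_add_uminus)
    ultimately show ?thesis using pos[of "- y"] by (simp add: add.commute)
  qed (rule pos)
qed

lemma tent_at_0: "tent a 0 = 0" "tent a 1 = 1 / (real a + 1)" "tent a (- 1) = 1 / (real a + 1)"
  by (simp_all add: tent_inside field_simps)

definition occupation :: "nat \<Rightarrow> (nat \<Rightarrow> int) \<Rightarrow> nat \<Rightarrow> real" where
  "occupation a z k = (\<Sum>i<k. of_bool (\<bar>z i\<bar> \<le> int a))"

lemma occupation_Suc [simp]: "occupation a z (Suc k) = occupation a z k + of_bool (\<bar>z k\<bar> \<le> int a)"
  and occupation_0 [simp]: "occupation a z 0 = 0"
  by (simp_all add: occupation_def)

lemma depends_upto_occupation: "k \<le> Suc l \<Longrightarrow> depends_upto l (\<lambda>z. occupation a z k)"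
  by (rule depends_uptoI) (auto simp: occupation_def intro!: sum.cong)

lemma loops_at_0_Suc [simp]: "loops_at_0 z (Suc k) = loops_at_0 z k + of_bool (z k = 0 \<and> z (Suc k) = 0)"
  and loops_at_0_0 [simp]: "loops_at_0 z 0 = 0"
  by (simp_all add: loops_at_0_def)

lemma depends_upto_loops: "depends_upto k (\<lambda>z. loops_at_0 z k)"
  by (rule depends_uptoI) (auto simp: loops_at_0_def intro!: sum.cong)

lemma loops_le_occupation: "real (loops_at_0 z k) \<le> occupation 0 z k"
  by (induction k) auto

context zero_lazy_walk
begin

text \<open>Doob's inequality, by induction on the time horizon: the event that the level has been reached
  only gains, in one step, outcomes on which the submartingale is above the level.\<close>

lemma maximal_inequality:
  fixes u :: "nat \<Rightarrow> (nat \<Rightarrow> int) \<Rightarrow> real"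
  assumes u: "\<And>k. depends_upto k (u k)" and nonneg: "\<And>k z. 0 \<le> u k z"
    and sub: "\<And>k z. u k z \<le> step c k (u (Suc k)) z" and "\<eta> > 0"
  shows "prob {\<omega> \<in> space M. \<exists>k\<le>n. \<eta> \<le> u k (path \<omega>)} \<le> Ex (u n) / \<eta>"
proof -
  define I where "I n z = (of_bool (\<exists>k\<le>n. \<eta> \<le> u k z) :: real)" for n z
  have I: "depends_upto n (I n)" for n
  proof (rule depends_uptoI)
    fix z z' :: "nat \<Rightarrow> int" assume "\<And>i. i \<le> n \<Longrightarrow> z i = z' i"
    then have "u k z = u k z'" if "k \<le> n" for k
      using that by (intro depends_uptoD[OF u[of k]]) auto
    then show "I n z = I n z'" by (simp add: I_def cong: conj_cong)
  qed
  have Iu: "depends_upto n (\<lambda>z. I n z * u n z)" for n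
    by (rule depends_upto_comp2[OF I u])
  have Iu': "depends_upto (Suc n) (\<lambda>z. I n z *\<^sub>R u (Suc n) z)" for n
    by (rule depends_upto_comp2[OF depends_upto_mono[OF I] u]) simp
  have "\<eta> * Ex (I n) \<le> Ex (\<lambda>z. I n z * u n z)"
  proof (induction n)
    case 0
    have "Ex (\<lambda>z. \<eta> * I 0 z) \<le> Ex (\<lambda>z. I 0 z * u 0 z)"
      by (intro integral_mono integrable_past[OF Iu] integrable_mult_right integrable_past[OF I]) (auto simp: I_def)
    then show ?case by simp
  next
    case (Suc n)
    have int: "integrable M (\<lambda>\<omega>. I n (path \<omega>))" "integrable M (\<lambda>\<omega>. I (Suc n) (path \<omega>))" "integrable M (\<lambda>\<omega>. I n (path \<omega>) *\<^sub>R u (Suc n) (path \<omega>))"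
      by (rule integrable_past[OF I] integrable_past[OF Iu'])+
    have "\<eta> * Ex (I (Suc n)) = \<eta> * Ex (I n) + \<eta> * Ex (\<lambda>z. I (Suc n) z - I n z)"
      using int by (simp add: algebra_simps)
    also have "\<eta> * Ex (I n) \<le> Ex (\<lambda>z. I n z * u n z)" by fact
    also have "\<dots> \<le> Ex (step c n (\<lambda>z. I n z *\<^sub>R u (Suc n) z))"
    proof (intro integral_mono integrable_past[OF Iu] integrable_past[OF depends_upto_step[OF Iu']])
      fix \<omega>
      show "I n (path \<omega>) * u n (path \<omega>) \<le> step c n (\<lambda>z. I n z *\<^sub>R u (Suc n) z) (path \<omega>)"
        unfolding step_scaleR[OF I] using sub by (auto simp: I_def)
    qed
    also have "\<dots> = Ex (\<lambda>z. I n z *\<^sub>R u (Suc n) z)" by (rule one_step[OF Iu', symmetric])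
    also have "\<dots> + \<eta> * Ex (\<lambda>z. I (Suc n) z - I n z) = Ex (\<lambda>z. I n z *\<^sub>R u (Suc n) z + \<eta> * (I (Suc n) z - I n z))"
      using int by (subst Bochner_Integration.integral_add) (auto intro!: integrable_mult_right Bochner_Integration.integrable_diff)
    also have "\<dots> \<le> Ex (\<lambda>z. I (Suc n) z * u (Suc n) z)"
    proof (intro integral_mono integrable_past[OF Iu] Bochner_Integration.integrable_add integrable_mult_right Bochner_Integration.integrable_diff int)
      fix \<omega>
      show "I n (path \<omega>) *\<^sub>R u (Suc n) (path \<omega>) + \<eta> * (I (Suc n) (path \<omega>) - I n (path \<omega>)) \<le> I (Suc n) (path \<omega>) * u (Suc n) (path \<omega>)"
        using nonneg[of "Suc n" "path \<omega>"] by (auto simp: I_def le_Suc_eq)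
    qed
    finally show ?case by simp
  qed
  also have "Ex (\<lambda>z. I n z * u n z) \<le> Ex (u n)"
    by (intro integral_mono integrable_past[OF Iu] integrable_past[OF u]) (auto simp: I_def nonneg)
  finally have bound: "Ex (I n) \<le> Ex (u n) / \<eta>" using \<open>\<eta> > 0\<close> by (simp add: field_simps)
  have "Ex (I n) = prob {\<omega> \<in> space M. \<exists>k\<le>n. \<eta> \<le> u k (path \<omega>)}"
  proof -
    have "depends_upto n (\<lambda>z. \<exists>k\<le>n. \<eta> \<le> u k z)"
    proof (rule depends_uptoI)
      fix z z' :: "nat \<Rightarrow> int" assume "\<And>i. i \<le> n \<Longrightarrow> z i = z' i"
      then have "I n z = I n z'" by (rule depends_uptoD[OF I])
      then show "(\<exists>k\<le>n. \<eta> \<le> u k z) = (\<exists>k\<le>n. \<eta> \<le> u k z')" by (simp add: I_def of_bool_eq_iff)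
    qed
    then have "{\<omega> \<in> space M. \<exists>k\<le>n. \<eta> \<le> u k (path \<omega>)} \<in> sets M" (is "?S \<in> _") by (rule sets_past)
    have "I n (path \<omega>) = indicator ?S \<omega>" if "\<omega> \<in> space M" for \<omega>
      using that by (auto simp: I_def indicator_def)
    then have "Ex (I n) = integral\<^sup>L M (indicator ?S)"
      by (intro Bochner_Integration.integral_cong refl)
    also have "\<dots> = prob (?S \<inter> space M)" by (rule Bochner_Integration.integral_indicator)
    also have "?S \<inter> space M = ?S" by blast
    finally show ?thesis .
  qed
  with bound show ?thesis by (simp only:)
qed

definition increment :: "nat \<Rightarrow> nat \<Rightarrow> (nat \<Rightarrow> int) \<Rightarrow> real" where
  "increment k l z = real_of_int (z l - z k)"

lemma depends_upto_increment: "k \<le> n \<Longrightarrow> l \<le> n \<Longrightarrow> depends_upto n (\<lambda>z. f (increment k l z))"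
  by (rule depends_uptoI) (simp add: increment_def)

lemma step_increment:
  assumes "k \<le> l"
  shows "step c l (\<lambda>z. f (increment k (Suc l) z)) z = (1 - 2 * jump_rate c (z l)) *\<^sub>R f (increment k l z) +
     jump_rate c (z l) *\<^sub>R (f (increment k l z + 1) + f (increment k l z - 1))"
  using assms by (simp add: step_def increment_def algebra_simps)

lemma Ex_increment_square: "k \<le> l \<Longrightarrow> Ex (\<lambda>z. (increment k l z)\<^sup>2) \<le> real (l - k)"
proof (induction l rule: dec_induct)
  case base then show ?case by (simp add: increment_def)
next
  case (step l)
  have "Ex (\<lambda>z. (increment k (Suc l) z)\<^sup>2) = Ex (step c l (\<lambda>z. (increment k (Suc l) z)\<^sup>2))"
    using step by (intro one_step depends_upto_increment) auto
  also have "\<dots> \<le> Ex (\<lambda>z. (increment k l z)\<^sup>2 + 1)"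
  proof (intro integral_mono integrable_past[OF depends_upto_step] Bochner_Integration.integrable_add integrable_past[OF depends_upto_increment[of _ l]] depends_upto_increment)
    fix \<omega>
    have "step c l (\<lambda>z. (increment k (Suc l) z)\<^sup>2) (path \<omega>) = (increment k l (path \<omega>))\<^sup>2 + 2 * jump_rate c (Z l \<omega>)"
      using step by (subst step_increment) (auto simp: power2_eq_square algebra_simps)
    also have "\<dots> \<le> (increment k l (path \<omega>))\<^sup>2 + 1" using jump_rate_bounds(2)[of "Z l \<omega>"] by simp
    finally show "step c l (\<lambda>z. (increment k (Suc l) z)\<^sup>2) (path \<omega>) \<le> (increment k l (path \<omega>))\<^sup>2 + 1" .
  qed (use step in auto)
  also have "\<dots> = Ex (\<lambda>z. (increment k l z)\<^sup>2) + 1"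
    using step by (subst Bochner_Integration.integral_add) (auto simp: prob_space intro!: integrable_past[OF depends_upto_increment[of _ l]])
  finally show ?case using step by (simp add: Suc_diff_le)
qed

text \<open>In one step the fourth power of an increment grows by at most \<open>6 v\<^sup>2 + 1\<close> in mean, and the mean of
  \<open>v\<^sup>2\<close> grows at most linearly; laziness only helps.\<close>

lemma Ex_increment_fourth: "k \<le> l \<Longrightarrow> Ex (\<lambda>z. (increment k l z)^4) \<le> 3 * (real (l - k))\<^sup>2"
proof (induction l rule: dec_induct)
  case base then show ?case by (simp add: increment_def)
next
  case (step l)
  have int: "integrable M (\<lambda>\<omega>. (increment k l (path \<omega>))^4)" "integrable M (\<lambda>\<omega>. (increment k l (path \<omega>))\<^sup>2)"
    using step by (auto intro!: integrable_past[OF depends_upto_increment[of _ l]])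
  have "Ex (\<lambda>z. (increment k (Suc l) z)^4) = Ex (step c l (\<lambda>z. (increment k (Suc l) z)^4))"
    using step by (intro one_step depends_upto_increment) auto
  also have "\<dots> \<le> Ex (\<lambda>z. (increment k l z)^4 + (6 * (increment k l z)\<^sup>2 + 1))"
  proof (intro integral_mono integrable_past[OF depends_upto_step] Bochner_Integration.integrable_add int integrable_mult_right depends_upto_increment)
    fix \<omega>
    define r where "r = jump_rate c (Z l \<omega>)"
    define v where "v = increment k l (path \<omega>)"
    have "step c l (\<lambda>z. (increment k (Suc l) z)^4) (path \<omega>) = v^4 + 2 * r * (6 * v\<^sup>2 + 1)"
      using step by (subst step_increment) (auto simp: power4_eq_xxxx power2_eq_square algebra_simps r_def v_def)
    also have "2 * r * (6 * v\<^sup>2 + 1) \<le> 1 * (6 * v\<^sup>2 + 1)"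
      using jump_rate_bounds(2)[of "Z l \<omega>"] by (intro mult_right_mono) (auto simp: r_def)
    finally show "step c l (\<lambda>z. (increment k (Suc l) z)^4) (path \<omega>) \<le> (increment k l (path \<omega>))^4 + (6 * (increment k l (path \<omega>))\<^sup>2 + 1)"
      by (simp add: v_def)
  qed (use step in auto)
  also have "\<dots> = Ex (\<lambda>z. (increment k l z)^4) + (6 * Ex (\<lambda>z. (increment k l z)\<^sup>2) + 1)"
    using int by (simp add: prob_space)
  also have "\<dots> \<le> 3 * (real (l - k))\<^sup>2 + (6 * real (l - k) + 1)"
    using step Ex_increment_square[of k l] by (intro add_mono) auto
  also have "\<dots> \<le> 3 * (real (Suc l - k))\<^sup>2"
    using step by (simp add: Suc_diff_le power2_eq_square algebra_simps)
  finally show ?case .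
qed

lemma Ex_abs_le: "Ex (\<lambda>z. \<bar>real_of_int (z k)\<bar>) \<le> sqrt (real k)"
proof -
  have "Ex (\<lambda>z. \<bar>real_of_int (z k)\<bar>) = Ex (\<lambda>z. \<bar>increment 0 k z\<bar>)"
  proof (rule integral_cong_AE)
    show "(\<lambda>\<omega>. \<bar>real_of_int (Z k \<omega>)\<bar>) \<in> borel_measurable M"
      by (rule borel_measurable_past[of k "\<lambda>z. \<bar>real_of_int (z k)\<bar>"]) (auto intro!: depends_uptoI)
    show "(\<lambda>\<omega>. \<bar>increment 0 k (path \<omega>)\<bar>) \<in> borel_measurable M"
      by (rule borel_measurable_past[OF depends_upto_increment[of 0 k k]]) auto
    show "AE \<omega> in M. \<bar>real_of_int (Z k \<omega>)\<bar> = \<bar>increment 0 k (path \<omega>)\<bar>"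
      using start by eventually_elim (simp add: increment_def)
  qed
  also have "\<dots> \<le> sqrt (real k)"
  proof (cases "k = 0")
    case False
    have int: "integrable M (\<lambda>\<omega>. f (increment 0 k (path \<omega>)))" for f :: "real \<Rightarrow> real"
      by (rule integrable_past[OF depends_upto_increment[of 0 k k]]) auto
    define s where "s = sqrt (real k)"
    have s: "s > 0" "s * s = real k" using False by (auto simp: s_def)
    \<comment> \<open>The inequality \<open>2 v s \<le> v\<^sup>2 + s\<^sup>2\<close>, where the choice \<open>s = sqrt k\<close> balances both terms.\<close>
    have "Ex (\<lambda>z. \<bar>increment 0 k z\<bar>) \<le> Ex (\<lambda>z. (increment 0 k z)\<^sup>2 / (2 * s) + s / 2)"
    proof (intro integral_mono int)
      fix \<omega>
      define v where "v = \<bar>increment 0 k (path \<omega>)\<bar>"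
      have "0 \<le> (v - s)\<^sup>2" by simp
      then have "v * (2 * s) \<le> v\<^sup>2 + s * s" by (simp add: power2_eq_square algebra_simps)
      then have "v \<le> (v\<^sup>2 + s * s) / (2 * s)" using s by (simp add: le_divide_eq)
      also have "\<dots> = v\<^sup>2 / (2 * s) + s / 2" using s by (simp add: field_simps)
      finally show "\<bar>increment 0 k (path \<omega>)\<bar> \<le> (increment 0 k (path \<omega>))\<^sup>2 / (2 * s) + s / 2"
        by (simp add: v_def)
    qed
    also have "\<dots> = Ex (\<lambda>z. (increment 0 k z)\<^sup>2) / (2 * s) + s / 2"
      using int[of "\<lambda>v. v\<^sup>2"] by (simp add: prob_space)
    also have "\<dots> \<le> s * s / (2 * s) + s / 2"
      using Ex_increment_square[of 0 k] s by (intro add_mono divide_right_mono) auto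
    also have "\<dots> = s" using s(1) by simp
    finally show ?thesis using s by (simp add: s_def)
  qed (simp add: increment_def)
  finally show ?thesis .
qed

text \<open>The fourth power gives a bound quadratic in the length \<open>b\<close>, which is still small after summation over
  a number of blocks inversely proportional to their length.\<close>

lemma maximal_increment:
  assumes "\<eta> > 0"
  shows "prob {\<omega> \<in> space M. \<exists>i\<le>b. \<eta> \<le> \<bar>real_of_int (Z (k + i) \<omega> - Z k \<omega>)\<bar>} \<le> 3 * (real b)\<^sup>2 / \<eta>^4"
proof -
  \<comment> \<open>Set to \<open>0\<close> up to time \<open>k\<close>, so as to have a submartingale from time \<open>0\<close> on.\<close>
  define u where "u l z = (if l \<le> k then 0 else (increment k l z)^4)" for l z
  have dep: "depends_upto l (u l)" for l
    by (rule depends_uptoI) (auto simp: u_def increment_def)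
  have "prob {\<omega> \<in> space M. \<exists>l\<le>k + b. \<eta>^4 \<le> u l (path \<omega>)} \<le> Ex (u (k + b)) / \<eta>^4"
  proof (rule maximal_inequality[OF dep])
    show "0 \<le> u l z" for l z by (simp add: u_def)
    show "u l z \<le> step c l (u (Suc l)) z" for l z
    proof (cases "k \<le> l")
      case True
      have "u l z = (increment k l z)^4" using True by (cases "l = k") (auto simp: u_def increment_def)
      also have "\<dots> \<le> (increment k l z)^4 + 2 * jump_rate c (z l) * (6 * (increment k l z)\<^sup>2 + 1)"
        using jump_rate_bounds(1)[of "z l"] by simp
      also have "\<dots> = step c l (\<lambda>z. (increment k (Suc l) z)^4) z"
        using True by (subst step_increment) (auto simp: power4_eq_xxxx power2_eq_square algebra_simps)
      also have "(\<lambda>z. (increment k (Suc l) z)^4) = u (Suc l)" using True by (auto simp: u_def)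
      finally show ?thesis .
    qed (auto simp: u_def step_def)
    show "0 < \<eta>^4" using assms by simp
  qed
  also have "Ex (u (k + b)) \<le> 3 * (real b)\<^sup>2"
    using Ex_increment_fourth[of k "k + b"] by (cases "b = 0") (auto simp: u_def)
  also have "{\<omega> \<in> space M. \<exists>l\<le>k + b. \<eta>^4 \<le> u l (path \<omega>)} = {\<omega> \<in> space M. \<exists>i\<le>b. \<eta> \<le> \<bar>real_of_int (Z (k + i) \<omega> - Z k \<omega>)\<bar>}"
  proof -
    have eq: "\<eta>^4 \<le> x^4 \<longleftrightarrow> \<eta> \<le> \<bar>x\<bar>" for x :: real
      using power_mono_iff[of \<eta> "\<bar>x\<bar>" 4] assms by simp
    have "(\<exists>l\<le>k + b. \<eta>^4 \<le> u l z) \<longleftrightarrow> (\<exists>i\<le>b. \<eta> \<le> \<bar>real_of_int (z (k + i) - z k)\<bar>)" for z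
    proof
      assume "\<exists>l\<le>k + b. \<eta>^4 \<le> u l z"
      then obtain l where l: "l \<le> k + b" "\<eta>^4 \<le> u l z" by blast
      moreover have "\<eta>^4 > 0" using assms by simp
      ultimately have "k < l" by (auto simp: u_def split: if_splits)
      with l show "\<exists>i\<le>b. \<eta> \<le> \<bar>real_of_int (z (k + i) - z k)\<bar>"
        by (intro exI[of _ "l - k"]) (auto simp: u_def eq increment_def)
    next
      assume "\<exists>i\<le>b. \<eta> \<le> \<bar>real_of_int (z (k + i) - z k)\<bar>"
      then obtain i where i: "i \<le> b" "\<eta> \<le> \<bar>real_of_int (z (k + i) - z k)\<bar>" by blast
      then have "i \<noteq> 0" using assms by (intro notI) simp
      with i show "\<exists>l\<le>k + b. \<eta>^4 \<le> u l z"
        by (intro exI[of _ "k + i"]) (auto simp: u_def eq increment_def)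
    qed
    then show ?thesis by simp
  qed
  finally show ?thesis using assms by (simp add: divide_right_mono)
qed

text \<open>The tent function of the walk minus the normalised occupation time is a submartingale. At the origin
  this is the assumption \<open>1/4 \<le> c\<close>; elsewhere it is even a martingale.\<close>

lemma Ex_occupation_le: "Ex (\<lambda>z. occupation a z k) \<le> 2 * (real a + 1) * sqrt (real k)"
proof -
  have dt: "depends_upto k (\<lambda>z. tent a (z k))" for k by (rule depends_uptoI) simp
  have do: "depends_upto k (\<lambda>z. occupation a z k)" for k by (rule depends_upto_occupation) simp
  have "Ex (\<lambda>z. occupation a z k) / (2 * (real a + 1)) \<le> Ex (\<lambda>z. tent a (z k))"
  proof (induction k)
    case 0 then show ?case by (simp add: tent_bounds)
  next
    case (Suc k)
    have di: "depends_upto k (\<lambda>z. of_bool (\<bar>z k\<bar> \<le> int a) :: real)" by (auto intro!: depends_uptoI)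
    have dt': "depends_upto (Suc k) (\<lambda>z. tent a (z (Suc k)))" by (rule dt)
    have "Ex (\<lambda>z. occupation a z (Suc k)) / (2 * (real a + 1)) =
        Ex (\<lambda>z. occupation a z k) / (2 * (real a + 1)) + Ex (\<lambda>z. of_bool (\<bar>z k\<bar> \<le> int a)) / (2 * (real a + 1))"
      using integrable_past[OF do] integrable_past[OF di] by (simp add: add_divide_distrib)
    also have "\<dots> \<le> Ex (\<lambda>z. tent a (z k)) + Ex (\<lambda>z. of_bool (\<bar>z k\<bar> \<le> int a)) / (2 * (real a + 1))"
      using Suc by simp
    also have "\<dots> = Ex (\<lambda>z. tent a (z k) + of_bool (\<bar>z k\<bar> \<le> int a) / (2 * (real a + 1)))"
      using integrable_past[OF dt] integrable_past[OF di] by simp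
    also have "\<dots> \<le> Ex (step c k (\<lambda>z. tent a (z (Suc k))))"
    proof (intro integral_mono Bochner_Integration.integrable_add integrable_past[OF dt] integrable_divide integrable_past[OF di] integrable_past[OF depends_upto_step[OF dt']])
      fix \<omega>
      show "tent a (Z k \<omega>) + of_bool (\<bar>Z k \<omega>\<bar> \<le> int a) / (2 * (real a + 1)) \<le> step c k (\<lambda>z. tent a (z (Suc k))) (path \<omega>)"
      proof (cases "Z k \<omega> = 0")
        case True
        then have "step c k (\<lambda>z. tent a (z (Suc k))) (path \<omega>) = 2 * c / (real a + 1)"
          by (simp add: step_def jump_rate_def tent_at_0 field_simps)
        moreover have "1 / (2 * (real a + 1)) \<le> 2 * c / (real a + 1)"
          using c divide_right_mono[of "1 / 2" "2 * c" "real a + 1"] by simp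
        ultimately show ?thesis using True by (simp add: tent_at_0)
      next
        case False
        then show ?thesis using tent_drift[OF False, of a] by (simp add: step_def jump_rate_def)
      qed
    qed
    also have "\<dots> = Ex (\<lambda>z. tent a (z (Suc k)))" by (rule one_step[OF dt', symmetric])
    finally show ?case .
  qed
  also have "\<dots> \<le> Ex (\<lambda>z. \<bar>real_of_int (z k)\<bar>)"
  proof (intro integral_mono integrable_past[OF dt] tent_bounds)
    show "integrable M (\<lambda>\<omega>. \<bar>real_of_int (Z k \<omega>)\<bar>)"
      by (rule integrable_past[of k "\<lambda>z. \<bar>real_of_int (z k)\<bar>"]) (auto intro!: depends_uptoI)
  qed
  also have "\<dots> \<le> sqrt (real k)" by (rule Ex_abs_le)
  finally show ?thesis by (simp add: field_simps)
qed

end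

section \<open>Loops at the origin and occupation times\<close>

lemma tent_lipschitz:
  assumes "\<bar>x\<bar> \<le> int a" "\<bar>y - x\<bar> \<le> 1" shows "\<bar>tent a y - tent a x\<bar> \<le> 1"
proof -
  define u v where "u = \<bar>real_of_int x\<bar>" and "v = \<bar>real_of_int y\<bar>"
  have uv: "\<bar>v - u\<bar> \<le> 1" "0 \<le> u" "0 \<le> v" "u \<le> real a" "v \<le> real a + 1" using assms unfolding u_def v_def by linarith+
  have "tent a x = u * (u + 1) / (2 * (real a + 1))" "tent a y = v * (v + 1) / (2 * (real a + 1))"
    using assms by (simp_all add: tent_inside u_def v_def)
  then have "tent a y - tent a x = (v - u) * ((u + v + 1) / (2 * (real a + 1)))"
    by (simp add: diff_divide_distrib[symmetric] algebra_simps)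
  also have "\<bar>\<dots>\<bar> = \<bar>v - u\<bar> * ((u + v + 1) / (2 * (real a + 1)))" using uv by (simp add: abs_mult)
  also have "\<dots> \<le> 1 * 1" using uv by (intro mult_mono) (auto simp: divide_le_eq_1)
  finally show ?thesis by simp
qed

text \<open>For the walk of the comb this is a martingale: \<open>\<bar>z\<bar> - loops\<close> is one since both terms drift by
  \<open>1/2\<close> at each visit to the origin, and \<open>tent - occupation / (2 (a + 1))\<close> is one by construction.
  Its increments vanish outside \<open>[-a, a]\<close> because \<open>\<bar>y\<bar> - tent a y\<close> is constant there; its
  second moment is therefore at most proportional to the expected occupation time, hence of order
  \<open>(a + 1) sqrt k\<close> at time \<open>k\<close>.\<close>

definition loop_martingale :: "nat \<Rightarrow> nat \<Rightarrow> (nat \<Rightarrow> int) \<Rightarrow> real" where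
  "loop_martingale a k z = \<bar>real_of_int (z k)\<bar> - tent a (z k) - real (loops_at_0 z k)
     + occupation a z k / (2 * (real a + 1))"

lemma depends_upto_loop_martingale: "depends_upto k (loop_martingale a k)"
proof (rule depends_uptoI)
  fix z z' :: "nat \<Rightarrow> int" assume z: "\<And>i. i \<le> k \<Longrightarrow> z i = z' i"
  have "loops_at_0 z k = loops_at_0 z' k" by (rule depends_uptoD[OF depends_upto_loops z])
  moreover have "occupation a z k = occupation a z' k"
    by (rule depends_uptoD[OF depends_upto_occupation[of k k] z]) simp
  moreover have "z k = z' k" by (rule z) simp
  ultimately show "loop_martingale a k z = loop_martingale a k z'" by (simp add: loop_martingale_def)
qed

lemma loop_martingale_update:
  "loop_martingale a (Suc k) (z(Suc k := y)) = loop_martingale a k z +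
     ((\<bar>real_of_int y\<bar> - tent a y) - (\<bar>real_of_int (z k)\<bar> - tent a (z k)) - of_bool (z k = 0 \<and> y = 0)
      + of_bool (\<bar>z k\<bar> \<le> int a) / (2 * (real a + 1)))"
proof -
  have "loops_at_0 (z(Suc k := y)) k = loops_at_0 z k"
    by (rule depends_upto_fun_upd[OF depends_upto_loops]) simp
  moreover have "occupation a (z(Suc k := y)) k = occupation a z k"
    by (rule depends_upto_fun_upd[OF depends_upto_occupation[of k k]]) auto
  ultimately show ?thesis by (simp add: loop_martingale_def add_divide_distrib)
qed

text \<open>Increments \<open>D\<close> of mean zero are orthogonal to the present value \<open>m\<close>.\<close>

lemma step_square:
  fixes g :: "(nat \<Rightarrow> int) \<Rightarrow> real"
  assumes g: "\<And>y. g (z(Suc k := y)) = m + D y"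
    and mean: "(1 - 2 * jump_rate c (z k)) * D (z k) + jump_rate c (z k) * (D (z k + 1) + D (z k - 1)) = 0"
  shows "step c k (\<lambda>z. (g z)\<^sup>2) z =
    m\<^sup>2 + ((1 - 2 * jump_rate c (z k)) * (D (z k))\<^sup>2 + jump_rate c (z k) * ((D (z k + 1))\<^sup>2 + (D (z k - 1))\<^sup>2))"
proof -
  define r where "r = jump_rate c (z k)"
  have "step c k (\<lambda>z. (g z)\<^sup>2) z = (1 - 2 * r) * (m + D (z k))\<^sup>2 + r * ((m + D (z k + 1))\<^sup>2 + (m + D (z k - 1))\<^sup>2)"
    by (simp add: step_def g r_def)
  also have "\<dots> = m\<^sup>2 + 2 * m * ((1 - 2 * r) * D (z k) + r * (D (z k + 1) + D (z k - 1)))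
      + ((1 - 2 * r) * (D (z k))\<^sup>2 + r * ((D (z k + 1))\<^sup>2 + (D (z k - 1))\<^sup>2))"
    by (simp add: power2_eq_square algebra_simps)
  finally show ?thesis using mean by (simp add: r_def)
qed

text \<open>The square is a submartingale, as the maximal inequality requires, and its growth is charged to the
  visits of \<open>[-a, a]\<close>.\<close>

lemma loop_martingale_square_step:
  shows "(loop_martingale a k z)\<^sup>2 \<le> step (1/4) k (\<lambda>z. (loop_martingale a (Suc k) z)\<^sup>2) z"
    and "step (1/4) k (\<lambda>z. (loop_martingale a (Suc k) z)\<^sup>2) z \<le> (loop_martingale a k z)\<^sup>2 + 16 * of_bool (\<bar>z k\<bar> \<le> int a)"
proof -
  define x where "x = z k"
  define r where "r = jump_rate (1/4) x"
  define q where "q = of_bool (\<bar>x\<bar> \<le> int a) / (2 * (real a + 1))"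
  define D where "D y = (\<bar>real_of_int y\<bar> - tent a y) - (\<bar>real_of_int x\<bar> - tent a x) - of_bool (x = 0 \<and> y = 0) + q" for y
  have r: "0 \<le> r" "r \<le> 1/2" by (auto simp: r_def jump_rate_def)
  have mean: "(1 - 2 * r) * D x + r * (D (x + 1) + D (x - 1)) = 0"
  proof (cases "x = 0")
    case True
    have "tent a 1 = 2 * q" "tent a (- 1) = 2 * q" unfolding tent_at_0 q_def using True by (simp_all add: field_simps)
    with True show ?thesis by (simp add: D_def r_def jump_rate_def tent_at_0(1) field_simps)
  next
    case False
    have "\<bar>real_of_int (x + 1)\<bar> + \<bar>real_of_int (x - 1)\<bar> = 2 * \<bar>real_of_int x\<bar>" using False by linarith
    moreover have "(tent a (x + 1) + tent a (x - 1)) / 2 = tent a x + q"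
      using tent_drift[OF False, of a] by (simp only: q_def)
    ultimately show ?thesis using False by (simp add: D_def r_def jump_rate_def)
  qed
  have eq: "step (1/4) k (\<lambda>z. (loop_martingale a (Suc k) z)\<^sup>2) z =
     (loop_martingale a k z)\<^sup>2 + ((1 - 2 * r) * (D x)\<^sup>2 + r * ((D (x + 1))\<^sup>2 + (D (x - 1))\<^sup>2))"
    unfolding r_def x_def
    by (rule step_square) (use mean in \<open>simp_all add: loop_martingale_update D_def r_def x_def q_def\<close>)
  show "(loop_martingale a k z)\<^sup>2 \<le> step (1/4) k (\<lambda>z. (loop_martingale a (Suc k) z)\<^sup>2) z"
    unfolding eq using r by simp
  have D: "(D y)\<^sup>2 \<le> 16 * of_bool (\<bar>x\<bar> \<le> int a)" if "\<bar>y - x\<bar> \<le> 1" for y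
  proof (cases "\<bar>x\<bar> \<le> int a")
    case True
    have "\<bar>\<bar>real_of_int y\<bar> - \<bar>real_of_int x\<bar>\<bar> \<le> 1" using that by linarith
    moreover have "\<bar>tent a y - tent a x\<bar> \<le> 1" by (rule tent_lipschitz[OF True that])
    moreover have "0 \<le> q" "q \<le> 1" by (auto simp: q_def divide_le_eq_1)
    moreover have "0 \<le> (of_bool (x = 0 \<and> y = 0) :: real)" "of_bool (x = 0 \<and> y = 0) \<le> (1 :: real)" by auto
    \<comment> \<open>Each of the four parts of the increment is at most one.\<close>
    ultimately have "\<bar>D y\<bar> \<le> 4" unfolding D_def by linarith
    then have "\<bar>D y\<bar>\<^sup>2 \<le> 4\<^sup>2" by (intro power_mono) auto
    then show ?thesis using True by simp
  next
    case False
    then have "\<bar>y\<bar> \<ge> int a" "\<bar>x\<bar> \<ge> int a" "x \<noteq> 0" using that by linarith+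
    then show ?thesis using False by (simp add: D_def q_def tent_outside)
  qed
  have "(1 - 2 * r) * (D x)\<^sup>2 + r * ((D (x + 1))\<^sup>2 + (D (x - 1))\<^sup>2) \<le>
      (1 - 2 * r) * (16 * of_bool (\<bar>x\<bar> \<le> int a)) + r * (16 * of_bool (\<bar>x\<bar> \<le> int a) + 16 * of_bool (\<bar>x\<bar> \<le> int a))"
    using r by (intro add_mono mult_left_mono D) auto
  also have "\<dots> = 16 * of_bool (\<bar>z k\<bar> \<le> int a)" by (simp add: algebra_simps x_def)
  finally show "step (1/4) k (\<lambda>z. (loop_martingale a (Suc k) z)\<^sup>2) z \<le> (loop_martingale a k z)\<^sup>2 + 16 * of_bool (\<bar>z k\<bar> \<le> int a)"
    unfolding eq by simp
qed

context zero_lazy_walk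
begin

lemma loop_martingale_maximal:
  assumes c: "c = 1/4" and \<eta>: "\<eta> > 0"
  shows "prob {\<omega> \<in> space M. \<exists>k\<le>n. \<eta> \<le> \<bar>loop_martingale a k (path \<omega>)\<bar>} \<le> 32 * (real a + 1) * sqrt (real n) / \<eta>\<^sup>2"
proof -
  define u where "u k z = (loop_martingale a k z)\<^sup>2" for k z
  have u: "depends_upto k (u k)" for k
    unfolding u_def by (rule depends_upto_comp2[OF depends_upto_loop_martingale depends_upto_const[of k "2::nat"]])
  have o: "depends_upto k (\<lambda>z. occupation a z k)" for k by (rule depends_upto_occupation) simp
  have mom: "Ex (u k) \<le> 16 * Ex (\<lambda>z. occupation a z k)" for k
  proof (induction k)
    case 0
    have "AE \<omega> in M. u 0 (path \<omega>) = 0"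
      using start by eventually_elim (simp add: u_def loop_martingale_def tent_at_0)
    then have "Ex (u 0) = (\<integral>\<omega>. 0 \<partial>M)" by (intro integral_cong_AE borel_measurable_past[OF u]) auto
    then show ?case by simp
  next
    case (Suc k)
    have di: "depends_upto k (\<lambda>z. of_bool (\<bar>z k\<bar> \<le> int a) :: real)" by (auto intro!: depends_uptoI)
    have "Ex (u (Suc k)) = Ex (step c k (u (Suc k)))" by (rule one_step[OF u])
    also have "\<dots> \<le> Ex (\<lambda>z. u k z + 16 * of_bool (\<bar>z k\<bar> \<le> int a))"
    proof (intro integral_mono Bochner_Integration.integrable_add integrable_mult_right
        integrable_past[OF u] integrable_past[OF di] integrable_past[OF depends_upto_step[OF u]])
      fix \<omega>
      have "u (Suc k) = (\<lambda>z. (loop_martingale a (Suc k) z)\<^sup>2)" by (simp add: u_def fun_eq_iff)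
      then show "step c k (u (Suc k)) (path \<omega>) \<le> u k (path \<omega>) + 16 * of_bool (\<bar>Z k \<omega>\<bar> \<le> int a)"
        using loop_martingale_square_step(2)[of k a "path \<omega>"] c by (simp only: u_def)
    qed
    also have "\<dots> = Ex (u k) + 16 * Ex (\<lambda>z. of_bool (\<bar>z k\<bar> \<le> int a))"
      using integrable_past[OF u[of k]] integrable_past[OF di] by simp
    also have "\<dots> \<le> 16 * Ex (\<lambda>z. occupation a z k) + 16 * Ex (\<lambda>z. of_bool (\<bar>z k\<bar> \<le> int a))" using Suc by simp
    also have "\<dots> = 16 * Ex (\<lambda>z. occupation a z (Suc k))"
      using integrable_past[OF o[of k]] integrable_past[OF di] by simp
    finally show ?case .
  qed
  have "prob {\<omega> \<in> space M. \<exists>k\<le>n. \<eta>\<^sup>2 \<le> u k (path \<omega>)} \<le> Ex (u n) / \<eta>\<^sup>2"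
  proof (rule maximal_inequality[OF u])
    have "u (Suc k) = (\<lambda>z. (loop_martingale a (Suc k) z)\<^sup>2)" for k by (simp add: u_def fun_eq_iff)
    then show "u k z \<le> step c k (u (Suc k)) z" for k z
      using loop_martingale_square_step(1)[of a k z] c by (simp only: u_def)
  qed (use \<eta> in \<open>auto simp: u_def\<close>)
  also have "\<dots> \<le> 16 * (2 * (real a + 1) * sqrt (real n)) / \<eta>\<^sup>2"
    using order_trans[OF mom[of n] mult_left_mono[OF Ex_occupation_le[of a n]]] by (intro divide_right_mono) auto
  also have "\<dots> = 32 * (real a + 1) * sqrt (real n) / \<eta>\<^sup>2" by simp
  also have "{\<omega> \<in> space M. \<exists>k\<le>n. \<eta>\<^sup>2 \<le> u k (path \<omega>)} = {\<omega> \<in> space M. \<exists>k\<le>n. \<eta> \<le> \<bar>loop_martingale a k (path \<omega>)\<bar>}"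
    using \<eta> by (simp add: u_def abs_le_square_iff[symmetric])
  finally show ?thesis .
qed

lemma Ex_loops_le: "Ex (\<lambda>z. real (loops_at_0 z k)) \<le> 2 * sqrt (real k)"
proof -
  have o: "depends_upto k (\<lambda>z. occupation 0 z k)" by (rule depends_upto_occupation) simp
  have l: "depends_upto k (\<lambda>z. real (loops_at_0 z k))"
    using depends_upto_comp2[OF depends_upto_loops depends_upto_const, of k "\<lambda>x y. real x"] .
  have "Ex (\<lambda>z. real (loops_at_0 z k)) \<le> Ex (\<lambda>z. occupation 0 z k)"
    by (intro integral_mono integrable_past[OF o] integrable_past[OF l] loops_le_occupation)
  then show ?thesis using Ex_occupation_le[of 0 k] by simp
qed

lemma prob_loops_large:
  assumes "h > 0" shows "prob {\<omega> \<in> space M. h \<le> real (loops_at_0 (path \<omega>) k)} \<le> 2 * sqrt (real k) / h"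
proof -
  have l: "depends_upto k (\<lambda>z. real (loops_at_0 z k))"
    using depends_upto_comp2[OF depends_upto_loops depends_upto_const, of k "\<lambda>x y. real x"] .
  have "prob {\<omega> \<in> space M. h \<le> real (loops_at_0 (path \<omega>) k)} \<le> Ex (\<lambda>z. real (loops_at_0 z k)) / h"
    using integral_Markov_inequality_measure[OF integrable_past[OF l], of "{}" h] assms by simp
  also have "\<dots> \<le> 2 * sqrt (real k) / h" using Ex_loops_le[of k] assms by (intro divide_right_mono) auto
  finally show ?thesis .
qed

end

section \<open>Gaussian fluctuations of the walk\<close>

lemma cos_minus_exp_bound: "\<bar>cos x - exp (- (x\<^sup>2 / 2))\<bar> \<le> x^4" for x :: real
proof -
  obtain t where "cos x = (\<Sum>m<4. cos_coeff m * x ^ m) + (cos (t + 1/2 * real 4 * pi) / fact 4) * x ^ 4"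
    using Maclaurin_cos_expansion[of x 4] by blast
  moreover have "(\<Sum>m<4. cos_coeff m * x ^ m) = cos_coeff 0 + cos_coeff 1 * x + cos_coeff 2 * x\<^sup>2 + cos_coeff 3 * x^3"
    by (simp add: eval_nat_numeral)
  moreover have "cos_coeff 0 = 1" "cos_coeff 1 = 0" "cos_coeff 2 = - 1 / 2" "cos_coeff 3 = 0"
    by (simp_all add: cos_coeff_def)
  moreover have "(fact 4 :: real) = 24" by (simp add: fact_numeral)
  ultimately have "cos x = 1 - x\<^sup>2 / 2 + (cos (t + 2 * pi) / 24) * x^4" by simp
  then have "\<bar>cos x - (1 - x\<^sup>2 / 2)\<bar> = \<bar>cos (t + 2 * pi)\<bar> / 24 * x^4" by (simp add: abs_mult)
  also have "\<dots> \<le> 1 / 24 * x^4" by (intro mult_right_mono divide_right_mono) auto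
  finally have 1: "\<bar>cos x - (1 - x\<^sup>2 / 2)\<bar> \<le> x^4 / 24" by simp
  define y where "y = x\<^sup>2 / 2"
  have y: "y \<ge> 0" by (simp add: y_def)
  have "1 - y \<le> exp (- y)" using exp_ge_add_one_self[of "- y"] by simp
  moreover have "exp (- y) \<le> 1 - y + y\<^sup>2"
  proof -
    have q: "1 + y + y\<^sup>2 / 2 \<le> exp y" using exp_lower_Taylor_quadratic[OF y] by simp
    have p: "0 \<le> 1 - y + y\<^sup>2" using sum_squares_ge_zero[of "y - 1/2" 0] by (simp add: power2_eq_square algebra_simps)
    have "1 \<le> 1 + y\<^sup>2 / 2 + y^3 / 2 + y^4 / 2" using y by simp
    also have "\<dots> = (1 - y + y\<^sup>2) * (1 + y + y\<^sup>2 / 2)" by (simp add: field_simps eval_nat_numeral)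
    also have "\<dots> \<le> (1 - y + y\<^sup>2) * exp y" using p q by (intro mult_left_mono)
    finally have "1 * exp (- y) \<le> (1 - y + y\<^sup>2) * exp y * exp (- y)" by (intro mult_right_mono) auto
    then show ?thesis by (simp add: mult.assoc flip: exp_add)
  qed
  ultimately have "\<bar>(1 - y) - exp (- y)\<bar> \<le> y\<^sup>2" by linarith
  also have "y\<^sup>2 = x^4 / 4" by (simp add: y_def power2_eq_square eval_nat_numeral)
  finally have "\<bar>(1 - x\<^sup>2 / 2) - exp (- (x\<^sup>2 / 2))\<bar> \<le> x^4 / 4" by (simp add: y_def)
  moreover have "0 \<le> x^4" by simp
  ultimately show ?thesis using 1 by linarith
qed

lemma one_minus_cos_le: "1 - cos x \<le> x\<^sup>2 / 2" for x :: real
proof -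
  have "1 - cos x = 2 * (sin (x / 2))\<^sup>2" using cos_double_sin[of "x / 2"] by simp
  also have "(sin (x / 2))\<^sup>2 \<le> (x / 2)\<^sup>2"
    using abs_sin_x_le_abs_x[of "x / 2"] by (rule abs_le_square_iff[THEN iffD1])
  finally show ?thesis by (simp add: power2_eq_square)
qed

text \<open>The powers of \<open>cos w\<close> and of \<open>exp (- w\<^sup>2 / 2)\<close> differ by at most \<open>N w\<^sup>4\<close>, and \<open>N w\<^sup>2\<close> stays bounded.\<close>

lemma cos_power_tendsto:
  fixes w :: "nat \<Rightarrow> real" and N :: "nat \<Rightarrow> nat"
  assumes w: "w \<longlonglongrightarrow> 0" and N: "(\<lambda>n. (w n)\<^sup>2 * real (N n)) \<longlonglongrightarrow> v"
  shows "(\<lambda>n. cos (w n) ^ N n) \<longlonglongrightarrow> exp (- (v / 2))"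
proof -
  have "(\<lambda>n. cos (w n) ^ N n - exp (- ((w n)\<^sup>2 / 2)) ^ N n) \<longlonglongrightarrow> 0"
  proof (rule Lim_null_comparison)
    show "\<forall>\<^sub>F n in sequentially. norm (cos (w n) ^ N n - exp (- ((w n)\<^sup>2 / 2)) ^ N n) \<le> ((w n)\<^sup>2 * real (N n)) * (w n)\<^sup>2"
    proof (intro always_eventually allI)
      fix n
      have "norm (cos (w n) ^ N n - exp (- ((w n)\<^sup>2 / 2)) ^ N n) \<le> real (N n) * norm (cos (w n) - exp (- ((w n)\<^sup>2 / 2)))"
        by (rule norm_power_diff) auto
      also have "\<dots> \<le> real (N n) * (w n)^4"
        using cos_minus_exp_bound[of "w n"] by (intro mult_left_mono) auto
      finally show "norm (cos (w n) ^ N n - exp (- ((w n)\<^sup>2 / 2)) ^ N n) \<le> ((w n)\<^sup>2 * real (N n)) * (w n)\<^sup>2"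
        by (simp add: power2_eq_square eval_nat_numeral algebra_simps)
    qed
    have "(\<lambda>n. (w n)\<^sup>2 * real (N n) * (w n)\<^sup>2) \<longlonglongrightarrow> v * 0\<^sup>2"
      by (intro tendsto_intros N w)
    then show "(\<lambda>n. (w n)\<^sup>2 * real (N n) * (w n)\<^sup>2) \<longlonglongrightarrow> 0" by simp
  qed
  moreover have "(\<lambda>n. exp (- ((w n)\<^sup>2 / 2)) ^ N n) \<longlonglongrightarrow> exp (- (v / 2))"
  proof -
    have "exp (- ((w n)\<^sup>2 / 2)) ^ N n = exp (- ((w n)\<^sup>2 * real (N n) / 2))" for n
      by (simp add: exp_of_nat_mult[symmetric])
    moreover have "(\<lambda>n. exp (- ((w n)\<^sup>2 * real (N n) / 2))) \<longlonglongrightarrow> exp (- (v / 2))"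
      by (intro tendsto_intros N) simp
    ultimately show ?thesis by simp
  qed
  ultimately show ?thesis by (rule Lim_transform[rotated])
qed

context zero_lazy_walk
begin

text \<open>Away from the origin one step multiplies the characteristic function by \<open>cos \<theta>\<close> exactly. At the
  origin the factor is a convex combination of \<open>cos \<theta>\<close> and \<open>1\<close>, so that each visit costs an error of
  at most \<open>1 - cos \<theta>\<close>, which is of order \<open>\<theta>\<^sup>2\<close>.\<close>

lemma Ex_cis_step:
  fixes G :: "(nat \<Rightarrow> int) \<Rightarrow> real"
  assumes G: "depends_upto k G" and C: "\<And>z. \<bar>G z\<bar> \<le> C" and l: "k \<le> l"
  shows "norm (Ex (\<lambda>z. G z *\<^sub>R cis (\<theta> * increment k l z)) - cos \<theta> ^ (l - k) *\<^sub>R Ex (\<lambda>z. of_real (G z)))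
    \<le> C * (1 - cos \<theta>) * Ex (\<lambda>z. occupation 0 z l)"
  using l
proof (induction l rule: dec_induct)
  case base
  have "C \<ge> 0" using C[of undefined] by linarith
  moreover have "Ex (\<lambda>z. occupation 0 z k) \<ge> 0" by (intro integral_nonneg_AE) (simp add: occupation_def sum_nonneg)
  ultimately show ?case by (simp add: increment_def scaleR_conv_of_real)
next
  case (step l)
  let ?g = "\<lambda>l z. G z *\<^sub>R cis (\<theta> * increment k l z)"
  have C0: "C \<ge> 0" using C[of undefined] by linarith
  have Gl: "depends_upto l G" by (rule depends_upto_mono[OF G]) (use step in simp)
  have dg: "depends_upto l' (?g l')" if "k \<le> l'" for l'
    by (rule depends_upto_comp2[OF depends_upto_mono[OF G that] depends_upto_increment[OF that, of l' "\<lambda>v. cis (\<theta> * v)"]]) simp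
  have dr: "depends_upto l (\<lambda>z. of_bool (z l = 0) :: real)" by (rule depends_uptoI) simp
  have do: "depends_upto l' (\<lambda>z. occupation 0 z l')" for l' by (rule depends_upto_occupation) simp
  have Suc_step: "step c l (?g (Suc l)) z = (cos \<theta> + (1 - 2 * jump_rate c (z l)) * (1 - cos \<theta>)) *\<^sub>R ?g l z" for z
  proof -
    define r where "r = jump_rate c (z l)"
    define v where "v = increment k l z"
    have "step c l (?g (Suc l)) z = G z *\<^sub>R step c l (\<lambda>z. cis (\<theta> * increment k (Suc l) z)) z"
      by (rule step_scaleR[OF Gl])
    also have "step c l (\<lambda>z. cis (\<theta> * increment k (Suc l) z)) z =
        (1 - 2 * r) *\<^sub>R cis (\<theta> * v) + r *\<^sub>R (cis (\<theta> * (v + 1)) + cis (\<theta> * (v - 1)))"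
      unfolding r_def v_def by (rule step_increment) (use step in simp)
    also have "cis (\<theta> * (v + 1)) + cis (\<theta> * (v - 1)) = (2 * cos \<theta>) *\<^sub>R cis (\<theta> * v)"
      by (simp add: complex_eq_iff algebra_simps cos_add cos_diff sin_add sin_diff)
    also have "(1 - 2 * r) *\<^sub>R cis (\<theta> * v) + r *\<^sub>R (2 * cos \<theta>) *\<^sub>R cis (\<theta> * v) = (cos \<theta> + (1 - 2 * r) * (1 - cos \<theta>)) *\<^sub>R cis (\<theta> * v)"
      by (simp add: algebra_simps)
    finally show ?thesis by (simp add: r_def v_def mult.commute)
  qed
  have "Ex (?g (Suc l)) = Ex (step c l (?g (Suc l)))" by (rule one_step[OF dg]) (use step in simp)
  also have "\<dots> = Ex (\<lambda>z. cos \<theta> *\<^sub>R ?g l z + ((1 - 2 * jump_rate c (z l)) * (1 - cos \<theta>)) *\<^sub>R ?g l z)"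
    unfolding Suc_step by (simp only: scaleR_add_left)
  finally have eq: "Ex (?g (Suc l)) = Ex (\<lambda>z. cos \<theta> *\<^sub>R ?g l z + ((1 - 2 * jump_rate c (z l)) * (1 - cos \<theta>)) *\<^sub>R ?g l z)" .
  have i1: "integrable M (\<lambda>\<omega>. ?g l (path \<omega>))" by (rule integrable_past[OF dg]) (use step in simp)
  have d2: "depends_upto l (\<lambda>z. ((1 - 2 * jump_rate c (z l)) * (1 - cos \<theta>)) *\<^sub>R ?g l z)"
    by (rule depends_upto_comp2[of l "\<lambda>z. (1 - 2 * jump_rate c (z l)) * (1 - cos \<theta>)" "?g l" "(*\<^sub>R)"])
      (use step in \<open>auto intro!: depends_uptoI dg[of l]\<close>)
  have "Ex (?g (Suc l)) - cos \<theta> *\<^sub>R Ex (?g l) = Ex (\<lambda>z. ((1 - 2 * jump_rate c (z l)) * (1 - cos \<theta>)) *\<^sub>R ?g l z)"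
    unfolding eq Bochner_Integration.integral_add[OF integrable_scaleR_right[OF i1] integrable_past[OF d2]]
    by (simp only: integral_scaleR_right add_diff_cancel_left')
  also have "norm \<dots> \<le> Ex (\<lambda>z. (C * (1 - cos \<theta>)) * of_bool (z l = 0))"
  proof (rule order_trans[OF integral_norm_bound integral_mono[OF integrable_norm]])
    show "integrable M (\<lambda>\<omega>. ((1 - 2 * jump_rate c (Z l \<omega>)) * (1 - cos \<theta>)) *\<^sub>R ?g l (path \<omega>))"
      by (rule integrable_past[OF d2])
    show "integrable M (\<lambda>\<omega>. (C * (1 - cos \<theta>)) * of_bool (Z l \<omega> = 0))"
      by (rule integrable_mult_right) (rule integrable_past[OF dr])
    fix \<omega>
    show "norm (((1 - 2 * jump_rate c (Z l \<omega>)) * (1 - cos \<theta>)) *\<^sub>R ?g l (path \<omega>)) \<le> (C * (1 - cos \<theta>)) * of_bool (Z l \<omega> = 0)"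
    proof (cases "Z l \<omega> = 0")
      case True
      have "norm (((1 - 2 * jump_rate c (Z l \<omega>)) * (1 - cos \<theta>)) *\<^sub>R ?g l (path \<omega>)) = (1 - 2 * c) * (1 - cos \<theta>) * \<bar>G (path \<omega>)\<bar>"
        using True c by (simp add: jump_rate_def abs_mult)
      also have "\<dots> \<le> 1 * (1 - cos \<theta>) * C"
        using c C[of "path \<omega>"] by (intro mult_mono) auto
      finally show ?thesis using True by (simp add: mult.commute)
    qed (simp add: jump_rate_def)
  qed
  finally have 1: "norm (Ex (?g (Suc l)) - cos \<theta> *\<^sub>R Ex (?g l)) \<le> C * (1 - cos \<theta>) * Ex (\<lambda>z. of_bool (z l = 0))" by simp
  have "norm (cos \<theta> *\<^sub>R (Ex (?g l) - cos \<theta> ^ (l - k) *\<^sub>R Ex (\<lambda>z. of_real (G z)))) \<le> 1 * (C * (1 - cos \<theta>) * Ex (\<lambda>z. occupation 0 z l))"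
    unfolding norm_scaleR using step.IH by (intro mult_mono) auto
  moreover have "cos \<theta> *\<^sub>R (Ex (?g l) - cos \<theta> ^ (l - k) *\<^sub>R Ex (\<lambda>z. of_real (G z))) =
      cos \<theta> *\<^sub>R Ex (?g l) - cos \<theta> ^ (Suc l - k) *\<^sub>R Ex (\<lambda>z. of_real (G z))"
    using step by (simp add: scaleR_diff_right Suc_diff_le)
  ultimately have 2: "norm (cos \<theta> *\<^sub>R Ex (?g l) - cos \<theta> ^ (Suc l - k) *\<^sub>R Ex (\<lambda>z. of_real (G z))) \<le> C * (1 - cos \<theta>) * Ex (\<lambda>z. occupation 0 z l)"
    by (simp only: mult_1)
  have "Ex (\<lambda>z. occupation 0 z (Suc l)) = Ex (\<lambda>z. occupation 0 z l) + Ex (\<lambda>z. of_bool (z l = 0))"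
    using integrable_past[OF do] integrable_past[OF dr] by simp
  moreover note norm_diff_triangle_le[OF 1 2]
  ultimately show ?case by (simp only: distrib_left add.commute)
qed

end

text \<open>With \<open>r\<close> steps per unit of time, the walk is observed at the times \<open>j / m\<close>; the increments
  are normalised to have variance close to one.\<close>

definition grid :: "real \<Rightarrow> nat \<Rightarrow> nat \<Rightarrow> nat" where
  "grid r m j = nat \<lfloor>r * (real j / real m)\<rfloor>"

definition grid_increment :: "real \<Rightarrow> nat \<Rightarrow> (nat \<Rightarrow> int) \<Rightarrow> nat \<Rightarrow> real" where
  "grid_increment r m z j = sqrt (real m / r) * real_of_int (z (grid r m (Suc j)) - z (grid r m j))"

definition rescaled :: "real \<Rightarrow> (nat \<Rightarrow> int) \<Rightarrow> real \<Rightarrow> real" where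
  "rescaled r z t = lin_interp (\<lambda>k. real_of_int (z k)) (r * t) / sqrt r"

lemma grid_mono: "0 \<le> r \<Longrightarrow> i \<le> j \<Longrightarrow> grid r m i \<le> grid r m j"
  unfolding grid_def by (intro nat_mono floor_mono mult_left_mono divide_right_mono) auto

lemma grid_bounds:
  assumes "0 \<le> r"
  shows "real (grid r m j) \<le> r * (real j / real m)" "r * (real j / real m) < real (grid r m j) + 1"
  using nat_floor_bounds[of "r * (real j / real m)"] assms unfolding grid_def by simp_all

context zero_lazy_walk
begin

text \<open>A positive weight \<open>G\<close> depending on the past is absorbed into the measure, so that Levy's
  continuity theorem applies to the increment alone; it then says that the increment becomes
  Gaussian and independent of the past. The last assumption on \<open>w\<close> makes the visits to the origin
  negligible, and the lower bound on \<open>G\<close> keeps the normalisation away from zero.\<close>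

lemma weighted_increment_limit:
  fixes G :: "nat \<Rightarrow> (nat \<Rightarrow> int) \<Rightarrow> real" and \<rho> :: "real \<Rightarrow> real"
  assumes G: "\<And>n. depends_upto (k n) (G n)" and bounds: "\<And>n z. 1 \<le> G n z" "\<And>n z. G n z \<le> C"
    and kl: "\<And>n. k n \<le> l n"
    and w: "w \<longlonglongrightarrow> 0" "(\<lambda>n. (w n)\<^sup>2 * real (l n - k n)) \<longlonglongrightarrow> 1" "(\<lambda>n. (w n)\<^sup>2 * sqrt (real (l n))) \<longlonglongrightarrow> 0"
    and \<rho>: "continuous_on UNIV \<rho>" "\<And>x. \<bar>\<rho> x\<bar> \<le> R"
  shows "(\<lambda>n. Ex (\<lambda>z. G n z * \<rho> (w n * increment (k n) (l n) z)) -
            Ex (G n) * (\<integral>x. \<rho> x \<partial>std_normal_distribution)) \<longlonglongrightarrow> 0"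
proof -
  define m where "m n = Ex (G n)" for n
  define \<xi> where "\<xi> n \<omega> = w n * increment (k n) (l n) (path \<omega>)" for n \<omega>
  have iG: "integrable M (\<lambda>\<omega>. G n (path \<omega>))" for n by (rule integrable_past[OF G])
  have mG [measurable]: "(\<lambda>\<omega>. G n (path \<omega>)) \<in> borel_measurable M" for n using iG by simp
  have m\<xi> [measurable]: "\<xi> n \<in> borel_measurable M" for n
    unfolding \<xi>_def by (rule borel_measurable_past[OF depends_upto_increment[of "k n" "l n" "l n"]]) (simp_all add: kl)
  have m: "1 \<le> m n" "m n \<le> C" for n
  proof -
    have "(\<integral>\<omega>. 1 \<partial>M) \<le> m n" unfolding m_def by (intro integral_mono iG bounds) auto
    then show "1 \<le> m n" by (simp add: prob_space)
    have "m n \<le> (\<integral>\<omega>. C \<partial>M)" unfolding m_def by (intro integral_mono iG bounds) auto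
    then show "m n \<le> C" by (simp add: prob_space)
  qed
  define \<nu> where "\<nu> n = density M (\<lambda>\<omega>. ennreal (G n (path \<omega>) / m n))" for n
  have G0: "0 \<le> G n z / m n" for n z using bounds(1)[of n z] m(1)[of n] by simp
  have int_\<nu>: "integral\<^sup>L (\<nu> n) f = (\<integral>\<omega>. (G n (path \<omega>) / m n) *\<^sub>R f \<omega> \<partial>M)"
    if "f \<in> borel_measurable M" for f :: "'a \<Rightarrow> 'b::{banach, second_countable_topology}" and n
    unfolding \<nu>_def by (rule integral_density) (use that G0 in auto)
  interpret \<nu>: prob_space "\<nu> n" for n
  proof
    have "emeasure (\<nu> n) (space (\<nu> n)) = (\<integral>\<^sup>+\<omega>. ennreal (G n (path \<omega>) / m n) \<partial>M)"
      unfolding \<nu>_def by (simp add: emeasure_density cong: nn_integral_cong)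
    also have "\<dots> = ennreal (\<integral>\<omega>. G n (path \<omega>) / m n \<partial>M)"
      by (rule nn_integral_eq_integral) (use iG G0 in auto)
    also have "(\<integral>\<omega>. G n (path \<omega>) / m n \<partial>M) = 1" using m(1)[of n] by (simp add: m_def)
    finally show "emeasure (\<nu> n) (space (\<nu> n)) = 1" by simp
  qed
  have m\<nu> [measurable]: "\<xi> n \<in> borel_measurable (\<nu> n)" for n by (simp add: \<nu>_def)
  have char: "char (distr (\<nu> n) borel (\<xi> n)) \<theta> = (1 / m n) *\<^sub>R Ex (\<lambda>z. G n z *\<^sub>R cis (\<theta> * w n * increment (k n) (l n) z))" for n \<theta>
  proof -
    have "char (distr (\<nu> n) borel (\<xi> n)) \<theta> = (\<integral>\<omega>. iexp (\<theta> * \<xi> n \<omega>) \<partial>\<nu> n)"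
      unfolding char_def by (rule integral_distr) auto
    also have "\<dots> = (\<integral>\<omega>. (G n (path \<omega>) / m n) *\<^sub>R iexp (\<theta> * \<xi> n \<omega>) \<partial>M)"
      by (rule int_\<nu>) measurable
    also have "\<dots> = (\<integral>\<omega>. (1 / m n) *\<^sub>R (G n (path \<omega>) *\<^sub>R cis (\<theta> * w n * increment (k n) (l n) (path \<omega>))) \<partial>M)"
      by (intro Bochner_Integration.integral_cong refl) (simp add: \<xi>_def cis_conv_exp mult.assoc)
    finally show ?thesis by (simp only: integral_scaleR_right)
  qed
  have wc: "weak_conv_m (\<lambda>n. distr (\<nu> n) borel (\<xi> n)) std_normal_distribution"
  proof (rule levy_continuity)
    show "real_distribution (distr (\<nu> n) borel (\<xi> n))" for n
      by (rule \<nu>.real_distribution_distr) simp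
    show "real_distribution std_normal_distribution" by (rule real_dist_normal_dist)
    fix \<theta> :: real
    define D where "D n = Ex (\<lambda>z. G n z *\<^sub>R cis (\<theta> * w n * increment (k n) (l n) z)) - cos (\<theta> * w n) ^ (l n - k n) *\<^sub>R complex_of_real (m n)" for n
    have "D \<longlonglongrightarrow> 0"
    proof (rule Lim_null_comparison)
      show "\<forall>\<^sub>F n in sequentially. norm (D n) \<le> C * \<theta>\<^sup>2 * ((w n)\<^sup>2 * sqrt (real (l n)))"
      proof (intro always_eventually allI)
        fix n
        have C: "0 \<le> C" using m[of n] by linarith
        have "\<bar>G n z\<bar> \<le> C" for z using bounds(1)[of n z] bounds(2)[of n z] by simp
        then have "norm (D n) \<le> C * (1 - cos (\<theta> * w n)) * Ex (\<lambda>z. occupation 0 z (l n))"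
          using Ex_cis_step[OF G[of n] _ kl[of n], of C "\<theta> * w n"] by (simp add: D_def m_def mult.assoc)
        also have "\<dots> \<le> C * ((\<theta> * w n)\<^sup>2 / 2) * (2 * sqrt (real (l n)))"
        proof (intro mult_mono)
          show "1 - cos (\<theta> * w n) \<le> (\<theta> * w n)\<^sup>2 / 2" by (rule one_minus_cos_le)
          show "Ex (\<lambda>z. occupation 0 z (l n)) \<le> 2 * sqrt (real (l n))" using Ex_occupation_le[of 0 "l n"] by simp
          show "0 \<le> Ex (\<lambda>z. occupation 0 z (l n))"
            by (intro integral_nonneg_AE) (simp add: occupation_def sum_nonneg)
        qed (use C in auto)
        finally show "norm (D n) \<le> C * \<theta>\<^sup>2 * ((w n)\<^sup>2 * sqrt (real (l n)))"
          by (simp add: power_mult_distrib algebra_simps)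
      qed
      show "(\<lambda>n. C * \<theta>\<^sup>2 * ((w n)\<^sup>2 * sqrt (real (l n)))) \<longlonglongrightarrow> 0"
        by (intro tendsto_mult_right_zero w)
    qed
    have inv: "norm (D n) / \<bar>m n\<bar> \<le> norm (D n)" for n
      using m(1)[of n] mult_left_mono[of 1 "m n" "norm (D n)"] by (simp add: divide_le_eq)
    from \<open>D \<longlonglongrightarrow> 0\<close> have "(\<lambda>n. (1 / m n) *\<^sub>R D n) \<longlonglongrightarrow> 0"
    proof (rule Lim_null_comparison[rotated, OF tendsto_norm_zero])
      show "\<forall>\<^sub>F n in sequentially. norm ((1 / m n) *\<^sub>R D n) \<le> norm (D n)"
        using m by (intro always_eventually allI) (simp add: inv)
    qed
    moreover have "(\<lambda>n. cos (\<theta> * w n) ^ (l n - k n)) \<longlonglongrightarrow> exp (- (\<theta>\<^sup>2 / 2))"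
    proof (rule cos_power_tendsto)
      show "(\<lambda>n. \<theta> * w n) \<longlonglongrightarrow> 0" by (intro tendsto_mult_right_zero w)
      show "(\<lambda>n. (\<theta> * w n)\<^sup>2 * real (l n - k n)) \<longlonglongrightarrow> \<theta>\<^sup>2"
        using tendsto_mult[OF tendsto_const[of "\<theta>\<^sup>2"] w(2)] by (simp add: power_mult_distrib mult.assoc)
    qed
    moreover have "char (distr (\<nu> n) borel (\<xi> n)) \<theta> = (1 / m n) *\<^sub>R D n + complex_of_real (cos (\<theta> * w n) ^ (l n - k n))" for n
    proof -
      have "char (distr (\<nu> n) borel (\<xi> n)) \<theta> = (1 / m n) *\<^sub>R (D n + cos (\<theta> * w n) ^ (l n - k n) *\<^sub>R complex_of_real (m n))"
        unfolding char D_def by simp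
      also have "\<dots> = (1 / m n) *\<^sub>R D n + complex_of_real (cos (\<theta> * w n) ^ (l n - k n))"
      proof -
        have "complex_of_real (m n) \<noteq> 0" using m(1)[of n] by simp
        then show ?thesis by (simp add: scaleR_conv_of_real add_divide_distrib)
      qed
      finally show ?thesis .
    qed
    ultimately have "(\<lambda>n. char (distr (\<nu> n) borel (\<xi> n)) \<theta>) \<longlonglongrightarrow> 0 + complex_of_real (exp (- (\<theta>\<^sup>2 / 2)))"
      by (simp only: tendsto_add tendsto_of_real)
    then show "(\<lambda>n. char (distr (\<nu> n) borel (\<xi> n)) \<theta>) \<longlonglongrightarrow> char std_normal_distribution \<theta>"
      by (simp add: char_std_normal_distribution)
  qed
  have "(\<lambda>n. integral\<^sup>L (distr (\<nu> n) borel (\<xi> n)) \<rho>) \<longlonglongrightarrow> integral\<^sup>L std_normal_distribution \<rho>"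
  proof (rule weak_conv_imp_integral_bdd_continuous_conv)
    show "real_distribution (distr (\<nu> n) borel (\<xi> n))" for n by (rule \<nu>.real_distribution_distr) simp
    show "real_distribution std_normal_distribution" by (rule real_dist_normal_dist)
    show "isCont \<rho> x" for x using \<rho>(1) by (simp add: continuous_on_eq_continuous_at)
    show "norm (\<rho> x) \<le> R" for x using \<rho>(2) by simp
  qed (rule wc)
  then have e: "(\<lambda>n. integral\<^sup>L (distr (\<nu> n) borel (\<xi> n)) \<rho> - integral\<^sup>L std_normal_distribution \<rho>) \<longlonglongrightarrow> 0"
    (is "?e \<longlonglongrightarrow> 0") by (rule LIM_zero)
  have "(\<lambda>n. m n * ?e n) \<longlonglongrightarrow> 0"
  proof (rule Lim_null_comparison)
    show "\<forall>\<^sub>F n in sequentially. norm (m n * ?e n) \<le> C * norm (?e n)"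
    proof (intro always_eventually allI)
      fix n show "norm (m n * ?e n) \<le> C * norm (?e n)"
        unfolding norm_mult using m[of n] by (intro mult_right_mono) auto
    qed
    show "(\<lambda>n. C * norm (?e n)) \<longlonglongrightarrow> 0" by (intro tendsto_mult_right_zero tendsto_norm_zero e)
  qed
  moreover have "m n * integral\<^sup>L (distr (\<nu> n) borel (\<xi> n)) \<rho> = Ex (\<lambda>z. G n z * \<rho> (w n * increment (k n) (l n) z))" for n
  proof -
    have [measurable]: "\<rho> \<in> borel_measurable borel" using \<rho>(1) by (rule borel_measurable_continuous_onI)
    have "integral\<^sup>L (distr (\<nu> n) borel (\<xi> n)) \<rho> = (\<integral>\<omega>. \<rho> (\<xi> n \<omega>) \<partial>\<nu> n)" by (rule integral_distr) auto
    also have "\<dots> = (\<integral>\<omega>. (G n (path \<omega>) / m n) *\<^sub>R \<rho> (\<xi> n \<omega>) \<partial>M)" by (rule int_\<nu>) measurable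
    finally show ?thesis using m(1)[of n] by (simp add: \<xi>_def)
  qed
  ultimately show ?thesis by (simp add: m_def right_diff_distrib)
qed

lemma grid_increment_eq: "grid_increment r m z j = sqrt (real m / r) * increment (grid r m j) (grid r m (Suc j)) z"
  by (simp add: grid_increment_def increment_def)

lemma grid_scaling:
  fixes r :: "nat \<Rightarrow> real"
  assumes r: "filterlim r at_top sequentially" "\<And>n. 0 \<le> r n" and m: "0 < m"
  shows "(\<lambda>n. sqrt (real m / r n)) \<longlonglongrightarrow> 0"
    and "(\<lambda>n. (sqrt (real m / r n))\<^sup>2 * real (grid (r n) m (Suc j) - grid (r n) m j)) \<longlonglongrightarrow> 1"
    and "(\<lambda>n. (sqrt (real m / r n))\<^sup>2 * sqrt (real (grid (r n) m (Suc j)))) \<longlonglongrightarrow> 0"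
proof -
  have pos: "\<forall>\<^sub>F n in sequentially. 0 < r n" using r(1) by (simp add: filterlim_at_top_dense)
  have q: "(\<lambda>n. real m / r n) \<longlonglongrightarrow> 0"
    using filterlim_at_top_imp_at_infinity[OF r(1)] by (rule tendsto_divide_0[OF tendsto_const])
  then show w: "(\<lambda>n. sqrt (real m / r n)) \<longlonglongrightarrow> 0" using tendsto_real_sqrt by fastforce
  have sq: "(sqrt (real m / r n))\<^sup>2 = real m / r n" for n using r(2)[of n] by simp
  show "(\<lambda>n. (sqrt (real m / r n))\<^sup>2 * real (grid (r n) m (Suc j) - grid (r n) m j)) \<longlonglongrightarrow> 1"
    unfolding sq
  proof (rule LIM_zero_cancel, rule Lim_null_comparison[OF _ q])
    show "\<forall>\<^sub>F n in sequentially. norm (real m / r n * real (grid (r n) m (Suc j) - grid (r n) m j) - 1) \<le> real m / r n"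
      using pos
    proof eventually_elim
      case (elim n)
      have "real (grid (r n) m (Suc j) - grid (r n) m j) = real (grid (r n) m (Suc j)) - real (grid (r n) m j)"
        using grid_mono[OF r(2)[of n], of j "Suc j" m] by (simp add: of_nat_diff)
      moreover have "r n * (real (Suc j) / real m) = r n * (real j / real m) + r n / real m"
        using m by (simp add: field_simps)
      ultimately have "\<bar>real (grid (r n) m (Suc j) - grid (r n) m j) - r n / real m\<bar> \<le> 1"
        using grid_bounds[OF r(2)[of n], where m = m and j = j] grid_bounds[OF r(2)[of n], where m = m and j = "Suc j"] by linarith
      then have "real m / r n * \<bar>real (grid (r n) m (Suc j) - grid (r n) m j) - r n / real m\<bar> \<le> real m / r n * 1"
        using elim by (intro mult_left_mono) auto
      moreover have "real m / r n * x - 1 = real m / r n * (x - r n / real m)" for x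
        using elim m by (simp add: field_simps)
      ultimately show ?case using elim by (simp add: abs_mult)
    qed
  qed
  show "(\<lambda>n. (sqrt (real m / r n))\<^sup>2 * sqrt (real (grid (r n) m (Suc j)))) \<longlonglongrightarrow> 0"
  proof (rule Lim_null_comparison)
    show "\<forall>\<^sub>F n in sequentially. norm ((sqrt (real m / r n))\<^sup>2 * sqrt (real (grid (r n) m (Suc j)))) \<le> sqrt (real m / r n) * sqrt (real (Suc j))"
      using pos
    proof eventually_elim
      case (elim n)
      have "sqrt (real m / r n) * sqrt (real (grid (r n) m (Suc j))) \<le> sqrt (real m / r n) * sqrt (r n * (real (Suc j) / real m))"
        using grid_bounds(1)[OF r(2)[of n], where m = m and j = "Suc j"] elim by (intro mult_left_mono) auto
      also have "\<dots> = sqrt (real (Suc j))" using elim m by (simp add: real_sqrt_mult[symmetric] field_simps)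
      finally have "sqrt (real m / r n) * (sqrt (real m / r n) * sqrt (real (grid (r n) m (Suc j)))) \<le> sqrt (real m / r n) * sqrt (real (Suc j))"
        using elim by (intro mult_left_mono) auto
      moreover have "norm ((sqrt (real m / r n))\<^sup>2 * sqrt (real (grid (r n) m (Suc j))))
          = sqrt (real m / r n) * (sqrt (real m / r n) * sqrt (real (grid (r n) m (Suc j))))"
      proof -
        have nonneg: "0 \<le> sqrt (real m / r n)" "0 \<le> sqrt (real (grid (r n) m (Suc j)))" using elim by auto
        then show ?thesis
          unfolding power2_eq_square mult.assoc real_norm_def
          by (intro abs_of_nonneg mult_nonneg_nonneg)
      qed
      ultimately show ?case by (simp only:)
    qed
    show "(\<lambda>n. sqrt (real m / r n) * sqrt (real (Suc j))) \<longlonglongrightarrow> 0"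
      using w by (rule tendsto_mult_left_zero)
  qed
qed

text \<open>Induction on the number of increments: those before the last one form a weight depending on the past.\<close>

proposition grid_increments_limit:
  fixes r :: "nat \<Rightarrow> real" and \<rho> :: "nat \<Rightarrow> real \<Rightarrow> real"
  assumes r: "filterlim r at_top sequentially" "\<And>n. 0 \<le> r n" and m: "0 < m"
    and \<rho>: "\<And>j. continuous_on UNIV (\<rho> j)" "\<And>j x. 0 \<le> \<rho> j x" "\<And>j x. \<rho> j x \<le> 1"
  shows "(\<lambda>n. Ex (\<lambda>z. \<Prod>j<J. \<rho> j (grid_increment (r n) m z j))) \<longlonglongrightarrow>
    (\<Prod>j<J. \<integral>x. \<rho> j x \<partial>std_normal_distribution)"
proof (induction J)
  case 0
  then show ?case by (simp add: prob_space)
next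
  case (Suc J)
  define P where "P n z = (\<Prod>j<J. \<rho> j (grid_increment (r n) m z j))" for n z
  define \<nu> where "\<nu> = (\<integral>x. \<rho> J x \<partial>std_normal_distribution)"
  let ?k = "\<lambda>n. grid (r n) m J" and ?l = "\<lambda>n. grid (r n) m (Suc J)"
  let ?w = "\<lambda>n. sqrt (real m / r n)"
  have P: "depends_upto (?k n) (P n)" for n
  proof (rule depends_uptoI)
    fix z z' :: "nat \<Rightarrow> int" assume z: "\<And>i. i \<le> ?k n \<Longrightarrow> z i = z' i"
    have "z (grid (r n) m j) = z' (grid (r n) m j)" if "j \<le> J" for j
      by (intro z grid_mono r that)
    then show "P n z = P n z'" unfolding P_def grid_increment_def by (intro prod.cong) auto
  qed
  have P01: "0 \<le> P n z" "P n z \<le> 1" for n z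
    unfolding P_def by (auto intro!: prod_nonneg prod_le_1 \<rho>)
  have \<rho>_abs: "\<bar>\<rho> J x\<bar> \<le> 1" for x using \<rho>(2,3)[of J x] by simp
  have lim: "(\<lambda>n. Ex (\<lambda>z. G n z * \<rho> J (?w n * increment (?k n) (?l n) z)) - Ex (G n) * \<nu>) \<longlonglongrightarrow> 0"
    if "\<And>n. depends_upto (?k n) (G n)" "\<And>n z. 1 \<le> G n z" "\<And>n z. G n z \<le> 2" for G
    unfolding \<nu>_def
    by (rule weighted_increment_limit[where C = 2 and R = 1, OF that _ grid_scaling[OF r m] \<rho>(1) \<rho>_abs])
       (auto intro: grid_mono r)
  have PS: "depends_upto (?l n) (\<lambda>z. P n z * \<rho> J (?w n * increment (?k n) (?l n) z))" for n
    by (rule depends_upto_comp2[OF depends_upto_mono[OF P] depends_upto_increment]) (auto intro: grid_mono r)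
  have \<rho>S: "depends_upto (?l n) (\<lambda>z. \<rho> J (?w n * increment (?k n) (?l n) z))" for n
    by (rule depends_upto_increment) (auto intro: grid_mono r)
  \<comment> \<open>The weight \<open>P\<close> may be arbitrarily small. It is the difference of the weights \<open>1 + P\<close> and \<open>1\<close>, which
    are bounded below.\<close>
  have 1: "(\<lambda>n. Ex (\<lambda>z. (1 + P n z) * \<rho> J (?w n * increment (?k n) (?l n) z)) - Ex (\<lambda>z. 1 + P n z) * \<nu>) \<longlonglongrightarrow> 0"
    by (rule lim) (use P01 depends_upto_comp2[OF depends_upto_const P, of _ "\<lambda>x y. x + y"] in auto)
  have 2: "(\<lambda>n. Ex (\<lambda>z. 1 * \<rho> J (?w n * increment (?k n) (?l n) z)) - Ex (\<lambda>z. 1) * \<nu>) \<longlonglongrightarrow> 0"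
    by (rule lim) (auto intro: depends_upto_const)
  have eq: "Ex (\<lambda>z. (1 + P n z) * \<rho> J (?w n * increment (?k n) (?l n) z)) - Ex (\<lambda>z. 1 + P n z) * \<nu>
      - (Ex (\<lambda>z. 1 * \<rho> J (?w n * increment (?k n) (?l n) z)) - Ex (\<lambda>z. 1) * \<nu>)
      = Ex (\<lambda>z. P n z * \<rho> J (?w n * increment (?k n) (?l n) z)) - Ex (P n) * \<nu>" for n
    using integrable_past[OF PS[of n]] integrable_past[OF \<rho>S[of n]] integrable_past[OF P[of n]]
    by (simp add: distrib_right prob_space)
  have "(\<lambda>n. Ex (\<lambda>z. P n z * \<rho> J (?w n * increment (?k n) (?l n) z)) - Ex (P n) * \<nu>) \<longlonglongrightarrow> 0"
    using tendsto_diff[OF 1 2] unfolding eq by simp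
  moreover have "(\<lambda>n. Ex (P n) * \<nu>) \<longlonglongrightarrow> (\<Prod>j<J. \<integral>x. \<rho> j x \<partial>std_normal_distribution) * \<nu>"
    unfolding P_def by (intro tendsto_mult Suc tendsto_const)
  ultimately have "(\<lambda>n. Ex (\<lambda>z. P n z * \<rho> J (?w n * increment (?k n) (?l n) z))) \<longlonglongrightarrow>
      (\<Prod>j<J. \<integral>x. \<rho> j x \<partial>std_normal_distribution) * \<nu>"
    by (rule Lim_transform[rotated])
  then show ?case by (simp add: P_def \<nu>_def grid_increment_eq)
qed

text \<open>Two times at distance at most \<open>\<delta>\<close> lie in the same or in adjacent blocks of length about \<open>\<delta>\<close>. There
  are about \<open>T/\<delta>\<close> blocks, each of which is bad with a probability of order \<open>\<delta>\<^sup>2\<close>.\<close>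

proposition oscillation:
  fixes r :: "nat \<Rightarrow> real"
  assumes r: "filterlim r at_top sequentially" "\<And>n. 0 \<le> r n" and T: "0 \<le> T" and \<eta>: "0 < \<eta>" and \<kappa>: "0 < \<kappa>"
  obtains \<delta> where "0 < \<delta>"
    "\<forall>\<^sub>F n in sequentially. \<exists>A\<in>sets M. prob A \<le> \<kappa> \<and> space M - A \<subseteq> regular \<and>
       (\<forall>\<omega>\<in>space M - A. \<forall>s\<in>{0..T}. \<forall>t\<in>{0..T}. \<bar>s - t\<bar> \<le> \<delta> \<longrightarrow>
          \<bar>rescaled (r n) (path \<omega>) s - rescaled (r n) (path \<omega>) t\<bar> \<le> \<eta>)"
proof -
  \<comment> \<open>The constant is \<open>3 * 2\<^sup>2 * 6\<^sup>4\<close>: the factor of the maximal inequality, blocks of at most \<open>2 q \<delta>\<close> steps,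
    and the threshold \<open>\<eta> sqrt q / 6\<close> within one block.\<close>
  define \<delta> where "\<delta> = min 1 (\<kappa> * \<eta>^4 / (15552 * (T + 3)))"
  have \<delta>: "0 < \<delta>" "\<delta> \<le> 1" "15552 * (T + 3) * \<delta> / \<eta>^4 \<le> \<kappa>"
  proof -
    show "0 < \<delta>" "\<delta> \<le> 1" using T \<eta> \<kappa> by (auto simp: \<delta>_def)
    have "15552 * (T + 3) * \<delta> \<le> 15552 * (T + 3) * (\<kappa> * \<eta>^4 / (15552 * (T + 3)))"
      using T by (intro mult_left_mono) (auto simp: \<delta>_def)
    also have "\<dots> = \<kappa> * \<eta>^4" using T by simp
    finally show "15552 * (T + 3) * \<delta> / \<eta>^4 \<le> \<kappa>" using \<eta> by (simp add: divide_le_eq)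
  qed
  have "\<forall>\<^sub>F n in sequentially. max (2 / \<delta>) (16 / \<eta>\<^sup>2) \<le> r n"
    using r(1) by (simp only: filterlim_at_top)
  then have "\<forall>\<^sub>F n in sequentially. \<exists>A\<in>sets M. prob A \<le> \<kappa> \<and> space M - A \<subseteq> regular \<and>
       (\<forall>\<omega>\<in>space M - A. \<forall>s\<in>{0..T}. \<forall>t\<in>{0..T}. \<bar>s - t\<bar> \<le> \<delta> \<longrightarrow>
          \<bar>rescaled (r n) (path \<omega>) s - rescaled (r n) (path \<omega>) t\<bar> \<le> \<eta>)"
  proof eventually_elim
    case (elim n)
    define q where "q = r n"
    have q: "2 \<le> q * \<delta>" "16 / \<eta>\<^sup>2 \<le> q" "0 < q"
      using elim \<delta>(1) \<eta> by (auto simp: q_def divide_le_eq intro: less_le_trans[of 0 "2 / \<delta>"])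
    have q4: "4 \<le> \<eta> * sqrt q"
    proof -
      have "4\<^sup>2 \<le> \<eta>\<^sup>2 * q" using q(2) \<eta> by (simp add: divide_le_eq mult.commute)
      also have "\<dots> = (\<eta> * sqrt q)\<^sup>2" using q by (simp add: power_mult_distrib)
      finally show ?thesis by (rule power2_le_imp_le) (use q \<eta> in auto)
    qed
    define b where "b = nat \<lfloor>q * \<delta>\<rfloor> + 2"
    have b: "q * \<delta> + 1 \<le> real b" "real b \<le> 2 * (q * \<delta>) \<or> real b \<le> q * \<delta> + 2"
      using nat_floor_bounds[of "q * \<delta>"] q(1) by (auto simp: b_def)
    have b2: "real b \<le> 2 * (q * \<delta>)" using b q by linarith
    define J where "J = nat \<lceil>T / \<delta>\<rceil> + 2"
    have "0 \<le> T / \<delta>" using T \<delta> by simp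
    then have J: "T / \<delta> + 2 \<le> real J" "real J \<le> T / \<delta> + 3"
      unfolding J_def by linarith+
    define \<mu> where "\<mu> = \<eta> * sqrt q / 6"
    have \<mu>: "0 < \<mu>" using \<eta> q by (simp add: \<mu>_def)
    define E where "E j = {\<omega> \<in> space M. \<exists>i\<le>b. \<mu> \<le> \<bar>real_of_int (Z (j * b + i) \<omega> - Z (j * b) \<omega>)\<bar>}" for j
    have E: "E j \<in> sets M" for j
      unfolding E_def by (rule sets_past[of "j * b + b"]) (auto intro!: depends_uptoI)
    define A where "A = (space M - regular) \<union> (\<Union>j<J. E j)"
    have A: "A \<in> sets M" using E by (auto simp: A_def)
    have "prob A \<le> prob (space M - regular) + prob (\<Union>j<J. E j)"
      unfolding A_def using E by (intro measure_Un_le) auto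
    also have "prob (\<Union>j<J. E j) \<le> (\<Sum>j<J. prob (E j))"
      using E by (intro finite_measure_subadditive_finite) auto
    also have "(\<Sum>j<J. prob (E j)) \<le> (\<Sum>j<J. 3 * (real b)\<^sup>2 / \<mu>^4)"
      unfolding E_def by (intro sum_mono maximal_increment \<mu>)
    also have "\<dots> = real J * (3 * (real b)\<^sup>2 / \<mu>^4)" by simp
    also have "\<dots> \<le> (T / \<delta> + 3) * (3 * (2 * (q * \<delta>))\<^sup>2 / \<mu>^4)"
      using J b2 T \<delta> \<mu> by (intro mult_mono divide_right_mono power_mono) auto
    also have "\<dots> = (T / \<delta> + 3) * \<delta>\<^sup>2 * (15552 / \<eta>^4)"
    proof -
      have \<mu>4: "\<mu>^4 = \<eta>^4 * q\<^sup>2 / 1296"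
        using q by (simp add: \<mu>_def power_mult_distrib power_divide power4_eq_xxxx power2_eq_square mult.assoc[symmetric])
      have "3 * (2 * (q * \<delta>))\<^sup>2 / (\<eta>^4 * q\<^sup>2 / 1296) = \<delta>\<^sup>2 * (15552 / \<eta>^4)"
        using q \<eta> by (simp add: power_mult_distrib)
      then show ?thesis unfolding \<mu>4 by (simp only: mult.assoc)
    qed
    also have "(T / \<delta> + 3) * \<delta>\<^sup>2 = T * \<delta> + 3 * (\<delta> * \<delta>)" using \<delta> by (simp add: power2_eq_square field_simps)
    also have "(T * \<delta> + 3 * (\<delta> * \<delta>)) * (15552 / \<eta>^4) \<le> (T * \<delta> + 3 * (\<delta> * 1)) * (15552 / \<eta>^4)"
      using \<delta> \<eta> by (intro mult_right_mono add_left_mono mult_left_mono) auto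
    also have "\<dots> = 15552 * (T + 3) * \<delta> / \<eta>^4" by (simp add: algebra_simps add_divide_distrib)
    also have "\<dots> \<le> \<kappa>" by (rule \<delta>)
    finally have probA: "prob A \<le> \<kappa>" by (simp add: prob_not_regular)
    have osc: "\<bar>rescaled q (path \<omega>) s - rescaled q (path \<omega>) t\<bar> \<le> \<eta>"
      if w: "\<omega> \<in> space M - A" and st: "0 \<le> s" "s \<le> t" "t \<le> T" "t - s \<le> \<delta>" for \<omega> s t
    proof -
      define f where "f k = real_of_int (Z k \<omega>)" for k
      have reg: "\<omega> \<in> regular" using w by (auto simp: A_def)
      have jump: "\<bar>f (Suc k) - f k\<bar> \<le> 1" for k
        using reg unfolding f_def regular_def by (auto simp flip: of_int_diff of_int_abs)
      have near: "\<bar>f (j * b + i) - f (j * b)\<bar> < \<mu>" if "j < J" "i \<le> b" for j i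
      proof -
        have "\<omega> \<notin> E j" using w that by (auto simp: A_def)
        then have "\<not> \<mu> \<le> \<bar>real_of_int (Z (j * b + i) \<omega> - Z (j * b) \<omega>)\<bar>"
          using w that unfolding E_def by blast
        then show ?thesis by (simp add: f_def)
      qed
      define k where "k = nat \<lfloor>q * s\<rfloor>"
      define l where "l = nat \<lfloor>q * t\<rfloor>"
      have qs: "0 \<le> q * s" "q * s \<le> q * t" "q * t \<le> q * s + q * \<delta>" "q * s \<le> q * T"
        using st q mult_left_mono[OF st(4), of q] by (auto simp: algebra_simps intro!: mult_left_mono)
      have k: "real k \<le> q * s" "q * s < real k + 1" using nat_floor_bounds[OF qs(1)] by (auto simp: k_def)
      have l: "real l \<le> q * t" "q * t < real l + 1" using nat_floor_bounds[of "q * t"] qs by (auto simp: l_def)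
      have kl: "k \<le> l" using qs unfolding k_def l_def by (intro nat_mono floor_mono) auto
      have lb: "l < k + b" using k l qs b(1) by linarith
      define j where "j = k div b"
      define i where "i = k mod b"
      have "0 < b" by (simp add: b_def)
      then have ki: "k = j * b + i" "i < b" by (simp_all add: j_def i_def)
      have "real j * (q * \<delta>) \<le> real j * real b" using b by (intro mult_left_mono) auto
      also have "\<dots> \<le> real k" using ki(1) by (metis le_add1 of_nat_le_iff of_nat_mult)
      also have "\<dots> \<le> q * T" using k qs by linarith
      finally have "real j * \<delta> \<le> T" using q(3) by (simp add: mult.left_commute)
      then have "real j \<le> T / \<delta>" using \<delta>(1) by (simp add: le_divide_eq)
      then have jJ: "Suc j < J" using J(1) by linarith
      \<comment> \<open>Either both times are in block \<open>j\<close>, or the path goes from \<open>k\<close> to the start of block \<open>j\<close>, to the start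
        of the next block, and to \<open>l\<close>.\<close>
      have "\<bar>f k - f l\<bar> \<le> 3 * \<mu>"
      proof (cases "l \<le> j * b + b")
        case True
        have "j * b + (l - j * b) = l" using kl ki by simp
        then have "\<bar>f l - f (j * b)\<bar> < \<mu>" using near[of j "l - j * b"] True jJ by simp
        moreover have "\<bar>f k - f (j * b)\<bar> < \<mu>" unfolding ki(1) using jJ ki(2) by (intro near) auto
        ultimately show ?thesis using \<mu> by linarith
      next
        case False
        have "Suc j * b + (l - Suc j * b) = l" using False by simp
        then have "\<bar>f l - f (Suc j * b)\<bar> < \<mu>" using near[of "Suc j" "l - Suc j * b"] jJ lb ki by simp
        moreover have "\<bar>f k - f (j * b)\<bar> < \<mu>" unfolding ki(1) using jJ ki(2) by (intro near) auto
        moreover have "\<bar>f (Suc j * b) - f (j * b)\<bar> < \<mu>" using near[of j b] jJ by (simp add: add.commute)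
        ultimately show ?thesis by linarith
      qed
      moreover have "\<bar>lin_interp f (q * s) - f k\<bar> \<le> 1"
        using jump[of k] by (intro lin_interp_close qs) (auto simp: k_def)
      moreover have "\<bar>lin_interp f (q * t) - f l\<bar> \<le> 1"
        using jump[of l] qs by (intro lin_interp_close) (auto simp: l_def)
      ultimately have "\<bar>lin_interp f (q * s) - lin_interp f (q * t)\<bar> \<le> 3 * \<mu> + 2" by linarith
      also have "\<dots> \<le> \<eta> * sqrt q" using q4 by (simp add: \<mu>_def)
      finally have "\<bar>lin_interp f (q * s) - lin_interp f (q * t)\<bar> / sqrt q \<le> \<eta>"
        using q(3) by (simp add: divide_le_eq)
      then show ?thesis
        using q(3) by (simp add: rescaled_def f_def[abs_def] diff_divide_distrib[symmetric])
    qed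
    have "\<bar>rescaled q (path \<omega>) s - rescaled q (path \<omega>) t\<bar> \<le> \<eta>"
      if "\<omega> \<in> space M - A" "s \<in> {0..T}" "t \<in> {0..T}" "\<bar>s - t\<bar> \<le> \<delta>" for \<omega> s t
      using osc[of \<omega> s t] osc[of \<omega> t s] that by (cases "s \<le> t") (auto simp: abs_minus_commute)
    moreover have "space M - A \<subseteq> regular" by (auto simp: A_def)
    ultimately show ?case using A probA unfolding q_def by blast
  qed
  with \<delta>(1) that show ?thesis by blast
qed

end

section \<open>From product test functions to Lipschitz functions of finitely many coordinates\<close>

text \<open>The translates of the hat function form a partition of unity on the line, and their products one on
  finite-dimensional space; interpolating at its nodes approximates a Lipschitz function by sums of
  products of functions of one coordinate.\<close>

definition hat :: "real \<Rightarrow> int \<Rightarrow> real \<Rightarrow> real" where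
  "hat \<delta> a x = max 0 (1 - \<bar>x / \<delta> - real_of_int a\<bar>)"

lemma hat_nonneg: "0 \<le> hat \<delta> a x" and hat_le_1: "hat \<delta> a x \<le> 1"
  by (auto simp: hat_def)

lemma continuous_on_hat: "continuous_on S (hat \<delta> a)"
  unfolding hat_def divide_inverse by (intro continuous_intros)

lemma hat_support: "0 < \<delta> \<Longrightarrow> hat \<delta> a x \<noteq> 0 \<Longrightarrow> \<bar>x - \<delta> * real_of_int a\<bar> \<le> \<delta>"
proof -
  assume \<delta>: "0 < \<delta>" and "hat \<delta> a x \<noteq> 0"
  then have "\<bar>x / \<delta> - real_of_int a\<bar> \<le> 1" by (auto simp: hat_def max_def split: if_splits)
  then have "\<delta> * \<bar>x / \<delta> - real_of_int a\<bar> \<le> \<delta> * 1" using \<delta> by (intro mult_left_mono) auto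
  moreover have "\<delta> * \<bar>x / \<delta> - real_of_int a\<bar> = \<bar>x - \<delta> * real_of_int a\<bar>"
  proof -
    have "\<delta> * \<bar>x / \<delta> - real_of_int a\<bar> = \<bar>\<delta> * (x / \<delta> - real_of_int a)\<bar>" using \<delta> by (simp add: abs_mult)
    also have "\<delta> * (x / \<delta> - real_of_int a) = x - \<delta> * real_of_int a" using \<delta> by (simp add: right_diff_distrib)
    finally show ?thesis .
  qed
  ultimately show ?thesis by simp
qed

lemma hat_sum:
  assumes S: "finite S"
  shows "(\<Sum>a\<in>S. hat \<delta> a x) \<le> 1"
    and "{\<lfloor>x / \<delta>\<rfloor>, \<lfloor>x / \<delta>\<rfloor> + 1} \<subseteq> S \<Longrightarrow> (\<Sum>a\<in>S. hat \<delta> a x) = 1"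
proof -
  define k where "k = \<lfloor>x / \<delta>\<rfloor>"
  have k: "real_of_int k \<le> x / \<delta>" "x / \<delta> < real_of_int k + 1" by (auto simp: k_def)
  have zero: "hat \<delta> a x = 0" if "a \<noteq> k" "a \<noteq> k + 1" for a
  proof -
    have "real_of_int a \<le> real_of_int k - 1 \<or> real_of_int a \<ge> real_of_int k + 2" using that by linarith
    then show ?thesis using k by (auto simp: hat_def)
  qed
  have two: "hat \<delta> k x + hat \<delta> (k + 1) x = 1" using k by (auto simp: hat_def)
  have sum_two: "(\<Sum>a\<in>{k, k + 1}. hat \<delta> a x) = 1" using two by simp
  have "(\<Sum>a\<in>S. hat \<delta> a x) = (\<Sum>a\<in>S \<inter> {k, k + 1}. hat \<delta> a x)"
    using S zero by (intro sum.mono_neutral_right) auto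
  also have "\<dots> \<le> (\<Sum>a\<in>{k, k + 1}. hat \<delta> a x)" by (intro sum_mono2) (auto simp: hat_nonneg)
  finally show "(\<Sum>a\<in>S. hat \<delta> a x) \<le> 1" using sum_two by simp
  assume "{\<lfloor>x / \<delta>\<rfloor>, \<lfloor>x / \<delta>\<rfloor> + 1} \<subseteq> S"
  then have "(\<Sum>a\<in>S. hat \<delta> a x) = (\<Sum>a\<in>{k, k + 1}. hat \<delta> a x)"
    using S zero by (intro sum.mono_neutral_right) (auto simp: k_def)
  then show "(\<Sum>a\<in>S. hat \<delta> a x) = 1" using sum_two by simp
qed

context
  fixes I :: "'i set" and \<delta> :: real and A :: nat
  assumes I: "finite I"
begin

text \<open>The sum over the nodes in the box \<open>[-A, A]\<close> (in units of \<open>\<delta>\<close>) only; it equals one well inside the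
  box.\<close>

definition hat_mass :: "('i \<Rightarrow> real) \<Rightarrow> real" where
  "hat_mass x = (\<Prod>i\<in>I. \<Sum>a\<in>{- int A..int A}. hat \<delta> a (x i))"

definition hat_interpolation :: "(('i \<Rightarrow> real) \<Rightarrow> real) \<Rightarrow> ('i \<Rightarrow> real) \<Rightarrow> real" where
  "hat_interpolation f x = (\<Sum>\<alpha>\<in>PiE I (\<lambda>_. {- int A..int A}). f (\<lambda>i. \<delta> * real_of_int (\<alpha> i)) * (\<Prod>i\<in>I. hat \<delta> (\<alpha> i) (x i)))"

lemma hat_mass_eq: "hat_mass x = (\<Sum>\<alpha>\<in>PiE I (\<lambda>_. {- int A..int A}). \<Prod>i\<in>I. hat \<delta> (\<alpha> i) (x i))"
  unfolding hat_mass_def by (rule prod_sum_PiE) (use I in auto)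

lemma hat_mass_bounds: "0 \<le> hat_mass x" "hat_mass x \<le> 1"
  unfolding hat_mass_def by (auto intro!: prod_nonneg prod_le_1 sum_nonneg hat_nonneg hat_sum)

lemma hat_interpolation_close:
  assumes \<delta>: "0 < \<delta>" and C: "\<And>x. \<bar>f x\<bar> \<le> C" and K: "0 \<le> K"
    and lip: "\<And>x y e. (\<And>i. i \<in> I \<Longrightarrow> \<bar>x i - y i\<bar> \<le> e) \<Longrightarrow> \<bar>f x - f y\<bar> \<le> K * e"
  shows "\<bar>f x - hat_interpolation f x\<bar> \<le> C * (1 - hat_mass x) + K * \<delta>"
proof -
  let ?P = "PiE I (\<lambda>_. {- int A..int A})"
  let ?h = "\<lambda>\<alpha>. \<Prod>i\<in>I. hat \<delta> (\<alpha> i) (x i)"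
  have h0: "0 \<le> ?h \<alpha>" for \<alpha> by (intro prod_nonneg) (auto simp: hat_nonneg)
  have "f x - hat_interpolation f x = f x * (1 - hat_mass x) + (\<Sum>\<alpha>\<in>?P. (f x - f (\<lambda>i. \<delta> * real_of_int (\<alpha> i))) * ?h \<alpha>)"
    by (simp add: hat_interpolation_def hat_mass_eq left_diff_distrib right_diff_distrib sum_subtractf sum_distrib_left)
  also have "\<bar>\<dots>\<bar> \<le> \<bar>f x * (1 - hat_mass x)\<bar> + \<bar>\<Sum>\<alpha>\<in>?P. (f x - f (\<lambda>i. \<delta> * real_of_int (\<alpha> i))) * ?h \<alpha>\<bar>"
    by (rule abs_triangle_ineq)
  also have "\<bar>f x * (1 - hat_mass x)\<bar> \<le> C * (1 - hat_mass x)"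
    using C[of x] hat_mass_bounds[of x] by (simp add: abs_mult mult_right_mono)
  also have "\<bar>\<Sum>\<alpha>\<in>?P. (f x - f (\<lambda>i. \<delta> * real_of_int (\<alpha> i))) * ?h \<alpha>\<bar> \<le> (\<Sum>\<alpha>\<in>?P. \<bar>(f x - f (\<lambda>i. \<delta> * real_of_int (\<alpha> i))) * ?h \<alpha>\<bar>)"
    by (rule sum_abs)
  also have "\<dots> \<le> (\<Sum>\<alpha>\<in>?P. K * \<delta> * ?h \<alpha>)"
  proof (rule sum_mono)
    fix \<alpha> assume "\<alpha> \<in> ?P"
    show "\<bar>(f x - f (\<lambda>i. \<delta> * real_of_int (\<alpha> i))) * ?h \<alpha>\<bar> \<le> K * \<delta> * ?h \<alpha>"
    proof (cases "?h \<alpha> = 0")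
      case False
      then have "hat \<delta> (\<alpha> i) (x i) \<noteq> 0" if "i \<in> I" for i using that I by auto
      then have "\<bar>f x - f (\<lambda>i. \<delta> * real_of_int (\<alpha> i))\<bar> \<le> K * \<delta>" by (intro lip hat_support \<delta>)
      then show ?thesis using h0[of \<alpha>] by (simp add: abs_mult mult_right_mono)
    qed simp
  qed
  also have "\<dots> = K * \<delta> * hat_mass x" by (simp add: hat_mass_eq sum_distrib_left)
  also have "\<dots> \<le> K * \<delta> * 1" using K \<delta> hat_mass_bounds by (intro mult_left_mono) auto
  finally show ?thesis by simp
qed

end

lemma hat_mass_eventually_1:
  assumes I: "finite I" and \<delta>: "0 < \<delta>"
  shows "\<forall>\<^sub>F A in sequentially. hat_mass I \<delta> A x = 1"
proof -
  have "\<forall>\<^sub>F A in sequentially. (\<Sum>a\<in>{- int A..int A}. hat \<delta> a (x i)) = 1" for i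
  proof -
    have "\<forall>\<^sub>F A :: nat in sequentially. nat \<bar>\<lfloor>x i / \<delta>\<rfloor>\<bar> + 1 \<le> A" by (rule eventually_ge_at_top)
    then show ?thesis
    proof eventually_elim
      case (elim A)
      then show ?case by (intro hat_sum) auto
    qed
  qed
  then have "\<forall>\<^sub>F A in sequentially. \<forall>i\<in>I. (\<Sum>a\<in>{- int A..int A}. hat \<delta> a (x i)) = 1"
    using I by (simp add: eventually_ball_finite)
  then show ?thesis by eventually_elim (simp add: hat_mass_def[OF I])
qed

text \<open>The mass left outside a large box is itself controlled by the assumption, because the mass function of
  the box is a product. Thus the convergence for products entails the tightness that passing to
  Lipschitz functions requires.\<close>

proposition tendsto_integral_of_products:
  fixes \<xi> :: "nat \<Rightarrow> 'i \<Rightarrow> 'a \<Rightarrow> real" and \<zeta> :: "'i \<Rightarrow> 'b \<Rightarrow> real" and f :: "('i \<Rightarrow> real) \<Rightarrow> real"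
  assumes M: "prob_space M" and N: "prob_space N" and I: "finite I"
    and \<xi>: "\<And>n i. i \<in> I \<Longrightarrow> \<xi> n i \<in> borel_measurable M" and \<zeta>: "\<And>i. i \<in> I \<Longrightarrow> \<zeta> i \<in> borel_measurable N"
    and prod: "\<And>\<rho>. (\<And>i. continuous_on UNIV (\<rho> i)) \<Longrightarrow> (\<And>i x. 0 \<le> \<rho> i x) \<Longrightarrow> (\<And>i x. \<rho> i x \<le> (1::real)) \<Longrightarrow>
      (\<lambda>n. \<integral>\<omega>. (\<Prod>i\<in>I. \<rho> i (\<xi> n i \<omega>)) \<partial>M) \<longlonglongrightarrow> (\<integral>\<omega>. (\<Prod>i\<in>I. \<rho> i (\<zeta> i \<omega>)) \<partial>N)"
    and f\<xi>: "\<And>n. (\<lambda>\<omega>. f (\<lambda>i. \<xi> n i \<omega>)) \<in> borel_measurable M" and f\<zeta>: "(\<lambda>\<omega>. f (\<lambda>i. \<zeta> i \<omega>)) \<in> borel_measurable N"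
    and C: "\<And>x. \<bar>f x\<bar> \<le> C" and K: "0 \<le> K"
    and lip: "\<And>x y e. (\<And>i. i \<in> I \<Longrightarrow> \<bar>x i - y i\<bar> \<le> e) \<Longrightarrow> \<bar>f x - f y\<bar> \<le> K * e"
  shows "(\<lambda>n. \<integral>\<omega>. f (\<lambda>i. \<xi> n i \<omega>) \<partial>M) \<longlonglongrightarrow> (\<integral>\<omega>. f (\<lambda>i. \<zeta> i \<omega>) \<partial>N)"
proof (rule tendstoI)
  fix e :: real assume e: "0 < e"
  interpret M: prob_space M by fact
  interpret N: prob_space N by fact
  have C0: "0 \<le> C" using C[of undefined] by linarith
  define \<delta> where "\<delta> = e / (5 * (K + 1))"
  have \<delta>: "0 < \<delta>" "K * \<delta> \<le> e / 5" using e K by (auto simp: \<delta>_def field_simps)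
  have meas: "(\<lambda>\<omega>. hat \<delta> a (g \<omega>)) \<in> borel_measurable L" if "g \<in> borel_measurable L" for L :: "'c measure" and g a
    by (rule measurable_compose[OF that borel_measurable_continuous_onI[OF continuous_on_hat]])
  have mass_meas: "(\<lambda>\<omega>. hat_mass I \<delta> A (\<lambda>i. g i \<omega>)) \<in> borel_measurable L"
    if "\<And>i. i \<in> I \<Longrightarrow> g i \<in> borel_measurable L" for L :: "'c measure" and g A
    unfolding hat_mass_def[OF I] by (intro borel_measurable_prod borel_measurable_sum meas that)
  have int_meas: "(\<lambda>\<omega>. hat_interpolation I \<delta> A f (\<lambda>i. g i \<omega>)) \<in> borel_measurable L"
    if "\<And>i. i \<in> I \<Longrightarrow> g i \<in> borel_measurable L" for L :: "'c measure" and g A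
    unfolding hat_interpolation_def[OF I]
    by (intro borel_measurable_sum borel_measurable_times borel_measurable_const borel_measurable_prod meas that)
  have "(\<lambda>A. \<integral>\<omega>. hat_mass I \<delta> A (\<lambda>i. \<zeta> i \<omega>) \<partial>N) \<longlonglongrightarrow> (\<integral>\<omega>. 1 \<partial>N)"
  proof (rule integral_dominated_convergence[where w = "\<lambda>_. 1"])
    show "AE \<omega> in N. (\<lambda>A. hat_mass I \<delta> A (\<lambda>i. \<zeta> i \<omega>)) \<longlonglongrightarrow> 1"
      using hat_mass_eventually_1[OF I \<delta>(1)] by (intro AE_I2 tendsto_eventually)
    show "AE \<omega> in N. norm (hat_mass I \<delta> A (\<lambda>i. \<zeta> i \<omega>)) \<le> 1" for A
      using hat_mass_bounds[OF I] by (intro AE_I2) auto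
  qed (auto intro!: mass_meas \<zeta>)
  then have "(\<lambda>A. C * (1 - (\<integral>\<omega>. hat_mass I \<delta> A (\<lambda>i. \<zeta> i \<omega>) \<partial>N))) \<longlonglongrightarrow> C * (1 - 1)"
    by (intro tendsto_intros) (simp add: N.prob_space)
  then have "\<forall>\<^sub>F A in sequentially. C * (1 - (\<integral>\<omega>. hat_mass I \<delta> A (\<lambda>i. \<zeta> i \<omega>) \<partial>N)) < e / 5"
    using e by (intro order_tendstoD(2)) auto
  \<comment> \<open>The box is chosen from the limit law; the convergence of the mass carries the choice over to \<open>\<xi> n\<close>.\<close>
  then obtain A where A: "C * (1 - (\<integral>\<omega>. hat_mass I \<delta> A (\<lambda>i. \<zeta> i \<omega>) \<partial>N)) < e / 5"
    using eventually_happens'[OF sequentially_bot] by blast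
  have interp: "\<bar>f x - hat_interpolation I \<delta> A f x\<bar> \<le> C * (1 - hat_mass I \<delta> A x) + K * \<delta>" for x
    by (rule hat_interpolation_close[OF I \<delta>(1) C K lip])
  have close: "\<bar>(\<integral>\<omega>. f (\<lambda>i. g i \<omega>) \<partial>L) - (\<integral>\<omega>. hat_interpolation I \<delta> A f (\<lambda>i. g i \<omega>) \<partial>L)\<bar>
      \<le> C * (1 - (\<integral>\<omega>. hat_mass I \<delta> A (\<lambda>i. g i \<omega>) \<partial>L)) + K * \<delta>"
    if L: "prob_space L" and g: "\<And>i. i \<in> I \<Longrightarrow> g i \<in> borel_measurable L" and fg: "(\<lambda>\<omega>. f (\<lambda>i. g i \<omega>)) \<in> borel_measurable L"
    for L :: "'c measure" and g
  proof -
    interpret L: prob_space L by fact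
    have if': "integrable L (\<lambda>\<omega>. f (\<lambda>i. g i \<omega>))"
      using fg C by (intro L.integrable_const_bound[of _ C]) auto
    have im: "integrable L (\<lambda>\<omega>. hat_mass I \<delta> A (\<lambda>i. g i \<omega>))"
      using mass_meas[OF g] hat_mass_bounds[OF I] by (intro L.integrable_const_bound[of _ 1]) auto
    have b: "\<bar>hat_interpolation I \<delta> A f x\<bar> \<le> C + (C + K * \<delta>)" for x
    proof -
      have "C * (1 - hat_mass I \<delta> A x) \<le> C * 1"
        using C0 hat_mass_bounds(1)[OF I] by (intro mult_left_mono) auto
      then show ?thesis using interp[of x] C[of x] by linarith
    qed
    have ii: "integrable L (\<lambda>\<omega>. hat_interpolation I \<delta> A f (\<lambda>i. g i \<omega>))"
      using int_meas[OF g] b by (intro L.integrable_const_bound[of _ "C + (C + K * \<delta>)"]) auto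
    have "\<bar>(\<integral>\<omega>. f (\<lambda>i. g i \<omega>) \<partial>L) - (\<integral>\<omega>. hat_interpolation I \<delta> A f (\<lambda>i. g i \<omega>) \<partial>L)\<bar>
        = \<bar>\<integral>\<omega>. f (\<lambda>i. g i \<omega>) - hat_interpolation I \<delta> A f (\<lambda>i. g i \<omega>) \<partial>L\<bar>"
      using if' ii by simp
    also have "\<dots> \<le> (\<integral>\<omega>. \<bar>f (\<lambda>i. g i \<omega>) - hat_interpolation I \<delta> A f (\<lambda>i. g i \<omega>)\<bar> \<partial>L)"
      using integral_norm_bound[of L "\<lambda>\<omega>. f (\<lambda>i. g i \<omega>) - hat_interpolation I \<delta> A f (\<lambda>i. g i \<omega>)"] by simp
    also have "\<dots> \<le> (\<integral>\<omega>. C * (1 - hat_mass I \<delta> A (\<lambda>i. g i \<omega>)) + K * \<delta> \<partial>L)"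
      using if' ii im
      by (intro integral_mono interp integrable_abs Bochner_Integration.integrable_diff
          Bochner_Integration.integrable_add integrable_mult_right) auto
    also have "\<dots> = C * (1 - (\<integral>\<omega>. hat_mass I \<delta> A (\<lambda>i. g i \<omega>) \<partial>L)) + K * \<delta>"
      using im by (simp add: L.prob_space)
    finally show ?thesis .
  qed
  have mass_lim: "(\<lambda>n. \<integral>\<omega>. hat_mass I \<delta> A (\<lambda>i. \<xi> n i \<omega>) \<partial>M) \<longlonglongrightarrow> (\<integral>\<omega>. hat_mass I \<delta> A (\<lambda>i. \<zeta> i \<omega>) \<partial>N)"
    unfolding hat_mass_def[OF I]
    by (rule prod) (auto intro!: continuous_on_sum continuous_on_hat sum_nonneg hat_nonneg hat_sum)
  then have "(\<lambda>n. C * (1 - (\<integral>\<omega>. hat_mass I \<delta> A (\<lambda>i. \<xi> n i \<omega>) \<partial>M))) \<longlonglongrightarrow> C * (1 - (\<integral>\<omega>. hat_mass I \<delta> A (\<lambda>i. \<zeta> i \<omega>) \<partial>N))"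
    by (intro tendsto_intros)
  then have ev1: "\<forall>\<^sub>F n in sequentially. C * (1 - (\<integral>\<omega>. hat_mass I \<delta> A (\<lambda>i. \<xi> n i \<omega>) \<partial>M)) < e / 5"
    using A by (rule order_tendstoD(2))
  have prod_int: "integrable L (\<lambda>\<omega>. \<Prod>i\<in>I. hat \<delta> (\<alpha> i) (g i \<omega>))"
    if L: "prob_space L" and g: "\<And>i. i \<in> I \<Longrightarrow> g i \<in> borel_measurable L" for L :: "'c measure" and g \<alpha>
  proof -
    interpret L: prob_space L by fact
    have "0 \<le> (\<Prod>i\<in>I. hat \<delta> (\<alpha> i) (x i))" "(\<Prod>i\<in>I. hat \<delta> (\<alpha> i) (x i)) \<le> 1" for x
      by (auto intro!: prod_nonneg prod_le_1 hat_nonneg hat_le_1)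
    then show ?thesis
      by (intro L.integrable_const_bound[of _ 1]) (auto intro!: borel_measurable_prod meas g simp: abs_of_nonneg)
  qed
  have expand: "(\<integral>\<omega>. hat_interpolation I \<delta> A f (\<lambda>i. g i \<omega>) \<partial>L) =
     (\<Sum>\<alpha>\<in>PiE I (\<lambda>_. {- int A..int A}). f (\<lambda>i. \<delta> * real_of_int (\<alpha> i)) * (\<integral>\<omega>. (\<Prod>i\<in>I. hat \<delta> (\<alpha> i) (g i \<omega>)) \<partial>L))"
    if "prob_space L" "\<And>i. i \<in> I \<Longrightarrow> g i \<in> borel_measurable L" for L :: "'c measure" and g
    unfolding hat_interpolation_def[OF I]
    using prod_int[OF that] by (subst Bochner_Integration.integral_sum) (auto intro!: integrable_mult_right)
  have e\<xi>: "(\<integral>\<omega>. hat_interpolation I \<delta> A f (\<lambda>i. \<xi> n i \<omega>) \<partial>M) =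
     (\<Sum>\<alpha>\<in>PiE I (\<lambda>_. {- int A..int A}). f (\<lambda>i. \<delta> * real_of_int (\<alpha> i)) * (\<integral>\<omega>. (\<Prod>i\<in>I. hat \<delta> (\<alpha> i) (\<xi> n i \<omega>)) \<partial>M))" for n
    by (rule expand[OF M]) (rule \<xi>)
  have e\<zeta>: "(\<integral>\<omega>. hat_interpolation I \<delta> A f (\<lambda>i. \<zeta> i \<omega>) \<partial>N) =
     (\<Sum>\<alpha>\<in>PiE I (\<lambda>_. {- int A..int A}). f (\<lambda>i. \<delta> * real_of_int (\<alpha> i)) * (\<integral>\<omega>. (\<Prod>i\<in>I. hat \<delta> (\<alpha> i) (\<zeta> i \<omega>)) \<partial>N))"
    by (rule expand[OF N]) (rule \<zeta>)
  have "(\<lambda>n. \<integral>\<omega>. hat_interpolation I \<delta> A f (\<lambda>i. \<xi> n i \<omega>) \<partial>M) \<longlonglongrightarrow> (\<integral>\<omega>. hat_interpolation I \<delta> A f (\<lambda>i. \<zeta> i \<omega>) \<partial>N)"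
    unfolding e\<xi> e\<zeta>
    by (intro tendsto_sum tendsto_mult tendsto_const prod) (auto intro!: continuous_on_hat hat_nonneg hat_le_1)
  then have ev2: "\<forall>\<^sub>F n in sequentially. dist (\<integral>\<omega>. hat_interpolation I \<delta> A f (\<lambda>i. \<xi> n i \<omega>) \<partial>M) (\<integral>\<omega>. hat_interpolation I \<delta> A f (\<lambda>i. \<zeta> i \<omega>) \<partial>N) < e / 5"
    using e by (intro tendstoD) auto
  show "\<forall>\<^sub>F n in sequentially. dist (\<integral>\<omega>. f (\<lambda>i. \<xi> n i \<omega>) \<partial>M) (\<integral>\<omega>. f (\<lambda>i. \<zeta> i \<omega>) \<partial>N) < e"
    using ev1 ev2
  proof eventually_elim
    case (elim n)
    have "\<bar>(\<integral>\<omega>. f (\<lambda>i. \<xi> n i \<omega>) \<partial>M) - (\<integral>\<omega>. hat_interpolation I \<delta> A f (\<lambda>i. \<xi> n i \<omega>) \<partial>M)\<bar>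
      \<le> C * (1 - (\<integral>\<omega>. hat_mass I \<delta> A (\<lambda>i. \<xi> n i \<omega>) \<partial>M)) + K * \<delta>" by (rule close[OF M \<xi> f\<xi>])
    moreover have "\<bar>(\<integral>\<omega>. f (\<lambda>i. \<zeta> i \<omega>) \<partial>N) - (\<integral>\<omega>. hat_interpolation I \<delta> A f (\<lambda>i. \<zeta> i \<omega>) \<partial>N)\<bar>
      \<le> C * (1 - (\<integral>\<omega>. hat_mass I \<delta> A (\<lambda>i. \<zeta> i \<omega>) \<partial>N)) + K * \<delta>" by (rule close[OF N \<zeta> f\<zeta>])
    ultimately show ?case using elim A \<delta>(2) unfolding dist_real_def by linarith
  qed
qed

section \<open>The increments of Brownian motion\<close>

definition brownian_increment :: "nat \<Rightarrow> (real \<Rightarrow> real) \<Rightarrow> nat \<Rightarrow> real" where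
  "brownian_increment m w j = sqrt (real m) * (w (real (Suc j) / real m) - w (real j / real m))"

lemma brownian_increments_prod:
  assumes N: "prob_space N" and W: "standard_brownian_motion N W" and m: "0 < m"
    and \<rho>: "\<And>j. continuous_on UNIV (\<rho> j)" "\<And>j x. 0 \<le> \<rho> j x" "\<And>j x. \<rho> j x \<le> (1::real)"
  shows "(\<integral>\<omega>. (\<Prod>j<J. \<rho> j (brownian_increment m (\<lambda>t. W t \<omega>) j)) \<partial>N) =
    (\<Prod>j<J. \<integral>x. \<rho> j x \<partial>std_normal_distribution)"
proof -
  interpret prob_space N by fact
  have \<rho>m [measurable]: "\<rho> j \<in> borel_measurable borel" for j using \<rho>(1) by (rule borel_measurable_continuous_onI)
  have ind: "indep_vars (\<lambda>_. borel) (\<lambda>i \<omega>. W (real (Suc i) / real m) \<omega> - W (real i / real m) \<omega>) {..<J}"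
  proof -
    have mono: "mono (\<lambda>i. real i / real m)" by (intro monoI divide_right_mono) auto
    have H: "\<And>t n. 0 \<le> t 0 \<Longrightarrow> mono t \<Longrightarrow> indep_vars (\<lambda>_. borel) (\<lambda>i \<omega>. W (t (Suc i)) \<omega> - W (t i) \<omega>) {..<n}"
      using W unfolding standard_brownian_motion_def by blast
    show ?thesis by (rule H[OF _ mono]) simp
  qed
  have "indep_vars (\<lambda>_. borel) (\<lambda>i \<omega>. \<rho> i (brownian_increment m (\<lambda>t. W t \<omega>) i)) {..<J}"
    unfolding brownian_increment_def
    by (rule indep_vars_compose2[OF ind, of "\<lambda>i d. \<rho> i (sqrt (real m) * d)"]) measurable
  then have "(\<integral>\<omega>. (\<Prod>j<J. \<rho> j (brownian_increment m (\<lambda>t. W t \<omega>) j)) \<partial>N) =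
      (\<Prod>j<J. \<integral>\<omega>. \<rho> j (brownian_increment m (\<lambda>t. W t \<omega>) j) \<partial>N)"
  proof (intro indep_vars_lebesgue_integral)
    fix i
    have [measurable]: "W t \<in> borel_measurable N" if "0 \<le> t" for t using W that by (simp add: standard_brownian_motion_def)
    have "(\<lambda>\<omega>. \<rho> i (brownian_increment m (\<lambda>t. W t \<omega>) i)) \<in> borel_measurable N"
      unfolding brownian_increment_def by measurable
    then show "integrable N (\<lambda>\<omega>. \<rho> i (brownian_increment m (\<lambda>t. W t \<omega>) i))"
      using \<rho> by (intro integrable_const_bound[of _ 1]) auto
  qed auto
  also have "\<dots> = (\<Prod>j<J. \<integral>x. \<rho> j x \<partial>std_normal_distribution)"
  proof (rule prod.cong[OF refl])
    fix j
    have "real j / real m < real (Suc j) / real m" using m by (simp add: divide_strict_right_mono)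
    then have "distributed N lborel (\<lambda>\<omega>. W (real (Suc j) / real m) \<omega> - W (real j / real m) \<omega>)
        (normal_density 0 (sqrt (real (Suc j) / real m - real j / real m)))"
      using W unfolding standard_brownian_motion_def by simp
    also have "real (Suc j) / real m - real j / real m = 1 / real m" by (simp add: diff_divide_distrib[symmetric])
    finally have "distributed N lborel (\<lambda>\<omega>. (W (real (Suc j) / real m) \<omega> - W (real j / real m) \<omega> - 0) / sqrt (1 / real m)) std_normal_density"
      using m by (subst normal_standard_normal_convert[symmetric]) auto
    moreover have "(W (real (Suc j) / real m) \<omega> - W (real j / real m) \<omega> - 0) / sqrt (1 / real m) = brownian_increment m (\<lambda>t. W t \<omega>) j" for \<omega>
      using m by (simp add: brownian_increment_def real_sqrt_divide)
    ultimately have d: "distributed N lborel (\<lambda>\<omega>. brownian_increment m (\<lambda>t. W t \<omega>) j) std_normal_density" by simp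
    have "(\<integral>\<omega>. \<rho> j (brownian_increment m (\<lambda>t. W t \<omega>) j) \<partial>N) = (\<integral>x. std_normal_density x * \<rho> j x \<partial>lborel)"
      by (rule distributed_integral[OF d, symmetric]) (auto simp: normal_density_nonneg)
    also have "\<dots> = (\<integral>x. \<rho> j x \<partial>std_normal_distribution)"
      by (subst integral_density) (auto simp: normal_density_nonneg)
    finally show "(\<integral>\<omega>. \<rho> j (brownian_increment m (\<lambda>t. W t \<omega>) j) \<partial>N) = (\<integral>x. \<rho> j x \<partial>std_normal_distribution)" .
  qed
  finally show ?thesis .
qed

section \<open>Joint convergence of two independent walks\<close>

lemma dist_pair_le:
  fixes a c b d :: real
  shows "dist (a, b) (c, d) \<le> \<bar>a - c\<bar> + \<bar>b - d\<bar>"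
  unfolding dist_prod_def dist_real_def using sqrt_sum_squares_le_sum_abs[of "\<bar>a - c\<bar>" "\<bar>b - d\<bar>"] by simp

definition path_pair :: "(real \<Rightarrow> real) \<Rightarrow> (real \<Rightarrow> real) \<Rightarrow> real \<Rightarrow> real \<times> real" where
  "path_pair x y = (\<lambda>t\<in>{0..}. (x t, y t))"

lemma path_pair_apply [simp]: "0 \<le> t \<Longrightarrow> path_pair x y t = (x t, y t)"
  by (simp add: path_pair_def)

lemma path_pair_in_cpaths:
  assumes "continuous_on {0..} x" "continuous_on {0..} y"
  shows "path_pair x y \<in> cpaths"
proof -
  have "continuous_on {0..} (\<lambda>t. (x t, y t))" by (intro continuous_on_Pair assms)
  then have "continuous_on {0..} (path_pair x y)"
    by (rule continuous_on_eq) simp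
  then show ?thesis by (simp add: cpaths_def path_pair_def)
qed

lemma random_path_pairI:
  assumes "\<And>\<omega>. \<omega> \<in> space M \<Longrightarrow> continuous_on {0..} (x \<omega>)" "\<And>\<omega>. \<omega> \<in> space M \<Longrightarrow> continuous_on {0..} (y \<omega>)"
    and "\<And>t. 0 \<le> t \<Longrightarrow> (\<lambda>\<omega>. x \<omega> t) \<in> borel_measurable M" "\<And>t. 0 \<le> t \<Longrightarrow> (\<lambda>\<omega>. y \<omega> t) \<in> borel_measurable M"
  shows "(\<lambda>\<omega>. path_pair (x \<omega>) (y \<omega>)) \<in> M \<rightarrow>\<^sub>M borel_sets_of path_topology"
  by (rule random_pathI) (auto intro!: path_pair_in_cpaths assms borel_measurable_Pair)

lemma continuous_on_rescaled: "0 \<le> r \<Longrightarrow> continuous_on {0..} (rescaled r z)"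
  unfolding rescaled_def divide_inverse
  by (intro continuous_intros continuous_on_compose2[OF continuous_on_lin_interp]) auto

lemma (in zero_lazy_walk) measurable_rescaled:
  "(\<lambda>\<omega>. rescaled r (path \<omega>) t) \<in> borel_measurable M"
  unfolding rescaled_def
proof (intro borel_measurable_divide measurable_lin_interp borel_measurable_const)
  show "(\<lambda>\<omega>. real_of_int (Z k \<omega>)) \<in> borel_measurable M" for k
    by (rule measurable_compose[OF Z_measurable]) simp
qed

text \<open>The polygonal path on the grid of mesh \<open>1 / m\<close> with the given normalised increments, constant
  after \<open>J\<close> of them.\<close>

definition polygon :: "nat \<Rightarrow> nat \<Rightarrow> (nat \<Rightarrow> real) \<Rightarrow> real \<Rightarrow> real" where
  "polygon m J x t = lin_interp (\<lambda>j. (\<Sum>i<min j J. x i) / sqrt (real m)) (real m * t)"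

lemma continuous_on_polygon: "continuous_on {0..} (polygon m J x)"
  unfolding polygon_def by (intro continuous_on_compose2[OF continuous_on_lin_interp] continuous_intros) auto

lemma polygon_lipschitz:
  assumes m: "0 < m" and t: "0 \<le> t" and d: "\<And>i. i < J \<Longrightarrow> \<bar>x i - y i\<bar> \<le> d" and "0 \<le> d"
  shows "\<bar>polygon m J x t - polygon m J y t\<bar> \<le> real J * d"
proof -
  have sm: "1 \<le> sqrt (real m)" using m by simp
  define f where "f j = (\<Sum>i<min j J. x i) / sqrt (real m) - (\<Sum>i<min j J. y i) / sqrt (real m)" for j
  have f: "\<bar>f j\<bar> \<le> real J * d" for j
  proof -
    have "f j = (\<Sum>i<min j J. x i - y i) / sqrt (real m)" by (simp add: f_def sum_subtractf diff_divide_distrib)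
    also have "\<bar>\<dots>\<bar> \<le> \<bar>\<Sum>i<min j J. x i - y i\<bar> / 1"
      unfolding abs_divide using sm by (intro frac_le) auto
    also have "\<dots> \<le> (\<Sum>i<min j J. \<bar>x i - y i\<bar>)" by simp
    also have "\<dots> \<le> (\<Sum>i<min j J. d)" by (intro sum_mono d) auto
    also have "\<dots> \<le> real J * d" using \<open>0 \<le> d\<close> by (simp add: mult_right_mono)
    finally show ?thesis .
  qed
  have "polygon m J x t - polygon m J y t = lin_interp f (real m * t)"
    by (simp add: polygon_def lin_interp_def Let_def f_def algebra_simps)
  also have "\<bar>\<dots> - 0\<bar> \<le> real J * d" by (rule lin_interp_close) (use f t in auto)
  finally show ?thesis by simp
qed

text \<open>A path is close to its polygonal approximation as soon as its oscillation is small at the scale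
  of the mesh.\<close>

lemma polygon_close:
  assumes m: "0 < m" and t: "0 \<le> t" "t \<le> T" and J: "real m * T + 1 \<le> real J"
    and nodes: "\<And>j. real j / real m \<le> T + 1 / real m \<Longrightarrow> \<bar>t - real j / real m\<bar> \<le> 1 / real m \<Longrightarrow>
      \<bar>(\<Sum>i<j. x i) / sqrt (real m) - y\<bar> \<le> e"
  shows "\<bar>polygon m J x t - y\<bar> \<le> e"
  unfolding polygon_def
proof (rule lin_interp_close)
  define k where "k = nat \<lfloor>real m * t\<rfloor>"
  have mt: "0 \<le> real m * t" "real m * t \<le> real m * T" using t by (auto intro: mult_left_mono)
  show "0 \<le> real m * t" by fact
  have k: "real k \<le> real m * t" "real m * t < real k + 1" using nat_floor_bounds[OF mt(1)] by (auto simp: k_def)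
  have one: "\<bar>(\<Sum>i<min j J. x i) / sqrt (real m) - y\<bar> \<le> e" if "j = k \<or> j = Suc k" for j
  proof -
    have jJ: "real j \<le> real J" and j: "real j \<le> real m * t + 1" "real m * t \<le> real j + 1"
      using that k mt J by auto
    have "real j / real m \<le> (real m * T + 1) / real m" using j mt by (intro divide_right_mono) auto
    then have "real j / real m \<le> T + 1 / real m" using m by (simp add: add_divide_distrib)
    moreover have "\<bar>t - real j / real m\<bar> \<le> 1 / real m"
    proof -
      have "t - real j / real m = (real m * t - real j) / real m" using m by (simp add: diff_divide_distrib)
      also have "\<bar>\<dots>\<bar> \<le> 1 / real m" unfolding abs_divide using j m by (intro frac_le) auto
      finally show ?thesis .
    qed
    ultimately have "\<bar>(\<Sum>i<j. x i) / sqrt (real m) - y\<bar> \<le> e" by (rule nodes)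
    moreover have "min j J = j" using jJ by simp
    ultimately show ?thesis by simp
  qed
  show "\<bar>(\<Sum>i<min (nat \<lfloor>real m * t\<rfloor>) J. x i) / sqrt (real m) - y\<bar> \<le> e"
    using one[of k] by (simp add: k_def)
  show "\<bar>(\<Sum>i<min (Suc (nat \<lfloor>real m * t\<rfloor>)) J. x i) / sqrt (real m) - y\<bar> \<le> e"
    using one[of "Suc k"] by (simp add: k_def)
qed

lemma sum_grid_increment:
  assumes "0 < m" "0 < r" "z 0 = 0"
  shows "(\<Sum>i<j. grid_increment r m z i) / sqrt (real m) = rescaled r z (real (grid r m j) / r)"
proof -
  have "(\<Sum>i<j. grid_increment r m z i) = sqrt (real m / r) * (\<Sum>i<j. real_of_int (z (grid r m (Suc i))) - real_of_int (z (grid r m i)))"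
    by (simp add: grid_increment_def sum_distrib_left)
  also have "(\<Sum>i<j. real_of_int (z (grid r m (Suc i))) - real_of_int (z (grid r m i))) = real_of_int (z (grid r m j)) - real_of_int (z (grid r m 0))"
    by (rule sum_lessThan_telescope)
  also have "grid r m 0 = 0" by (simp add: grid_def)
  finally show ?thesis using assms by (simp add: rescaled_def real_sqrt_divide)
qed

lemma polygon_close_walk:
  assumes m: "0 < m" and r: "real m \<le> r" and z: "z 0 = 0" and t: "0 \<le> t" "t \<le> T" and J: "real m * T + 1 \<le> real J"
    and osc: "\<And>s. s \<in> {0..T + 1} \<Longrightarrow> \<bar>t - s\<bar> \<le> 2 / real m \<Longrightarrow> \<bar>rescaled r z s - rescaled r z t\<bar> \<le> e"
  shows "\<bar>polygon m J (grid_increment r m z) t - rescaled r z t\<bar> \<le> e"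
proof (rule polygon_close[OF m t J])
  fix j assume j: "real j / real m \<le> T + 1 / real m" "\<bar>t - real j / real m\<bar> \<le> 1 / real m"
  have r0: "0 < r" using m r by simp
  define g where "g = real (grid r m j) / r"
  have gb: "real (grid r m j) \<le> r * (real j / real m)" "r * (real j / real m) - 1 \<le> real (grid r m j)"
    using grid_bounds[of r m j] r0 grid_bounds(2)[of r j m] by auto
  have "g \<le> r * (real j / real m) / r" "(r * (real j / real m) - 1) / r \<le> g"
    unfolding g_def by (rule divide_right_mono[OF gb(1) less_imp_le[OF r0]], rule divide_right_mono[OF gb(2) less_imp_le[OF r0]])
  then have g: "g \<le> real j / real m" "real j / real m - 1 / r \<le> g" using r0 by (auto simp: diff_divide_distrib)
  have rm: "1 / r \<le> 1 / real m" using r m by (intro divide_left_mono) auto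
  have "1 / real m \<le> 1" using m by simp
  then have "g \<in> {0..T + 1}" using g j r0 by (auto simp: g_def)
  moreover have "\<bar>t - g\<bar> \<le> 2 / real m" using g j rm by linarith
  ultimately show "\<bar>(\<Sum>i<j. grid_increment r m z i) / sqrt (real m) - rescaled r z t\<bar> \<le> e"
    unfolding sum_grid_increment[of m r z, OF m r0 z] g_def[symmetric] by (rule osc)
qed

lemma polygon_tendsto_path:
  assumes w: "continuous_on {0..} w" "w 0 = 0" and T: "0 \<le> T" and e: "0 < e"
    and J: "\<And>m. real (Suc m) * T + 1 \<le> real (J m)"
  shows "\<forall>\<^sub>F m in sequentially. \<forall>t\<in>{0..T}. \<bar>polygon (Suc m) (J m) (brownian_increment (Suc m) w) t - w t\<bar> \<le> e"
proof -
  have "uniformly_continuous_on {0..T + 1} w"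
    using w(1) by (intro compact_uniformly_continuous) (auto elim!: continuous_on_subset)
  then obtain d where d: "0 < d" and osc: "\<And>s t. s \<in> {0..T + 1} \<Longrightarrow> t \<in> {0..T + 1} \<Longrightarrow> dist t s < d \<Longrightarrow> dist (w t) (w s) < e"
    unfolding uniformly_continuous_on_def using e by metis
  have "\<forall>\<^sub>F m in sequentially. inverse (real (Suc m)) < d"
    using order_tendstoD(2)[OF LIMSEQ_inverse_real_of_nat d] .
  then show ?thesis
  proof eventually_elim
    case (elim m)
    show ?case
    proof
      fix t assume t: "t \<in> {0..T}"
      show "\<bar>polygon (Suc m) (J m) (brownian_increment (Suc m) w) t - w t\<bar> \<le> e"
      proof (rule polygon_close[OF _ _ _ J])
        fix j assume j: "real j / real (Suc m) \<le> T + 1 / real (Suc m)" "\<bar>t - real j / real (Suc m)\<bar> \<le> 1 / real (Suc m)"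
        have "(\<Sum>i<j. brownian_increment (Suc m) w i) = sqrt (real (Suc m)) * (\<Sum>i<j. w (real (Suc i) / real (Suc m)) - w (real i / real (Suc m)))"
          by (simp add: brownian_increment_def sum_distrib_left)
        also have "(\<Sum>i<j. w (real (Suc i) / real (Suc m)) - w (real i / real (Suc m))) = w (real j / real (Suc m)) - w (real 0 / real (Suc m))"
          by (rule sum_lessThan_telescope)
        finally have "(\<Sum>i<j. brownian_increment (Suc m) w i) / sqrt (real (Suc m)) = w (real j / real (Suc m))"
          using w(2) by simp
        moreover have "1 / real (Suc m) \<le> 1" by simp
        then have "real j / real (Suc m) \<le> T + 1" using j(1) by linarith
        then have "real j / real (Suc m) \<in> {0..T + 1}" by simp
        moreover have "dist t (real j / real (Suc m)) < d"
          using j(2) elim by (simp add: dist_real_def inverse_eq_divide del: of_nat_Suc)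
        ultimately show "\<bar>(\<Sum>i<j. brownian_increment (Suc m) w i) / sqrt (real (Suc m)) - w t\<bar> \<le> e"
          using osc[of t "real j / real (Suc m)"] t by (auto simp: dist_real_def dist_commute abs_minus_commute simp del: of_nat_Suc)
      qed (use t in auto)
    qed
  qed
qed

text \<open>The walks have time scales \<open>rX\<close> and \<open>rY\<close> of their own: in the comb the horizontal walk makes about
  \<open>sqrt n\<close> steps while the vertical one makes \<open>n\<close>.\<close>

locale two_walks =
  X: zero_lazy_walk M cX X + Y: zero_lazy_walk M cY Y + N: prob_space N
  for M :: "'a measure" and N :: "'b measure" and cX cY X Y +
  fixes W B :: "real \<Rightarrow> 'b \<Rightarrow> real" and rX rY :: "nat \<Rightarrow> real"
  assumes indep: "indep_chains M X Y"
    and W: "standard_brownian_motion N W" and B: "standard_brownian_motion N B"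
    and WB: "indep_processes N W B"
    and rX: "filterlim rX at_top sequentially" "\<And>n. 0 \<le> rX n"
    and rY: "filterlim rY at_top sequentially" "\<And>n. 0 \<le> rY n"
begin

lemma brownian_measurable:
  assumes "0 \<le> t" shows "W t \<in> borel_measurable N" "B t \<in> borel_measurable N"
  using W B assms by (simp_all add: standard_brownian_motion_def)

lemma brownian_continuous:
  assumes "\<omega> \<in> space N" shows "continuous_on {0..} (\<lambda>t. W t \<omega>)" "continuous_on {0..} (\<lambda>t. B t \<omega>)"
  using W B assms by (simp_all add: standard_brownian_motion_def)

definition walk_pair :: "nat \<Rightarrow> 'a \<Rightarrow> real \<Rightarrow> real \<times> real" where
  "walk_pair n \<omega> = path_pair (rescaled (rX n) (X.path \<omega>)) (rescaled (rY n) (Y.path \<omega>))"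

definition brownian_pair :: "'b \<Rightarrow> real \<Rightarrow> real \<times> real" where
  "brownian_pair \<omega> = path_pair (\<lambda>t. W t \<omega>) (\<lambda>t. B t \<omega>)"

lemma walk_pair_measurable: "walk_pair n \<in> M \<rightarrow>\<^sub>M borel_sets_of path_topology"
  unfolding walk_pair_def
  by (rule random_path_pairI) (intro continuous_on_rescaled rX rY X.measurable_rescaled Y.measurable_rescaled)+

lemma brownian_pair_measurable: "brownian_pair \<in> N \<rightarrow>\<^sub>M borel_sets_of path_topology"
  unfolding brownian_pair_def
  by (rule random_path_pairI) (intro brownian_continuous brownian_measurable, assumption)+

text \<open>Independence of the walks factorises the expectation; each factor then converges.\<close>

lemma grid_increments_independent:
  fixes \<rho> :: "bool \<times> nat \<Rightarrow> real \<Rightarrow> real"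
  assumes m: "0 < m"
    and \<rho>: "\<And>i. continuous_on UNIV (\<rho> i)" "\<And>i x. 0 \<le> \<rho> i x" "\<And>i x. \<rho> i x \<le> 1"
  shows "(\<lambda>n. \<integral>\<omega>. (\<Prod>j<J. \<rho> (True, j) (grid_increment (rX n) m (X.path \<omega>) j)) *
       (\<Prod>j<J. \<rho> (False, j) (grid_increment (rY n) m (Y.path \<omega>) j)) \<partial>M) \<longlonglongrightarrow>
     (\<Prod>j<J. \<integral>x. \<rho> (True, j) x \<partial>std_normal_distribution) * (\<Prod>j<J. \<integral>x. \<rho> (False, j) x \<partial>std_normal_distribution)"
proof -
  have \<rho>m [measurable]: "\<rho> i \<in> borel_measurable borel" for i using \<rho>(1) by (rule borel_measurable_continuous_onI)
  define F where "F b r z = (\<Prod>j<J. \<rho> (b, j) (grid_increment r m z j))" for b r z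
  have F: "F b r \<in> borel_measurable (\<Pi>\<^sub>M i\<in>UNIV. count_space UNIV)" for b r
    unfolding F_def grid_increment_def by measurable
  have F01: "0 \<le> F b r z" "F b r z \<le> 1" for b r z
    unfolding F_def by (auto intro!: prod_nonneg prod_le_1 \<rho>)
  have iv: "X.indep_var (\<Pi>\<^sub>M i\<in>UNIV. count_space UNIV) X.path (\<Pi>\<^sub>M i\<in>UNIV. count_space UNIV) Y.path"
    using indep by (simp add: indep_chains_def)
  have "(\<integral>\<omega>. F True (rX n) (X.path \<omega>) * F False (rY n) (Y.path \<omega>) \<partial>M) =
      (\<integral>\<omega>. F True (rX n) (X.path \<omega>) \<partial>M) * (\<integral>\<omega>. F False (rY n) (Y.path \<omega>) \<partial>M)" for n
  proof (rule X.indep_var_lebesgue_integral)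
    show "X.indep_var borel (\<lambda>\<omega>. F True (rX n) (X.path \<omega>)) borel (\<lambda>\<omega>. F False (rY n) (Y.path \<omega>))"
      using X.indep_var_compose[OF iv F F] by (simp add: comp_def)
    then have "(\<lambda>\<omega>. F True (rX n) (X.path \<omega>)) \<in> borel_measurable M" "(\<lambda>\<omega>. F False (rY n) (Y.path \<omega>)) \<in> borel_measurable M"
      by (auto dest: X.indep_var_rv1 X.indep_var_rv2)
    then show "integrable M (\<lambda>\<omega>. F True (rX n) (X.path \<omega>))" "integrable M (\<lambda>\<omega>. F False (rY n) (Y.path \<omega>))"
      using F01 by (auto intro!: X.integrable_const_bound[of _ 1] simp: abs_of_nonneg)
  qed
  moreover have "(\<lambda>n. (\<integral>\<omega>. F True (rX n) (X.path \<omega>) \<partial>M) * (\<integral>\<omega>. F False (rY n) (Y.path \<omega>) \<partial>M)) \<longlonglongrightarrow>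
     (\<Prod>j<J. \<integral>x. \<rho> (True, j) x \<partial>std_normal_distribution) * (\<Prod>j<J. \<integral>x. \<rho> (False, j) x \<partial>std_normal_distribution)"
    unfolding F_def
    by (intro tendsto_mult X.grid_increments_limit[of rX m "\<lambda>j. \<rho> (True, j)"] Y.grid_increments_limit[of rY m "\<lambda>j. \<rho> (False, j)"] rX rY m \<rho>)
  ultimately show ?thesis by (simp add: F_def)
qed

lemma brownian_increments_independent:
  fixes \<rho> :: "bool \<times> nat \<Rightarrow> real \<Rightarrow> real"
  assumes m: "0 < m"
    and \<rho>: "\<And>i. continuous_on UNIV (\<rho> i)" "\<And>i x. 0 \<le> \<rho> i x" "\<And>i x. \<rho> i x \<le> 1"
  shows "(\<integral>\<omega>. (\<Prod>j<J. \<rho> (True, j) (brownian_increment m (\<lambda>t. W t \<omega>) j)) *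
       (\<Prod>j<J. \<rho> (False, j) (brownian_increment m (\<lambda>t. B t \<omega>) j)) \<partial>N) =
     (\<Prod>j<J. \<integral>x. \<rho> (True, j) x \<partial>std_normal_distribution) * (\<Prod>j<J. \<integral>x. \<rho> (False, j) x \<partial>std_normal_distribution)"
proof -
  have \<rho>m [measurable]: "\<rho> i \<in> borel_measurable borel" for i using \<rho>(1) by (rule borel_measurable_continuous_onI)
  define F where "F b w = (\<Prod>j<J. \<rho> (b, j) (brownian_increment m w j))" for b w
  have F: "F b \<in> borel_measurable (\<Pi>\<^sub>M t\<in>{0..}. borel)" for b
    unfolding F_def brownian_increment_def
    by (intro borel_measurable_prod measurable_compose[OF _ \<rho>m] borel_measurable_times borel_measurable_diff
        borel_measurable_const measurable_component_singleton) auto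
  have F01: "0 \<le> F b w" "F b w \<le> 1" for b w
    unfolding F_def by (auto intro!: prod_nonneg prod_le_1 \<rho>)
  have restrict: "F b (\<lambda>t\<in>{0..}. w t) = F b w" for b w
    unfolding F_def brownian_increment_def by simp
  have iv: "N.indep_var (\<Pi>\<^sub>M t\<in>{0..}. borel) (\<lambda>\<omega>. \<lambda>t\<in>{0..}. W t \<omega>) (\<Pi>\<^sub>M t\<in>{0..}. borel) (\<lambda>\<omega>. \<lambda>t\<in>{0..}. B t \<omega>)"
    using WB by (simp add: indep_processes_def)
  have "N.indep_var borel (\<lambda>\<omega>. F True (\<lambda>t. W t \<omega>)) borel (\<lambda>\<omega>. F False (\<lambda>t. B t \<omega>))"
    using N.indep_var_compose[OF iv F F, of True False] unfolding comp_def restrict .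
  moreover from this have "(\<lambda>\<omega>. F True (\<lambda>t. W t \<omega>)) \<in> borel_measurable N" "(\<lambda>\<omega>. F False (\<lambda>t. B t \<omega>)) \<in> borel_measurable N"
    by (auto dest: N.indep_var_rv1 N.indep_var_rv2)
  ultimately have "(\<integral>\<omega>. F True (\<lambda>t. W t \<omega>) * F False (\<lambda>t. B t \<omega>) \<partial>N) =
      (\<integral>\<omega>. F True (\<lambda>t. W t \<omega>) \<partial>N) * (\<integral>\<omega>. F False (\<lambda>t. B t \<omega>) \<partial>N)"
    using F01 by (intro N.indep_var_lebesgue_integral) (auto intro!: N.integrable_const_bound[of _ 1] simp: abs_of_nonneg)
  also have "\<dots> = (\<Prod>j<J. \<integral>x. \<rho> (True, j) x \<partial>std_normal_distribution) * (\<Prod>j<J. \<integral>x. \<rho> (False, j) x \<partial>std_normal_distribution)"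
    unfolding F_def
    using brownian_increments_prod[OF N.prob_space_axioms W m, of "\<lambda>j. \<rho> (True, j)"]
      brownian_increments_prod[OF N.prob_space_axioms B m, of "\<lambda>j. \<rho> (False, j)"] \<rho> by simp
  finally show ?thesis by (simp add: F_def)
qed

text \<open>The increments of both walks are one family indexed by \<open>bool \<times> nat\<close>, \<open>True\<close> standing for the first
  walk, so that the limit theorem for functions of a finite family applies.\<close>

definition polygon_pair :: "nat \<Rightarrow> nat \<Rightarrow> (bool \<times> nat \<Rightarrow> real) \<Rightarrow> real \<Rightarrow> real \<times> real" where
  "polygon_pair m J x = path_pair (polygon m J (\<lambda>j. x (True, j))) (polygon m J (\<lambda>j. x (False, j)))"

lemma polygon_pair_in_cpaths: "polygon_pair m J x \<in> cpaths"
  unfolding polygon_pair_def by (intro path_pair_in_cpaths continuous_on_polygon)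

lemma polygon_pair_measurable:
  assumes "\<And>i. (\<lambda>\<omega>. x i \<omega>) \<in> borel_measurable L"
  shows "(\<lambda>\<omega>. polygon_pair m J (\<lambda>i. x i \<omega>)) \<in> L \<rightarrow>\<^sub>M borel_sets_of path_topology"
  unfolding polygon_pair_def
proof (rule random_path_pairI)
  have "(\<lambda>\<omega>. polygon m J (\<lambda>j. x (b, j) \<omega>) t) \<in> borel_measurable L" for b t
    unfolding polygon_def by (intro measurable_lin_interp borel_measurable_divide borel_measurable_sum borel_measurable_const assms)
  note this[of True] this[of False]
  then show "(\<lambda>\<omega>. polygon m J (\<lambda>j. x (True, j) \<omega>) t) \<in> borel_measurable L"
    "(\<lambda>\<omega>. polygon m J (\<lambda>j. x (False, j) \<omega>) t) \<in> borel_measurable L" for t by simp_all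
qed (rule continuous_on_polygon)+

definition walk_increments :: "nat \<Rightarrow> nat \<Rightarrow> bool \<times> nat \<Rightarrow> 'a \<Rightarrow> real" where
  "walk_increments m n i \<omega> = (if fst i then grid_increment (rX n) m (X.path \<omega>) (snd i) else grid_increment (rY n) m (Y.path \<omega>) (snd i))"

definition brownian_increments :: "nat \<Rightarrow> bool \<times> nat \<Rightarrow> 'b \<Rightarrow> real" where
  "brownian_increments m i \<omega> = (if fst i then brownian_increment m (\<lambda>t. W t \<omega>) (snd i) else brownian_increment m (\<lambda>t. B t \<omega>) (snd i))"

lemma walk_increments_measurable: "walk_increments m n i \<in> borel_measurable M"
proof -
  have "depends_upto (max (grid r m j) (grid r m (Suc j))) (\<lambda>z. grid_increment r m z j)" for r j
    by (rule depends_uptoI) (simp add: grid_increment_def)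
  note X.borel_measurable_past[OF this] Y.borel_measurable_past[OF this]
  then show ?thesis unfolding walk_increments_def by (cases "fst i") auto
qed

lemma brownian_increments_measurable: "brownian_increments m i \<in> borel_measurable N"
  unfolding brownian_increments_def brownian_increment_def
  by (cases "fst i") (auto intro!: borel_measurable_times borel_measurable_diff brownian_measurable)

text \<open>A Lipschitz functional of the polygons is a bounded Lipschitz function of finitely many increments.\<close>

lemma polygon_functional_tendsto:
  fixes \<phi> :: "(real \<Rightarrow> real \<times> real) \<Rightarrow> real"
  assumes lip: "horizon_lipschitz T K \<phi>" and C: "\<And>f. f \<in> cpaths \<Longrightarrow> \<bar>\<phi> f\<bar> \<le> C" and m: "0 < m"
  shows "(\<lambda>n. \<integral>\<omega>. \<phi> (polygon_pair m J (\<lambda>i. walk_increments m n i \<omega>)) \<partial>M) \<longlonglongrightarrow>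
     (\<integral>\<omega>. \<phi> (polygon_pair m J (\<lambda>i. brownian_increments m i \<omega>)) \<partial>N)"
proof (rule tendsto_integral_of_products[where I = "UNIV \<times> {..<J}" and K = "2 * (K * real J)"
      and f = "\<lambda>x. \<phi> (polygon_pair m J x)"])
  have K: "0 \<le> K" using lip by (simp add: horizon_lipschitz_def)
  show "prob_space M" "prob_space N" by unfold_locales
  note \<phi>m = measurable_continuous_functional[OF horizon_lipschitz_continuous[OF lip]]
  show "(\<lambda>\<omega>. \<phi> (polygon_pair m J (\<lambda>i. walk_increments m n i \<omega>))) \<in> borel_measurable M" for n
    by (rule measurable_compose[OF polygon_pair_measurable \<phi>m]) (rule walk_increments_measurable)
  show "(\<lambda>\<omega>. \<phi> (polygon_pair m J (\<lambda>i. brownian_increments m i \<omega>))) \<in> borel_measurable N"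
    by (rule measurable_compose[OF polygon_pair_measurable \<phi>m]) (rule brownian_increments_measurable)
  show "\<bar>\<phi> (polygon_pair m J x)\<bar> \<le> C" for x by (intro C polygon_pair_in_cpaths)
  show "0 \<le> 2 * (K * real J)" using K by simp
  show "\<bar>\<phi> (polygon_pair m J x) - \<phi> (polygon_pair m J y)\<bar> \<le> 2 * (K * real J) * e"
    if d: "\<And>i. i \<in> UNIV \<times> {..<J} \<Longrightarrow> \<bar>x i - y i\<bar> \<le> e" for x y :: "bool \<times> nat \<Rightarrow> real" and e
  proof (cases "J = 0")
    case True
    have "polygon m 0 f = polygon m 0 g" for f g by (simp add: fun_eq_iff polygon_def)
    then have "polygon_pair m J x = polygon_pair m J y" unfolding polygon_pair_def True by metis
    then show ?thesis using True by simp
  next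
    case False
    have e: "0 \<le> e" using d[of "(True, 0)"] False by auto
    have "\<bar>\<phi> (polygon_pair m J x) - \<phi> (polygon_pair m J y)\<bar> \<le> K * (real J * e + real J * e)"
    proof (rule horizon_lipschitzD[OF lip polygon_pair_in_cpaths polygon_pair_in_cpaths])
      fix t :: real assume t: "0 \<le> t" "t \<le> T"
      show "dist (polygon_pair m J x t) (polygon_pair m J y t) \<le> real J * e + real J * e"
        unfolding polygon_pair_def path_pair_apply[OF t(1)]
        by (rule order_trans[OF dist_pair_le add_mono]) (intro polygon_lipschitz m t d e; simp)+
    qed
    then show ?thesis by (simp add: algebra_simps)
  qed
  fix \<rho> :: "bool \<times> nat \<Rightarrow> real \<Rightarrow> real"
  assume \<rho>: "\<And>i. continuous_on UNIV (\<rho> i)" "\<And>i x. 0 \<le> \<rho> i x" "\<And>i x. \<rho> i x \<le> 1"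
  have split: "(\<Prod>i\<in>UNIV \<times> {..<J}. g i) = (\<Prod>j<J. g (True, j)) * (\<Prod>j<J. g (False, j))" for g :: "bool \<times> nat \<Rightarrow> real"
  proof -
    have "(\<Prod>i\<in>UNIV \<times> {..<J}. g i) = (\<Prod>b\<in>UNIV. \<Prod>j<J. g (b, j))" by (simp add: prod.cartesian_product)
    then show ?thesis by (simp add: UNIV_bool mult.commute)
  qed
  show "(\<lambda>n. \<integral>\<omega>. (\<Prod>i\<in>UNIV \<times> {..<J}. \<rho> i (walk_increments m n i \<omega>)) \<partial>M) \<longlonglongrightarrow>
      (\<integral>\<omega>. (\<Prod>i\<in>UNIV \<times> {..<J}. \<rho> i (brownian_increments m i \<omega>)) \<partial>N)"
    unfolding split using grid_increments_independent[of m \<rho> J, OF m \<rho>] brownian_increments_independent[of m \<rho> J, OF m \<rho>]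
    by (simp add: walk_increments_def brownian_increments_def)
qed (auto intro: walk_increments_measurable brownian_increments_measurable)

text \<open>Donsker's theorem for the pair. A Lipschitz functional of the walks is compared with the same
  functional of their polygonal approximations, which depends on finitely many increments only.\<close>

theorem walk_pair_converges: "converges_in_law path_topology M walk_pair N brownian_pair"
proof (rule converges_in_lawI_lipschitz)
  show "prob_space M" "prob_space N" by unfold_locales
  show "walk_pair n \<in> M \<rightarrow>\<^sub>M borel_sets_of path_topology" for n by (rule walk_pair_measurable)
  show "brownian_pair \<in> N \<rightarrow>\<^sub>M borel_sets_of path_topology" by (rule brownian_pair_measurable)
  fix \<phi> :: "(real \<Rightarrow> real \<times> real) \<Rightarrow> real" and T K C
  assume lip: "horizon_lipschitz T K \<phi>" and C: "\<And>f. f \<in> cpaths \<Longrightarrow> \<bar>\<phi> f\<bar> \<le> C"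
  have T: "0 \<le> T" and K: "0 \<le> K" using lip by (auto simp: horizon_lipschitz_def)
  have C0: "0 \<le> C" using C[OF polygon_pair_in_cpaths[of 1 0 "\<lambda>_. 0"]] by linarith
  note \<phi>m = measurable_continuous_functional[OF horizon_lipschitz_continuous[OF lip]]
  \<comment> \<open>Enough increments for the polygon of mesh \<open>1/(m+1)\<close> to cover the horizon.\<close>
  define J where "J m = Suc m * (nat \<lceil>T\<rceil> + 1)" for m
  have J: "real (Suc m) * T + 1 \<le> real (J m)" for m
  proof -
    have "real (Suc m) * T + 1 \<le> real (Suc m) * real (nat \<lceil>T\<rceil>) + real (Suc m)"
      by (intro add_mono mult_left_mono real_nat_ceiling_ge) auto
    then show ?thesis by (simp only: J_def of_nat_mult of_nat_add distrib_left of_nat_1 mult_1_right)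
  qed
  have limit: "(\<lambda>m. \<integral>\<omega>. \<phi> (polygon_pair (Suc m) (J m) (\<lambda>i. brownian_increments (Suc m) i \<omega>)) \<partial>N) \<longlonglongrightarrow> (\<integral>\<omega>. \<phi> (brownian_pair \<omega>) \<partial>N)"
  proof (rule tendsto_integral_path_functional[OF \<open>prob_space N\<close> lip C brownian_pair_measurable])
    show "(\<lambda>\<omega>. \<phi> (polygon_pair (Suc m) (J m) (\<lambda>i. brownian_increments (Suc m) i \<omega>))) \<in> borel_measurable N" for m
      by (rule measurable_compose[OF polygon_pair_measurable \<phi>m]) (rule brownian_increments_measurable)
    have "AE \<omega> in N. W 0 \<omega> = 0" "AE \<omega> in N. B 0 \<omega> = 0" using W B by (auto simp: standard_brownian_motion_def)
    then show "AE \<omega> in N. \<forall>e>0. \<forall>\<^sub>F m in sequentially. \<forall>t\<in>{0..T}.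
        dist (polygon_pair (Suc m) (J m) (\<lambda>i. brownian_increments (Suc m) i \<omega>) t) (brownian_pair \<omega> t) \<le> e"
      using AE_space
    proof eventually_elim
      case (elim \<omega>)
      show ?case
      proof (intro allI impI)
        fix e :: real assume "0 < e"
        then have e: "0 < e / 2" by simp
        note brownian_continuous[OF elim(3)]
        from polygon_tendsto_path[OF this(1) elim(1) T e J] polygon_tendsto_path[OF this(2) elim(2) T e J]
        show "\<forall>\<^sub>F m in sequentially. \<forall>t\<in>{0..T}.
           dist (polygon_pair (Suc m) (J m) (\<lambda>i. brownian_increments (Suc m) i \<omega>) t) (brownian_pair \<omega> t) \<le> e"
        proof eventually_elim
          case (elim m)
          show ?case
          proof
            fix t assume t: "t \<in> {0..T}"
            then have "dist (polygon_pair (Suc m) (J m) (\<lambda>i. brownian_increments (Suc m) i \<omega>) t) (brownian_pair \<omega> t) \<le>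
              \<bar>polygon (Suc m) (J m) (brownian_increment (Suc m) (\<lambda>t. W t \<omega>)) t - W t \<omega>\<bar> +
              \<bar>polygon (Suc m) (J m) (brownian_increment (Suc m) (\<lambda>t. B t \<omega>)) t - B t \<omega>\<bar>"
              unfolding polygon_pair_def brownian_pair_def brownian_increments_def
              by (simp add: dist_pair_le)
            also have "\<dots> \<le> e / 2 + e / 2" using elim t by (intro add_mono) auto
            finally show "dist (polygon_pair (Suc m) (J m) (\<lambda>i. brownian_increments (Suc m) i \<omega>) t) (brownian_pair \<omega> t) \<le> e" by simp
          qed
        qed
      qed
    qed
  qed (use polygon_pair_in_cpaths in auto)
  show "(\<lambda>n. \<integral>\<omega>. \<phi> (walk_pair n \<omega>) \<partial>M) \<longlonglongrightarrow> (\<integral>\<omega>. \<phi> (brownian_pair \<omega>) \<partial>N)"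
  proof (rule tendstoI)
    fix e :: real assume e: "0 < e"
    define \<eta> where "\<eta> = e / (8 * (K + 1))"
    define \<kappa> where "\<kappa> = e / (16 * (C + 1))"
    have \<eta>0: "0 < \<eta>" and \<kappa>0: "0 < \<kappa>" using e K C0 by (auto simp: \<eta>_def \<kappa>_def)
    have "K + 1 \<noteq> 0" "C + 1 \<noteq> 0" using K C0 by auto
    then have "(K + 1) * \<eta> = e / 8" "(C + 1) * \<kappa> = e / 16" unfolding \<eta>_def \<kappa>_def by (simp_all add: divide_simps)
    then have \<eta>: "0 < \<eta>" "K * (\<eta> + \<eta>) \<le> e / 4" and \<kappa>: "0 < \<kappa>" "2 * C * (\<kappa> + \<kappa>) \<le> e / 4"
      using \<eta>0 \<kappa>0 by (simp_all add: algebra_simps)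
    have T1: "0 \<le> T + 1" using T by simp
    \<comment> \<open>The mesh is chosen first, from the moduli of continuity that hold uniformly in \<open>n\<close>.\<close>
    obtain \<delta>X where \<delta>X: "0 < \<delta>X" "\<forall>\<^sub>F n in sequentially. \<exists>A\<in>sets M. measure M A \<le> \<kappa> \<and> space M - A \<subseteq> X.regular \<and>
       (\<forall>\<omega>\<in>space M - A. \<forall>s\<in>{0..T + 1}. \<forall>t\<in>{0..T + 1}. \<bar>s - t\<bar> \<le> \<delta>X \<longrightarrow>
          \<bar>rescaled (rX n) (X.path \<omega>) s - rescaled (rX n) (X.path \<omega>) t\<bar> \<le> \<eta>)"
      by (rule X.oscillation[OF rX T1 \<eta>(1) \<kappa>(1)])
    obtain \<delta>Y where \<delta>Y: "0 < \<delta>Y" "\<forall>\<^sub>F n in sequentially. \<exists>A\<in>sets M. measure M A \<le> \<kappa> \<and> space M - A \<subseteq> Y.regular \<and>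
       (\<forall>\<omega>\<in>space M - A. \<forall>s\<in>{0..T + 1}. \<forall>t\<in>{0..T + 1}. \<bar>s - t\<bar> \<le> \<delta>Y \<longrightarrow>
          \<bar>rescaled (rY n) (Y.path \<omega>) s - rescaled (rY n) (Y.path \<omega>) t\<bar> \<le> \<eta>)"
      by (rule Y.oscillation[OF rY T1 \<eta>(1) \<kappa>(1)])
    have "\<forall>\<^sub>F m in sequentially. inverse (real (Suc m)) < min \<delta>X \<delta>Y / 2"
      using \<delta>X(1) \<delta>Y(1) by (intro order_tendstoD(2)[OF LIMSEQ_inverse_real_of_nat]) auto
    moreover have "\<forall>\<^sub>F m in sequentially. dist (\<integral>\<omega>. \<phi> (polygon_pair (Suc m) (J m) (\<lambda>i. brownian_increments (Suc m) i \<omega>)) \<partial>N) (\<integral>\<omega>. \<phi> (brownian_pair \<omega>) \<partial>N) < e / 4"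
      using e by (intro tendstoD[OF limit]) auto
    ultimately have "\<forall>\<^sub>F m in sequentially. inverse (real (Suc m)) < min \<delta>X \<delta>Y / 2 \<and>
       dist (\<integral>\<omega>. \<phi> (polygon_pair (Suc m) (J m) (\<lambda>i. brownian_increments (Suc m) i \<omega>)) \<partial>N) (\<integral>\<omega>. \<phi> (brownian_pair \<omega>) \<partial>N) < e / 4"
      by (rule eventually_conj)
    then obtain m' where m': "inverse (real (Suc m')) < min \<delta>X \<delta>Y / 2"
       "dist (\<integral>\<omega>. \<phi> (polygon_pair (Suc m') (J m') (\<lambda>i. brownian_increments (Suc m') i \<omega>)) \<partial>N) (\<integral>\<omega>. \<phi> (brownian_pair \<omega>) \<partial>N) < e / 4"
      using eventually_happens'[OF sequentially_bot] by blast
    define m where "m = Suc m'"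
    have m: "0 < m" "2 / real m \<le> \<delta>X" "2 / real m \<le> \<delta>Y" using m'(1) by (auto simp: m_def inverse_eq_divide simp del: of_nat_Suc)
    have Jm: "real m * T + 1 \<le> real (J m')" using J by (simp only: m_def)
    have "\<forall>\<^sub>F n in sequentially. dist (\<integral>\<omega>. \<phi> (polygon_pair m (J m') (\<lambda>i. walk_increments m n i \<omega>)) \<partial>M)
       (\<integral>\<omega>. \<phi> (polygon_pair m (J m') (\<lambda>i. brownian_increments m i \<omega>)) \<partial>N) < e / 4"
      using e by (intro tendstoD[OF polygon_functional_tendsto[OF lip C m(1)]]) auto
    moreover have "\<forall>\<^sub>F n in sequentially. real m \<le> rX n" "\<forall>\<^sub>F n in sequentially. real m \<le> rY n"
      using rX(1) rY(1) by (auto simp: filterlim_at_top)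
    ultimately show "\<forall>\<^sub>F n in sequentially. dist (\<integral>\<omega>. \<phi> (walk_pair n \<omega>) \<partial>M) (\<integral>\<omega>. \<phi> (brownian_pair \<omega>) \<partial>N) < e"
      using \<delta>X(2) \<delta>Y(2)
    proof eventually_elim
      case (elim n)
      obtain AX where AX: "AX \<in> sets M" "measure M AX \<le> \<kappa>" "space M - AX \<subseteq> X.regular"
        "\<And>\<omega> s t. \<omega> \<in> space M - AX \<Longrightarrow> s \<in> {0..T + 1} \<Longrightarrow> t \<in> {0..T + 1} \<Longrightarrow> \<bar>s - t\<bar> \<le> \<delta>X \<Longrightarrow>
          \<bar>rescaled (rX n) (X.path \<omega>) s - rescaled (rX n) (X.path \<omega>) t\<bar> \<le> \<eta>"
        using elim(4) by blast
      obtain AY where AY: "AY \<in> sets M" "measure M AY \<le> \<kappa>" "space M - AY \<subseteq> Y.regular"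
        "\<And>\<omega> s t. \<omega> \<in> space M - AY \<Longrightarrow> s \<in> {0..T + 1} \<Longrightarrow> t \<in> {0..T + 1} \<Longrightarrow> \<bar>s - t\<bar> \<le> \<delta>Y \<Longrightarrow>
          \<bar>rescaled (rY n) (Y.path \<omega>) s - rescaled (rY n) (Y.path \<omega>) t\<bar> \<le> \<eta>"
        using elim(5) by blast
      have "\<bar>(\<integral>\<omega>. \<phi> (walk_pair n \<omega>) \<partial>M) - (\<integral>\<omega>. \<phi> (polygon_pair m (J m') (\<lambda>i. walk_increments m n i \<omega>)) \<partial>M)\<bar>
          \<le> K * (\<eta> + \<eta>) + 2 * C * measure M (AX \<union> AY)"
      proof (rule abs_integral_diff_le)
        show "prob_space M" by unfold_locales
        show "(\<lambda>\<omega>. \<phi> (walk_pair n \<omega>)) \<in> borel_measurable M"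
          by (rule measurable_compose[OF walk_pair_measurable \<phi>m])
        show "(\<lambda>\<omega>. \<phi> (polygon_pair m (J m') (\<lambda>i. walk_increments m n i \<omega>))) \<in> borel_measurable M"
          by (rule measurable_compose[OF polygon_pair_measurable \<phi>m]) (rule walk_increments_measurable)
        show "AX \<union> AY \<in> sets M" using AX AY by simp
        show "\<bar>\<phi> (walk_pair n \<omega>)\<bar> \<le> C" if "\<omega> \<in> space M" for \<omega>
          by (rule C, rule random_path_in_cpaths[OF walk_pair_measurable that])
        show "\<bar>\<phi> (polygon_pair m (J m') (\<lambda>i. walk_increments m n i \<omega>))\<bar> \<le> C" for \<omega>
          by (intro C polygon_pair_in_cpaths)
        show "0 \<le> K * (\<eta> + \<eta>)" using K \<eta> by simp
        fix \<omega> assume w: "\<omega> \<in> space M - (AX \<union> AY)"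
        then have wX: "\<omega> \<in> space M - AX" and wY: "\<omega> \<in> space M - AY" and ws: "\<omega> \<in> space M" by auto
        have zX: "X 0 \<omega> = 0" using AX(3) wX by (auto simp: X.regular_def)
        have zY: "Y 0 \<omega> = 0" using AY(3) wY by (auto simp: Y.regular_def)
        show "\<bar>\<phi> (walk_pair n \<omega>) - \<phi> (polygon_pair m (J m') (\<lambda>i. walk_increments m n i \<omega>))\<bar> \<le> K * (\<eta> + \<eta>)"
        proof (rule horizon_lipschitzD[OF lip random_path_in_cpaths[OF walk_pair_measurable ws] polygon_pair_in_cpaths])
          fix t assume t: "0 \<le> t" "t \<le> T"
          have "\<bar>polygon m (J m') (grid_increment (rX n) m (X.path \<omega>)) t - rescaled (rX n) (X.path \<omega>) t\<bar> \<le> \<eta>"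
            using t m(2) by (intro polygon_close_walk[OF m(1) elim(2) _ t Jm] zX AX(4)[OF wX]) auto
          moreover have "\<bar>polygon m (J m') (grid_increment (rY n) m (Y.path \<omega>)) t - rescaled (rY n) (Y.path \<omega>) t\<bar> \<le> \<eta>"
            using t m(3) by (intro polygon_close_walk[OF m(1) elim(3) _ t Jm] zY AY(4)[OF wY]) auto
          ultimately show "dist (walk_pair n \<omega> t) (polygon_pair m (J m') (\<lambda>i. walk_increments m n i \<omega>) t) \<le> \<eta> + \<eta>"
            unfolding walk_pair_def polygon_pair_def walk_increments_def path_pair_apply[OF t(1)]
            by (intro order_trans[OF dist_pair_le add_mono]) (simp_all add: abs_minus_commute)
        qed
      qed
      moreover have "measure M (AX \<union> AY) \<le> \<kappa> + \<kappa>"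
        using measure_Un_le[OF AX(1) AY(1)] AX(2) AY(2) by linarith
      then have "2 * C * measure M (AX \<union> AY) \<le> 2 * C * (\<kappa> + \<kappa>)" using C0 by (intro mult_left_mono) auto
      ultimately have "\<bar>(\<integral>\<omega>. \<phi> (walk_pair n \<omega>) \<partial>M) - (\<integral>\<omega>. \<phi> (polygon_pair m (J m') (\<lambda>i. walk_increments m n i \<omega>)) \<partial>M)\<bar> \<le> e / 2"
        using \<eta>(2) \<kappa>(2) by linarith
      then show ?case using elim(1) m'(2) unfolding m_def[symmetric] dist_real_def by linarith
    qed
  qed
qed

end

section \<open>Smoothed occupation times\<close>

text \<open>One on \<open>[-\<epsilon>, \<epsilon>]\<close> and zero outside \<open>[-\<epsilon> - \<epsilon>\<^sup>2, \<epsilon> + \<epsilon>\<^sup>2]\<close>: the ramps are short compared to \<open>\<epsilon>\<close>, and so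
  do not contribute in the limit.\<close>

definition plateau :: "real \<Rightarrow> real \<Rightarrow> real" where
  "plateau \<epsilon> x = max 0 (min 1 ((\<epsilon> + \<epsilon>\<^sup>2 - \<bar>x\<bar>) / \<epsilon>\<^sup>2))"

lemma plateau_bounds: "0 \<le> plateau \<epsilon> x" "plateau \<epsilon> x \<le> 1"
  by (auto simp: plateau_def)

lemma plateau_eq_1: "0 < \<epsilon> \<Longrightarrow> \<bar>x\<bar> \<le> \<epsilon> \<Longrightarrow> plateau \<epsilon> x = 1"
  by (simp add: plateau_def min_def le_divide_eq)

lemma plateau_eq_0: "0 < \<epsilon> \<Longrightarrow> \<epsilon> + \<epsilon>\<^sup>2 \<le> \<bar>x\<bar> \<Longrightarrow> plateau \<epsilon> x = 0"
proof -
  assume "0 < \<epsilon>" "\<epsilon> + \<epsilon>\<^sup>2 \<le> \<bar>x\<bar>"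
  then have "(\<epsilon> + \<epsilon>\<^sup>2 - \<bar>x\<bar>) / \<epsilon>\<^sup>2 \<le> 0" by (intro divide_nonpos_nonneg) auto
  then show ?thesis by (simp add: plateau_def)
qed

lemma plateau_lipschitz:
  assumes "0 < \<epsilon>" shows "\<bar>plateau \<epsilon> x - plateau \<epsilon> y\<bar> \<le> \<bar>x - y\<bar> / \<epsilon>\<^sup>2"
proof -
  have "\<bar>plateau \<epsilon> x - plateau \<epsilon> y\<bar> \<le> \<bar>(\<epsilon> + \<epsilon>\<^sup>2 - \<bar>x\<bar>) / \<epsilon>\<^sup>2 - (\<epsilon> + \<epsilon>\<^sup>2 - \<bar>y\<bar>) / \<epsilon>\<^sup>2\<bar>"
    unfolding plateau_def by linarith
  also have "\<dots> = \<bar>\<bar>y\<bar> - \<bar>x\<bar>\<bar> / \<epsilon>\<^sup>2" by (simp add: diff_divide_distrib[symmetric])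
  also have "\<dots> \<le> \<bar>x - y\<bar> / \<epsilon>\<^sup>2" by (intro divide_right_mono) auto
  finally show ?thesis .
qed

lemma continuous_on_plateau: "continuous_on S (plateau \<epsilon>)"
  unfolding plateau_def divide_inverse by (intro continuous_intros)

text \<open>An approximation of the local time at \<open>0\<close> which, unlike the normalised time spent in
  \<open>[-\<epsilon>, \<epsilon>]\<close>, is a continuous functional of the path.\<close>

definition smooth_occupation :: "real \<Rightarrow> (real \<Rightarrow> real) \<Rightarrow> real \<Rightarrow> real" where
  "smooth_occupation \<epsilon> y t = integral {0..t} (\<lambda>s. plateau \<epsilon> (y s)) / (2 * \<epsilon>)"

lemma plateau_integrable:
  fixes y :: "real \<Rightarrow> real"
  assumes "continuous_on {0..} y" "0 \<le> a" shows "(\<lambda>s. plateau \<epsilon> (y s)) integrable_on {a..b}"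
proof (rule Henstock_Kurzweil_Integration.integrable_continuous_real)
  have "continuous_on {a..b} y" using assms by (auto elim!: continuous_on_subset)
  then show "continuous_on {a..b} (\<lambda>s. plateau \<epsilon> (y s))"
    by (rule continuous_on_compose2[OF continuous_on_plateau[of UNIV]]) simp
qed

lemma smooth_occupation_cong:
  assumes "\<And>s. 0 \<le> s \<Longrightarrow> s \<le> t \<Longrightarrow> x s = y s"
  shows "smooth_occupation \<epsilon> x t = smooth_occupation \<epsilon> y t"
  unfolding smooth_occupation_def using assms by (intro arg_cong[where f = "\<lambda>x. x / (2 * \<epsilon>)"] integral_cong) auto

lemma smooth_occupation_0 [simp]: "smooth_occupation \<epsilon> y 0 = 0"
  by (simp add: smooth_occupation_def)

lemma smooth_occupation_increment:
  assumes \<epsilon>: "0 < \<epsilon>" and y: "continuous_on {0..} y" and st: "0 \<le> s" "s \<le> t"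
    and lo: "\<And>u. s \<le> u \<Longrightarrow> u \<le> t \<Longrightarrow> lo \<le> plateau \<epsilon> (y u)" and hi: "\<And>u. s \<le> u \<Longrightarrow> u \<le> t \<Longrightarrow> plateau \<epsilon> (y u) \<le> hi"
  shows "lo * (t - s) / (2 * \<epsilon>) \<le> smooth_occupation \<epsilon> y t - smooth_occupation \<epsilon> y s"
    and "smooth_occupation \<epsilon> y t - smooth_occupation \<epsilon> y s \<le> hi * (t - s) / (2 * \<epsilon>)"
proof -
  let ?f = "\<lambda>s. plateau \<epsilon> (y s)"
  have "integral {0..s} ?f + integral {s..t} ?f = integral {0..t} ?f"
    by (rule Henstock_Kurzweil_Integration.integral_combine[OF st plateau_integrable[OF y order_refl]])
  then have eq: "smooth_occupation \<epsilon> y t - smooth_occupation \<epsilon> y s = integral {s..t} ?f / (2 * \<epsilon>)"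
    by (simp add: smooth_occupation_def diff_divide_distrib[symmetric])
  have i: "(?f has_integral integral {s..t} ?f) {s..t}"
    using plateau_integrable[OF y st(1)] by (rule integrable_integral)
  have "((\<lambda>_. lo) has_integral (lo * (t - s))) {s..t}" "((\<lambda>_. hi) has_integral (hi * (t - s))) {s..t}"
    using has_integral_const_real[of lo s t] has_integral_const_real[of hi s t] st by (simp_all add: mult.commute)
  then have "lo * (t - s) \<le> integral {s..t} ?f" "integral {s..t} ?f \<le> hi * (t - s)"
    using i lo hi by (auto intro: has_integral_le)
  then show "lo * (t - s) / (2 * \<epsilon>) \<le> smooth_occupation \<epsilon> y t - smooth_occupation \<epsilon> y s"
    "smooth_occupation \<epsilon> y t - smooth_occupation \<epsilon> y s \<le> hi * (t - s) / (2 * \<epsilon>)"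
    unfolding eq using \<epsilon> by (auto intro!: divide_right_mono)
qed

lemma smooth_occupation_mono:
  assumes "0 < \<epsilon>" "continuous_on {0..} y" "0 \<le> s" "s \<le> t"
  shows "smooth_occupation \<epsilon> y s \<le> smooth_occupation \<epsilon> y t"
  using smooth_occupation_increment(1)[OF assms, of 0 1] plateau_bounds by simp

lemma smooth_occupation_lipschitz:
  assumes "0 < \<epsilon>" "continuous_on {0..} y" "0 \<le> s" "s \<le> t"
  shows "smooth_occupation \<epsilon> y t - smooth_occupation \<epsilon> y s \<le> (t - s) / (2 * \<epsilon>)"
  using smooth_occupation_increment(2)[OF assms, of 0 1] plateau_bounds by simp

lemma smooth_occupation_nonneg:
  assumes "0 < \<epsilon>" "continuous_on {0..} y" "0 \<le> t" shows "0 \<le> smooth_occupation \<epsilon> y t"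
  using smooth_occupation_mono[OF assms(1,2), of 0 t] assms(3) by simp

lemma continuous_on_smooth_occupation:
  assumes "0 < \<epsilon>" "continuous_on {0..} y" shows "continuous_on {0..} (smooth_occupation \<epsilon> y)"
proof -
  have "(1 / (2 * \<epsilon>))-lipschitz_on {0..} (smooth_occupation \<epsilon> y)"
  proof (rule lipschitz_onI)
    fix s t :: real assume "s \<in> {0..}" "t \<in> {0..}"
    then show "dist (smooth_occupation \<epsilon> y s) (smooth_occupation \<epsilon> y t) \<le> 1 / (2 * \<epsilon>) * dist s t"
      using smooth_occupation_lipschitz[OF assms, of s t] smooth_occupation_mono[OF assms, of s t]
        smooth_occupation_lipschitz[OF assms, of t s] smooth_occupation_mono[OF assms, of t s]
      by (cases "s \<le> t") (auto simp: dist_real_def)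
  qed (use assms in simp)
  then show ?thesis by (rule lipschitz_on_continuous_on)
qed

lemma smooth_occupation_close:
  assumes \<epsilon>: "0 < \<epsilon>" and x: "continuous_on {0..} x" and y: "continuous_on {0..} y" and t: "0 \<le> t" "t \<le> T"
    and d: "\<And>s. 0 \<le> s \<Longrightarrow> s \<le> T \<Longrightarrow> \<bar>x s - y s\<bar> \<le> d"
  shows "\<bar>smooth_occupation \<epsilon> x t - smooth_occupation \<epsilon> y t\<bar> \<le> T * d / \<epsilon>\<^sup>2 / (2 * \<epsilon>)"
proof -
  let ?f = "\<lambda>s. plateau \<epsilon> (x s)" and ?g = "\<lambda>s. plateau \<epsilon> (y s)"
  have d0: "0 \<le> d" using d[of 0] t by auto
  have "\<bar>integral {0..t} ?f - integral {0..t} ?g\<bar> = \<bar>integral {0..t} (\<lambda>s. ?f s - ?g s)\<bar>"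
    using plateau_integrable[OF x] plateau_integrable[OF y] by (subst integral_diff) auto
  also have "\<dots> \<le> (d / \<epsilon>\<^sup>2) * (t - 0)"
  proof -
    have "norm (integral {0..t} (\<lambda>s. ?f s - ?g s)) \<le> (d / \<epsilon>\<^sup>2) * (t - 0)"
    proof (rule integral_bound)
      show "continuous_on {0..t} (\<lambda>s. ?f s - ?g s)"
        by (intro continuous_on_diff continuous_on_compose2[OF continuous_on_plateau[of UNIV]]
            continuous_on_subset[OF x] continuous_on_subset[OF y]) auto
      fix s assume s: "s \<in> {0..t}"
      have "\<bar>?f s - ?g s\<bar> \<le> \<bar>x s - y s\<bar> / \<epsilon>\<^sup>2" by (rule plateau_lipschitz[OF \<epsilon>])
      also have "\<dots> \<le> d / \<epsilon>\<^sup>2" using d[of s] s t by (intro divide_right_mono) auto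
      finally show "norm (?f s - ?g s) \<le> d / \<epsilon>\<^sup>2" by simp
    qed (use t in auto)
    then show ?thesis by simp
  qed
  also have "\<dots> \<le> (d / \<epsilon>\<^sup>2) * T" using t d0 by (intro mult_left_mono) auto
  finally have "\<bar>integral {0..t} ?f - integral {0..t} ?g\<bar> / (2 * \<epsilon>) \<le> T * d / \<epsilon>\<^sup>2 / (2 * \<epsilon>)"
    using \<epsilon> by (intro divide_right_mono) (auto simp: mult.commute)
  then show ?thesis using \<epsilon> by (simp add: smooth_occupation_def diff_divide_distrib[symmetric])
qed

text \<open>The smooth occupation time is squeezed between the times spent in \<open>[-\<epsilon>, \<epsilon>]\<close> and in
  \<open>[-\<epsilon> - \<epsilon>\<^sup>2, \<epsilon> + \<epsilon>\<^sup>2]\<close>, whose normalisations differ by the factor \<open>1 + \<epsilon>\<close>.\<close>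

lemma smooth_occupation_tendsto_local_time:
  assumes y: "continuous_on {0..} y" and t: "0 \<le> t"
    and lim: "((\<lambda>\<epsilon>. 1 / (2 * \<epsilon>) * (LBINT s:{0..t}. indicator {s. \<bar>y s\<bar> \<le> \<epsilon>} s)) \<longlongrightarrow> l) (at_right 0)"
  shows "(\<lambda>j. smooth_occupation (inverse (real (Suc j))) y t) \<longlonglongrightarrow> l"
proof -
  define A where "A \<epsilon> = 1 / (2 * \<epsilon>) * (LBINT s:{0..t}. indicator {s. \<bar>y s\<bar> \<le> \<epsilon>} s)" for \<epsilon> :: real
  define e where "e j = inverse (real (Suc j))" for j
  have e: "0 < e j" for j by (simp add: e_def)
  have e0: "e \<longlonglongrightarrow> 0" unfolding e_def by (rule LIMSEQ_inverse_real_of_nat)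
  have ind: "set_integrable lborel {0..t} (indicator {s. \<bar>y s\<bar> \<le> \<epsilon>} :: real \<Rightarrow> real)" for \<epsilon>
  proof -
    have "closed ({0..t} \<inter> (\<lambda>s. \<bar>y s\<bar>) -` {..\<epsilon>})"
      by (rule continuous_closed_preimage) (use y in \<open>auto intro!: continuous_intros elim!: continuous_on_subset\<close>)
    then have "{0..t} \<inter> {s. \<bar>y s\<bar> \<le> \<epsilon>} \<in> sets lborel" by (simp add: vimage_def borel_closed)
    moreover have "emeasure lborel ({0..t} \<inter> {s. \<bar>y s\<bar> \<le> \<epsilon>}) < \<infinity>"
      by (rule le_less_trans[OF emeasure_mono[of _ "{0..t}"]]) (use t in auto)
    ultimately show ?thesis
      unfolding set_integrable_def by (simp add: indicator_inter_arith[symmetric] integrable_real_indicator)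
  qed
  have pl: "set_integrable lborel {0..t} (\<lambda>s. plateau \<epsilon> (y s))" for \<epsilon>
    by (rule borel_integrable_atLeastAtMost')
      (intro continuous_on_compose2[OF continuous_on_plateau[of UNIV]] continuous_on_subset[OF y], auto)
  have F: "smooth_occupation \<epsilon> y t = (LBINT s:{0..t}. plateau \<epsilon> (y s)) / (2 * \<epsilon>)" for \<epsilon>
    unfolding smooth_occupation_def using set_borel_integral_eq_integral(2)[OF pl] by simp
  have lower: "A \<epsilon> \<le> smooth_occupation \<epsilon> y t" if "0 < \<epsilon>" for \<epsilon>
  proof -
    have "(LBINT s:{0..t}. indicator {s. \<bar>y s\<bar> \<le> \<epsilon>} s) \<le> (LBINT s:{0..t}. plateau \<epsilon> (y s))"
      using that plateau_bounds(1)[of \<epsilon>] by (intro set_integral_mono ind pl) (auto simp: indicator_def plateau_eq_1)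
    then show ?thesis using that by (simp add: A_def F divide_right_mono)
  qed
  have upper: "smooth_occupation \<epsilon> y t \<le> (1 + \<epsilon>) * A (\<epsilon> + \<epsilon>\<^sup>2)" if "0 < \<epsilon>" for \<epsilon>
  proof -
    have "(LBINT s:{0..t}. plateau \<epsilon> (y s)) \<le> (LBINT s:{0..t}. indicator {s. \<bar>y s\<bar> \<le> \<epsilon> + \<epsilon>\<^sup>2} s)"
      using that plateau_bounds(2)[of \<epsilon>] by (intro set_integral_mono ind pl) (auto simp: indicator_def plateau_eq_0)
    then have "smooth_occupation \<epsilon> y t \<le> (LBINT s:{0..t}. indicator {s. \<bar>y s\<bar> \<le> \<epsilon> + \<epsilon>\<^sup>2} s) / (2 * \<epsilon>)"
      unfolding F using that by (intro divide_right_mono) auto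
    also have "\<dots> = (1 + \<epsilon>) * A (\<epsilon> + \<epsilon>\<^sup>2)"
    proof -
      have "\<epsilon> + \<epsilon>\<^sup>2 = \<epsilon> * (1 + \<epsilon>)" by (simp add: power2_eq_square algebra_simps)
      moreover have "1 + \<epsilon> \<noteq> 0" using that by linarith
      ultimately have "1 / (2 * \<epsilon>) = (1 + \<epsilon>) * (1 / (2 * (\<epsilon> + \<epsilon>\<^sup>2)))"
        using that by (simp add: divide_simps)
      note eq = this
      have "(LBINT s:{0..t}. indicator {s. \<bar>y s\<bar> \<le> \<epsilon> + \<epsilon>\<^sup>2} s) / (2 * \<epsilon>) = 1 / (2 * \<epsilon>) * (LBINT s:{0..t}. indicator {s. \<bar>y s\<bar> \<le> \<epsilon> + \<epsilon>\<^sup>2} s)"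
        by simp
      then show ?thesis by (simp only: eq A_def mult.assoc)
    qed
    finally show ?thesis .
  qed
  have lim': "(A \<longlongrightarrow> l) (at_right 0)" using lim by (simp add: A_def[abs_def])
  have "filterlim e (at_right 0) sequentially"
    by (rule tendsto_imp_filterlim_at_right[OF e0]) (simp add: e)
  then have 1: "(\<lambda>j. A (e j)) \<longlonglongrightarrow> l" by (rule filterlim_compose[OF lim'])
  have "(\<lambda>j. e j + (e j)\<^sup>2) \<longlonglongrightarrow> 0 + 0\<^sup>2" by (intro tendsto_intros e0)
  then have "filterlim (\<lambda>j. e j + (e j)\<^sup>2) (at_right 0) sequentially"
  proof (intro tendsto_imp_filterlim_at_right always_eventually allI)
    show "0 < e j + (e j)\<^sup>2" for j using e[of j] by (intro add_pos_pos zero_less_power)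
  qed simp
  then have "(\<lambda>j. A (e j + (e j)\<^sup>2)) \<longlonglongrightarrow> l" by (rule filterlim_compose[OF lim'])
  then have "(\<lambda>j. (1 + e j) * A (e j + (e j)\<^sup>2)) \<longlonglongrightarrow> (1 + 0) * l" by (intro tendsto_intros e0)
  then have 2: "(\<lambda>j. (1 + e j) * A (e j + (e j)\<^sup>2)) \<longlonglongrightarrow> l" by simp
  have "(\<lambda>j. smooth_occupation (e j) y t) \<longlonglongrightarrow> l"
    by (rule tendsto_sandwich[OF _ _ 1 2]) (intro always_eventually allI lower upper e)+
  then show ?thesis by (simp add: e_def)
qed

text \<open>The second theorem of Dini: monotonicity transfers closeness from the points of a fine rational grid,
  of which there are finitely many, to the times in between.\<close>

lemma monotone_convergence_locally_uniform:
  fixes f :: "nat \<Rightarrow> real \<Rightarrow> real"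
  assumes mono: "\<And>j s t. 0 \<le> s \<Longrightarrow> s \<le> t \<Longrightarrow> f j s \<le> f j t" and l: "continuous_on {0..} l"
    and lim: "\<And>q. q \<in> \<rat> \<Longrightarrow> 0 \<le> q \<Longrightarrow> (\<lambda>j. f j q) \<longlonglongrightarrow> l q" and e: "0 < e" and T: "0 \<le> T"
  shows "\<forall>\<^sub>F j in sequentially. \<forall>t\<in>{0..T}. \<bar>f j t - l t\<bar> \<le> e"
proof -
  have "uniformly_continuous_on {0..T + 1} l"
    using l by (intro compact_uniformly_continuous) (auto elim!: continuous_on_subset)
  moreover have "0 < e / 2" using e by simp
  ultimately obtain d where d: "0 < d" and osc: "\<And>s t. s \<in> {0..T + 1} \<Longrightarrow> t \<in> {0..T + 1} \<Longrightarrow> dist t s < d \<Longrightarrow> dist (l t) (l s) < e / 2"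
    unfolding uniformly_continuous_on_def by metis
  obtain m where m: "inverse (real (Suc m)) < d" using reals_Archimedean[OF d] by blast
  define M where "M = real (Suc m)"
  have M: "1 \<le> M" "1 / M < d" using m by (auto simp: M_def inverse_eq_divide)
  define J where "J = nat \<lfloor>M * T\<rfloor> + 1"
  have "\<forall>\<^sub>F j in sequentially. \<forall>i\<in>{..J}. \<bar>f j (real i / M) - l (real i / M)\<bar> < e / 2"
  proof (rule eventually_ball_finite)
    show "\<forall>i\<in>{..J}. \<forall>\<^sub>F j in sequentially. \<bar>f j (real i / M) - l (real i / M)\<bar> < e / 2"
    proof
      fix i
      have "real i / M \<in> \<rat>" "0 \<le> real i / M" using M by (auto simp: M_def simp del: of_nat_Suc)
      from tendstoD[OF lim[OF this] \<open>0 < e / 2\<close>]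
      show "\<forall>\<^sub>F j in sequentially. \<bar>f j (real i / M) - l (real i / M)\<bar> < e / 2" by (simp add: dist_real_def)
    qed
  qed simp
  then show ?thesis
  proof eventually_elim
    case (elim j)
    show ?case
    proof
      fix t assume t: "t \<in> {0..T}"
      define k where "k = nat \<lfloor>M * t\<rfloor>"
      have Mt: "0 \<le> M * t" "M * t \<le> M * T" using t M by (auto intro: mult_left_mono)
      have k: "real k \<le> M * t" "M * t < real k + 1" using nat_floor_bounds[OF Mt(1)] by (auto simp: k_def)
      have kJ: "Suc k \<le> J" unfolding J_def k_def using Mt by (simp add: nat_mono floor_mono)
      have kt: "real k / M \<le> t" "t \<le> real (Suc k) / M"
        using k M by (simp_all add: divide_le_eq le_divide_eq mult.commute)
      have gap: "real (Suc k) / M = real k / M + 1 / M" by (simp add: add_divide_distrib)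
      have M1: "1 / M \<le> 1" using M by simp
      have "0 \<le> real k / M" "0 \<le> 1 / M" using M by auto
      moreover have "0 \<le> t" "t \<le> T" using t by auto
      ultimately have in1: "real k / M \<in> {0..T + 1}" "real (Suc k) / M \<in> {0..T + 1}" "t \<in> {0..T + 1}"
        unfolding atLeastAtMost_iff gap using kt(1) M1 by linarith+
      have near: "dist (l t) (l (real k / M)) < e / 2" "dist (l t) (l (real (Suc k) / M)) < e / 2"
        using kt gap M(2) unfolding dist_real_def
        by (intro osc[OF in1(1) in1(3), unfolded dist_real_def] osc[OF in1(2) in1(3), unfolded dist_real_def]; linarith)+
      have 1: "\<bar>f j (real k / M) - l (real k / M)\<bar> < e / 2" "\<bar>f j (real (Suc k) / M) - l (real (Suc k) / M)\<bar> < e / 2"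
        using elim kJ by (auto simp del: of_nat_Suc)
      have "f j (real k / M) \<le> f j t" "f j t \<le> f j (real (Suc k) / M)"
        using kt in1 t by (auto intro!: mono simp del: of_nat_Suc)
      with near 1 show "\<bar>f j t - l t\<bar> \<le> e" unfolding dist_real_def by linarith
    qed
  qed
qed

section \<open>Loops of the walk and smoothed occupation times\<close>

text \<open>The number of loops is of order \<open>sqrt n\<close>, which is also the time scale of the horizontal walk; hence
  its normalisation.\<close>

definition loop_clock :: "nat \<Rightarrow> (nat \<Rightarrow> int) \<Rightarrow> real \<Rightarrow> real" where
  "loop_clock n z t = lin_interp (\<lambda>k. real (loops_at_0 z k)) (real n * t) / sqrt (real n)"

lemma rescaled_near_grid:
  assumes z: "\<And>k. \<bar>z (Suc k) - z k\<bar> \<le> 1" and n: "0 < n" and s: "real i / real n \<le> s" "s \<le> real (Suc i) / real n"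
  shows "\<bar>rescaled (real n) z s - real_of_int (z i) / sqrt (real n)\<bar> \<le> 1 / sqrt (real n)"
proof -
  have ns: "real i \<le> real n * s" "real n * s \<le> real (Suc i)" using s n by (auto simp: divide_le_eq le_divide_eq mult.commute)
  have jump: "\<bar>real_of_int (z (Suc k)) - real_of_int (z k)\<bar> \<le> 1" for k
    using z[of k] by (simp flip: of_int_diff of_int_abs)
  have "\<bar>lin_interp (\<lambda>k. real_of_int (z k)) (real n * s) - real_of_int (z i)\<bar> \<le> 1"
  proof (cases "real n * s = real (Suc i)")
    case True
    then show ?thesis using jump[of i] by (simp only: lin_interp_of_nat)
  next
    case False
    then have "\<lfloor>real n * s\<rfloor> = int i" using ns by (intro floor_unique) auto
    then have "nat \<lfloor>real n * s\<rfloor> = i" by simp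
    then show ?thesis using jump[of i] ns by (intro lin_interp_close) auto
  qed
  then have "\<bar>lin_interp (\<lambda>k. real_of_int (z k)) (real n * s) - real_of_int (z i)\<bar> / sqrt (real n) \<le> 1 / sqrt (real n)"
    by (intro divide_right_mono) auto
  then show ?thesis by (simp add: rescaled_def diff_divide_distrib[symmetric])
qed

text \<open>In one step the rescaled walk moves by at most \<open>1 / sqrt n\<close>, which is the margin between \<open>a\<close> or \<open>b\<close> and the edges of the
  plateau.\<close>

lemma smooth_occupation_sandwich:
  assumes z: "\<And>k. \<bar>z (Suc k) - z k\<bar> \<le> 1" and n: "0 < n" and \<epsilon>: "0 < \<epsilon>"
    and a: "real a + 1 \<le> \<epsilon> * sqrt (real n)" and b: "(\<epsilon> + \<epsilon>\<^sup>2) * sqrt (real n) \<le> real b"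
  shows "occupation a z k / (2 * \<epsilon> * real n) \<le> smooth_occupation \<epsilon> (rescaled (real n) z) (real k / real n)"
    and "smooth_occupation \<epsilon> (rescaled (real n) z) (real k / real n) \<le> occupation b z k / (2 * \<epsilon> * real n)"
proof -
  let ?y = "rescaled (real n) z"
  have y: "continuous_on {0..} ?y"
    unfolding rescaled_def divide_inverse
    by (intro continuous_intros continuous_on_compose2[OF continuous_on_lin_interp]) auto
  have N: "0 < sqrt (real n)" using n by simp
  have inc: "of_bool (\<bar>z i\<bar> \<le> int a) / (2 * \<epsilon> * real n) \<le> smooth_occupation \<epsilon> ?y (real (Suc i) / real n) - smooth_occupation \<epsilon> ?y (real i / real n)"
    "smooth_occupation \<epsilon> ?y (real (Suc i) / real n) - smooth_occupation \<epsilon> ?y (real i / real n) \<le> of_bool (\<bar>z i\<bar> \<le> int b) / (2 * \<epsilon> * real n)" for i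
  proof -
    have st: "0 \<le> real i / real n" "real i / real n \<le> real (Suc i) / real n" by (auto intro: divide_right_mono)
    have len: "real (Suc i) / real n - real i / real n = 1 / real n" by (simp add: diff_divide_distrib[symmetric])
    have lo: "of_bool (\<bar>z i\<bar> \<le> int a) \<le> plateau \<epsilon> (?y u)" if "real i / real n \<le> u" "u \<le> real (Suc i) / real n" for u
    proof (cases "\<bar>z i\<bar> \<le> int a")
      case True
      then have "\<bar>real_of_int (z i)\<bar> \<le> real a" by linarith
      have "\<bar>?y u\<bar> \<le> \<bar>real_of_int (z i) / sqrt (real n)\<bar> + 1 / sqrt (real n)"
        using rescaled_near_grid[of z n i u, OF z n that] by linarith
      also have "\<dots> = (\<bar>real_of_int (z i)\<bar> + 1) / sqrt (real n)" by (simp add: add_divide_distrib)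
      also have "\<dots> \<le> \<epsilon>" using \<open>\<bar>real_of_int (z i)\<bar> \<le> real a\<close> a N by (simp add: divide_le_eq)
      finally show ?thesis using \<epsilon> by (simp add: plateau_eq_1)
    qed (simp add: plateau_bounds)
    have hi: "plateau \<epsilon> (?y u) \<le> of_bool (\<bar>z i\<bar> \<le> int b)" if "real i / real n \<le> u" "u \<le> real (Suc i) / real n" for u
    proof (cases "\<bar>z i\<bar> \<le> int b")
      case False
      then have zb: "real b + 1 \<le> \<bar>real_of_int (z i)\<bar>" by linarith
      have "\<epsilon> + \<epsilon>\<^sup>2 \<le> (\<bar>real_of_int (z i)\<bar> - 1) / sqrt (real n)" using zb b N by (simp add: le_divide_eq)
      also have "\<dots> = \<bar>real_of_int (z i) / sqrt (real n)\<bar> - 1 / sqrt (real n)" by (simp add: diff_divide_distrib)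
      also have "\<dots> \<le> \<bar>?y u\<bar>" using rescaled_near_grid[of z n i u, OF z n that] by linarith
      finally show ?thesis using \<epsilon> by (simp add: plateau_eq_0)
    qed (simp add: plateau_bounds)
    show "of_bool (\<bar>z i\<bar> \<le> int a) / (2 * \<epsilon> * real n) \<le> smooth_occupation \<epsilon> ?y (real (Suc i) / real n) - smooth_occupation \<epsilon> ?y (real i / real n)"
      using smooth_occupation_increment(1)[OF \<epsilon> y st lo hi] unfolding len by (simp add: mult.commute)
    show "smooth_occupation \<epsilon> ?y (real (Suc i) / real n) - smooth_occupation \<epsilon> ?y (real i / real n) \<le> of_bool (\<bar>z i\<bar> \<le> int b) / (2 * \<epsilon> * real n)"
      using smooth_occupation_increment(2)[OF \<epsilon> y st lo hi] unfolding len by (simp add: mult.commute)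
  qed
  show "occupation a z k / (2 * \<epsilon> * real n) \<le> smooth_occupation \<epsilon> ?y (real k / real n)"
  proof (induction k)
    case (Suc k) then show ?case using inc(1)[of k] by (simp add: add_divide_distrib)
  qed simp
  show "smooth_occupation \<epsilon> ?y (real k / real n) \<le> occupation b z k / (2 * \<epsilon> * real n)"
  proof (induction k)
    case (Suc k) then show ?case using inc(2)[of k] by (simp add: add_divide_distrib)
  qed simp
qed

lemma loops_near_occupation:
  assumes "\<bar>loop_martingale a k z\<bar> < \<mu>"
  shows "\<bar>real (loops_at_0 z k) - occupation a z k / (2 * (real a + 1))\<bar> \<le> \<mu> + real a / 2"
  using assms tent_bounds(2)[of a "z k"] tent_bounds(3)[where a = a and y = "z k"] unfolding loop_martingale_def by linarith

text \<open>The smooth occupation time lies between the occupation times of \<open>[-a, a]\<close> and \<open>[-b, b]\<close>, up to factors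
  close to one, and the loops are close to each of them as soon as the two loop martingales are small.\<close>

lemma loop_clock_near_smooth_occupation:
  assumes z: "\<And>k. \<bar>z (Suc k) - z k\<bar> \<le> 1" and n: "0 < n" and \<epsilon>: "0 < \<epsilon>" "\<epsilon> \<le> 1/2"
    and large: "2 \<le> \<epsilon>\<^sup>2 * sqrt (real n)"
    and a: "a = nat \<lfloor>\<epsilon> * sqrt (real n)\<rfloor> - 1" and b: "b = nat \<lceil>(\<epsilon> + \<epsilon>\<^sup>2) * sqrt (real n)\<rceil>"
    and \<delta>: "0 < \<delta>" "\<delta> \<le> 1" and H: "1 \<le> H"
    and Ma: "\<bar>loop_martingale a k z\<bar> < \<delta> * sqrt (real n)" and Mb: "\<bar>loop_martingale b k z\<bar> < \<delta> * sqrt (real n)"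
    and loops: "real (loops_at_0 z k) \<le> H * sqrt (real n)"
  shows "\<bar>smooth_occupation \<epsilon> (rescaled (real n) z) (real k / real n) - real (loops_at_0 z k) / sqrt (real n)\<bar> \<le> \<delta> + 7 * \<epsilon> * H"
proof -
  define N where "N = sqrt (real n)"
  have N: "0 < N" "N * N = real n" using n by (auto simp: N_def)
  have \<epsilon>2: "\<epsilon>\<^sup>2 = \<epsilon> * \<epsilon>" by (simp add: power2_eq_square)
  have large1: "2 \<le> \<epsilon> * \<epsilon> * N" using large by (simp add: \<epsilon>2 N_def)
  have "\<epsilon> * (\<epsilon> * N) \<le> 1 * (\<epsilon> * N)" using \<epsilon> N by (intro mult_right_mono) auto
  then have large2: "2 \<le> \<epsilon> * N" using large1 by (simp add: mult.assoc)
  have a': "real a + 1 \<le> \<epsilon> * N" "\<epsilon> * N - 1 \<le> real a + 1"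
    using large2 unfolding a N_def[symmetric] by linarith+
  have b': "(\<epsilon> + \<epsilon> * \<epsilon>) * N \<le> real b" "real b \<le> (\<epsilon> + \<epsilon> * \<epsilon>) * N + 1"
  proof -
    have "0 \<le> (\<epsilon> + \<epsilon> * \<epsilon>) * N" using \<epsilon> N by simp
    then show "(\<epsilon> + \<epsilon> * \<epsilon>) * N \<le> real b" "real b \<le> (\<epsilon> + \<epsilon> * \<epsilon>) * N + 1"
      unfolding b N_def[symmetric] \<epsilon>2 by linarith+
  qed
  define F where "F = smooth_occupation \<epsilon> (rescaled (real n) z) (real k / real n)"
  define l where "l = real (loops_at_0 z k) / N"
  have l: "0 \<le> l" "l \<le> H" using loops N by (auto simp: l_def divide_le_eq N_def)
  define oa where "oa = occupation a z k / (2 * (real a + 1)) / N"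
  define ob where "ob = occupation b z k / (2 * (real b + 1)) / N"
  \<comment> \<open>The ratios of the normalisation \<open>2 (a + 1)\<close> in the loop martingale to \<open>2 \<epsilon> sqrt n\<close> in the smooth
    occupation time, and the same for \<open>b\<close>.\<close>
  define qa where "qa = (real a + 1) / (\<epsilon> * N)"
  define qb where "qb = (real b + 1) / (\<epsilon> * N)"
  have \<epsilon>N: "0 < \<epsilon> * N" using \<epsilon> N by simp
  have div: "\<bar>x / N - y / N\<bar> \<le> d / N" if "\<bar>x - y\<bar> \<le> d" for x y d
    using divide_right_mono[OF that, of N] N by (simp add: diff_divide_distrib[symmetric])
  have "\<bar>l - oa\<bar> \<le> (\<delta> * N + real a / 2) / N"
    unfolding l_def oa_def by (rule div[OF loops_near_occupation[OF Ma[folded N_def]]])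
  also have "\<dots> = \<delta> + real a / 2 / N" using N by (simp add: add_divide_distrib)
  also have "real a / 2 / N \<le> \<epsilon> / 2" using a'(1) N by (simp add: divide_le_eq)
  finally have la: "\<bar>l - oa\<bar> \<le> \<delta> + \<epsilon> / 2" by simp
  have "\<bar>l - ob\<bar> \<le> (\<delta> * N + real b / 2) / N"
    unfolding l_def ob_def by (rule div[OF loops_near_occupation[OF Mb[folded N_def]]])
  also have "\<dots> = \<delta> + real b / 2 / N" using N by (simp add: add_divide_distrib)
  also have "real b / 2 / N \<le> \<epsilon>"
  proof -
    have "\<epsilon> * \<epsilon> * N \<le> 1/2 * \<epsilon> * N" using \<epsilon> N by (intro mult_right_mono) auto
    then have "real b \<le> 2 * (\<epsilon> * N)" using b'(2) large1 by (simp add: distrib_right)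
    then show ?thesis using N by (simp add: divide_le_eq mult_ac)
  qed
  finally have lb: "\<bar>l - ob\<bar> \<le> \<delta> + \<epsilon>" by simp
  have qa: "1 - \<epsilon> \<le> qa" "qa \<le> 1"
  proof -
    have "(1 - \<epsilon>) * (\<epsilon> * N) \<le> real a + 1" using a' large1 by (simp add: algebra_simps)
    then show "1 - \<epsilon> \<le> qa" using \<epsilon>N by (simp add: qa_def le_divide_eq)
    show "qa \<le> 1" using a' \<epsilon>N by (simp add: qa_def divide_le_eq)
  qed
  have qb: "0 \<le> qb" "qb \<le> 1 + 2 * \<epsilon>"
  proof -
    have "real b + 1 \<le> (1 + 2 * \<epsilon>) * (\<epsilon> * N)" using b' large1 by (simp add: algebra_simps)
    then show "qb \<le> 1 + 2 * \<epsilon>" using \<epsilon>N by (simp add: qb_def divide_le_eq)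
    show "0 \<le> qb" using \<epsilon>N by (simp add: qb_def)
  qed
  have conv: "occupation c z k / (2 * \<epsilon> * real n) = (real c + 1) / (\<epsilon> * N) * (occupation c z k / (2 * (real c + 1)) / N)" for c
  proof -
    have "x / (2 * \<epsilon> * (N * N)) = d / (\<epsilon> * N) * (x / (2 * d) / N)" if "d \<noteq> 0" for x d
      using that \<epsilon> N(1) by (simp add: field_simps)
    from this[of "real c + 1" "occupation c z k"] show ?thesis unfolding N(2) by simp
  qed
  have sandwich: "qa * oa \<le> F" "F \<le> qb * ob"
    using smooth_occupation_sandwich[of z n \<epsilon> a b k, OF z n \<epsilon>(1)] a'(1) b'(1)
    unfolding F_def qa_def qb_def oa_def ob_def conv N_def[symmetric] \<epsilon>2 by auto
  have "F \<le> l + \<delta> + 7 * \<epsilon> * H"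
  proof -
    have "ob \<le> l + \<delta> + \<epsilon>" using lb by linarith
    have "qb * ob \<le> qb * (l + \<delta> + \<epsilon>)" using qb lb by (intro mult_left_mono) auto
    also have "\<dots> \<le> (1 + 2 * \<epsilon>) * (l + \<delta> + \<epsilon>)" using qb l \<delta> \<epsilon> by (intro mult_right_mono) auto
    also have "\<dots> = l + \<delta> + \<epsilon> + 2 * \<epsilon> * (l + \<delta> + \<epsilon>)" by (simp add: algebra_simps)
    also have "2 * \<epsilon> * (l + \<delta> + \<epsilon>) \<le> 2 * \<epsilon> * (H + H + H)" using l \<delta> \<epsilon> H by (intro mult_left_mono add_mono) auto
    finally have "F \<le> l + \<delta> + \<epsilon> + 2 * \<epsilon> * (H + H + H)" using sandwich(2) by linarith
    moreover have "\<epsilon> * 1 \<le> \<epsilon> * H" using \<epsilon> H by (intro mult_left_mono) auto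
    ultimately show ?thesis by (simp add: algebra_simps)
  qed
  moreover have "l - \<delta> - 7 * \<epsilon> * H \<le> F"
  proof -
    define x where "x = l - \<delta> - \<epsilon> / 2"
    have "(1 - qa) * x \<le> (1 - qa) * l" using qa \<delta> \<epsilon> by (intro mult_left_mono) (auto simp: x_def)
    also have "\<dots> \<le> \<epsilon> * H" using qa l \<epsilon> by (intro mult_mono) auto
    finally have "x - \<epsilon> * H \<le> qa * x" by (simp add: algebra_simps)
    also have "\<dots> \<le> qa * oa" using la qa \<epsilon> by (intro mult_left_mono) (auto simp: x_def)
    finally have "x - \<epsilon> * H \<le> F" using sandwich(1) by linarith
    moreover have "\<epsilon> * 1 \<le> \<epsilon> * H" using \<epsilon> H by (intro mult_left_mono) auto
    ultimately show ?thesis using \<epsilon> unfolding x_def by linarith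
  qed
  ultimately show ?thesis unfolding F_def l_def N_def by linarith
qed

lemma loop_clock_bounds:
  fixes n :: nat
  assumes "0 \<le> t"
  defines "k \<equiv> nat \<lfloor>real n * t\<rfloor>"
  shows "real (loops_at_0 z k) / sqrt (real n) \<le> loop_clock n z t" "loop_clock n z t \<le> real (loops_at_0 z (Suc k)) / sqrt (real n)"
proof -
  have "0 \<le> real n * t" using assms(1) by simp
  note b = lin_interp_between[OF this, of "\<lambda>k. real (loops_at_0 z k)", folded k_def]
  show "real (loops_at_0 z k) / sqrt (real n) \<le> loop_clock n z t" "loop_clock n z t \<le> real (loops_at_0 z (Suc k)) / sqrt (real n)"
    unfolding loop_clock_def by (intro divide_right_mono b; simp)+
qed

lemma loop_clock_nonneg: "0 \<le> t \<Longrightarrow> 0 \<le> loop_clock n z t"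
  by (rule order_trans[OF _ loop_clock_bounds(1)]) auto

lemma continuous_on_loop_clock: "continuous_on {0..} (loop_clock n z)"
proof -
  have "continuous_on {0..} (\<lambda>t. lin_interp (\<lambda>k. real (loops_at_0 z k)) (real n * t))"
  proof (rule continuous_on_compose2[OF continuous_on_lin_interp])
    show "continuous_on {0..} (\<lambda>t. real n * t)" by (rule continuous_on_mult_left[OF continuous_on_id])
  qed auto
  then show ?thesis unfolding loop_clock_def[abs_def] divide_inverse by (rule continuous_on_mult_right)
qed

context zero_lazy_walk
begin

text \<open>With \<open>a\<close> and \<open>b\<close> of order \<open>\<epsilon> sqrt n\<close>, the two loop martingales exceed \<open>\<delta> sqrt n\<close> with a probability of
  order \<open>\<epsilon> / \<delta>\<^sup>2\<close>. The bound \<open>H\<close> on the clock does not depend on \<open>\<delta>\<close>, which may thus be chosen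
  according to the behaviour of the horizontal walk on \<open>[0, H]\<close>.\<close>

proposition loop_clock_approximation:
  assumes c: "c = 1/4" and T: "0 \<le> T" and \<kappa>: "0 < \<kappa>"
  obtains H where "1 \<le> H" "\<And>\<delta>. 0 < \<delta> \<Longrightarrow> \<delta> \<le> 1 \<Longrightarrow> \<forall>\<^sub>F j in sequentially. \<forall>\<^sub>F n in sequentially.
    \<exists>A\<in>sets M. prob A \<le> \<kappa> \<and> (\<forall>\<omega>\<in>space M - A. \<forall>t\<in>{0..T}. loop_clock n (path \<omega>) t \<le> H \<and>
      \<bar>smooth_occupation (inverse (real (Suc j))) (rescaled (real n) (path \<omega>)) t - loop_clock n (path \<omega>) t\<bar> \<le> \<delta>)"
proof -
  define R where "R = sqrt (T + 1)"
  have R: "1 \<le> R" using T by (simp add: R_def)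
  define H where "H = max 1 (4 * R / \<kappa>)"
  have H: "1 \<le> H" "2 * R / H \<le> \<kappa> / 2"
  proof -
    have "4 * R / \<kappa> \<le> H" by (simp add: H_def)
    then have "4 * R \<le> H * \<kappa>" using \<kappa> by (simp add: divide_le_eq)
    moreover show "1 \<le> H" by (simp add: H_def)
    ultimately show "2 * R / H \<le> \<kappa> / 2" by (simp add: divide_le_eq mult.commute)
  qed
  have main: "\<forall>\<^sub>F j in sequentially. \<forall>\<^sub>F n in sequentially.
    \<exists>A\<in>sets M. prob A \<le> \<kappa> \<and> (\<forall>\<omega>\<in>space M - A. \<forall>t\<in>{0..T}. loop_clock n (path \<omega>) t \<le> H \<and>
      \<bar>smooth_occupation (inverse (real (Suc j))) (rescaled (real n) (path \<omega>)) t - loop_clock n (path \<omega>) t\<bar> \<le> \<delta>)"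
    if \<delta>: "0 < \<delta>" "\<delta> \<le> 1" for \<delta>
  proof -
    define \<delta>' where "\<delta>' = \<delta> / 3"
    have \<delta>': "0 < \<delta>'" "\<delta>' \<le> 1" using \<delta> by (auto simp: \<delta>'_def)
    define \<epsilon>0 where "\<epsilon>0 = min (1/2) (min (\<delta>' / (7 * H)) (\<kappa> * \<delta>'\<^sup>2 / (192 * R)))"
    have \<epsilon>0: "0 < \<epsilon>0" using H \<delta>' \<kappa> R by (simp add: \<epsilon>0_def)
    have "\<forall>\<^sub>F j in sequentially. inverse (real (Suc j)) < \<epsilon>0"
      by (rule order_tendstoD(2)[OF LIMSEQ_inverse_real_of_nat \<epsilon>0])
    then show ?thesis
    proof eventually_elim
      case (elim j)
      define \<epsilon> where "\<epsilon> = inverse (real (Suc j))"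
      have \<epsilon>: "0 < \<epsilon>" "\<epsilon> \<le> 1/2" "\<epsilon> \<le> \<delta>' / (7 * H)" "\<epsilon> \<le> \<kappa> * \<delta>'\<^sup>2 / (192 * R)"
      proof -
        have "\<epsilon> < \<epsilon>0" using elim by (simp only: \<epsilon>_def)
        then show "\<epsilon> \<le> 1/2" "\<epsilon> \<le> \<delta>' / (7 * H)" "\<epsilon> \<le> \<kappa> * \<delta>'\<^sup>2 / (192 * R)"
          by (simp_all add: \<epsilon>0_def)
        show "0 < \<epsilon>" by (simp add: \<epsilon>_def)
      qed
      have \<epsilon>H: "7 * \<epsilon> * H \<le> \<delta>'" using \<epsilon>(3) H by (simp add: le_divide_eq mult_ac)
      have \<epsilon>R: "96 * \<epsilon> * R / \<delta>'\<^sup>2 \<le> \<kappa> / 2" using \<epsilon>(4) R \<delta>' by (simp add: le_divide_eq divide_le_eq mult_ac)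
      have "\<forall>\<^sub>F n in sequentially. max (2 / \<epsilon>\<^sup>2) (1 / \<delta>') \<le> sqrt (real n)"
        using filterlim_compose[OF sqrt_at_top filterlim_real_sequentially] by (simp only: filterlim_at_top)
      then show ?case unfolding \<epsilon>_def[symmetric]
      proof eventually_elim
        case (elim n)
        define N where "N = sqrt (real n)"
        have "0 < 1 / \<delta>'" using \<delta>' by simp
        moreover have "1 / \<delta>' \<le> N" using elim by (simp add: N_def)
        ultimately have N0: "0 < N" by linarith
        then have n: "0 < n" by (simp add: N_def)
        have NN: "N * N = real n" by (simp add: N_def)
        have large: "2 \<le> \<epsilon>\<^sup>2 * sqrt (real n)" using elim \<epsilon> by (simp add: divide_le_eq mult.commute)
        have N1: "1 / N \<le> \<delta>'" using elim \<delta>' N0 unfolding N_def[symmetric] by (simp add: divide_le_eq mult.commute)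
        define a where "a = nat \<lfloor>\<epsilon> * sqrt (real n)\<rfloor> - 1"
        define b where "b = nat \<lceil>(\<epsilon> + \<epsilon>\<^sup>2) * sqrt (real n)\<rceil>"
        define m where "m = nat \<lfloor>real n * T\<rfloor> + 1"
        have nT: "0 \<le> real n * T" using T by simp
        have m: "real m \<le> real n * (T + 1)"
          using nat_floor_bounds(1)[OF nT] n unfolding m_def by (simp add: distrib_left)
        have sm: "sqrt (real m) \<le> N * R"
          using real_sqrt_le_mono[OF m] by (simp add: real_sqrt_mult N_def R_def)
        have \<mu>: "0 < \<delta>' * N" using \<delta>' N0 by simp
        define Ea where "Ea = {\<omega> \<in> space M. \<exists>k\<le>m. \<delta>' * N \<le> \<bar>loop_martingale a k (path \<omega>)\<bar>}"
        define Eb where "Eb = {\<omega> \<in> space M. \<exists>k\<le>m. \<delta>' * N \<le> \<bar>loop_martingale b k (path \<omega>)\<bar>}"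
        define EL where "EL = {\<omega> \<in> space M. H * N \<le> real (loops_at_0 (path \<omega>) m)}"
        have E_sets: "Ea \<in> sets M" "Eb \<in> sets M" "EL \<in> sets M"
        proof -
          have *: "{\<omega> \<in> space M. \<exists>k\<le>m. \<delta>' * N \<le> \<bar>loop_martingale d k (path \<omega>)\<bar>} \<in> sets M" for d
          proof (rule sets_past[of m])
            show "depends_upto m (\<lambda>z. \<exists>k\<le>m. \<delta>' * N \<le> \<bar>loop_martingale d k z\<bar>)"
            proof (rule depends_uptoI)
              fix z z' :: "nat \<Rightarrow> int" assume z: "\<And>i. i \<le> m \<Longrightarrow> z i = z' i"
              have "loop_martingale d k z = loop_martingale d k z'" if "k \<le> m" for k
                by (rule depends_uptoD[OF depends_upto_loop_martingale]) (use z that in auto)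
              then show "(\<exists>k\<le>m. \<delta>' * N \<le> \<bar>loop_martingale d k z\<bar>) = (\<exists>k\<le>m. \<delta>' * N \<le> \<bar>loop_martingale d k z'\<bar>)"
                by (metis (no_types))
            qed
          qed
          show "Ea \<in> sets M" "Eb \<in> sets M" unfolding Ea_def Eb_def by (rule *)+
          show "EL \<in> sets M" unfolding EL_def
            by (rule sets_past[of m]) (rule depends_upto_comp2[OF depends_upto_loops depends_upto_const, of m "\<lambda>x _. H * N \<le> real x"])
        qed
        \<comment> \<open>Probabilities: zero, at most \<open>\<kappa> / 2\<close> for the martingales by the choice of \<open>\<epsilon>\<close>, and at most \<open>\<kappa> / 2\<close> for
          the number of loops by the choice of \<open>H\<close>.\<close>
        define A where "A = (space M - regular) \<union> (Ea \<union> Eb \<union> EL)"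
        have A: "A \<in> sets M" using E_sets by (auto simp: A_def)
        have "\<epsilon> * \<epsilon> * N \<le> 1/2 * \<epsilon> * N" using \<epsilon>(1,2) N0 by (intro mult_right_mono) auto
        then have \<epsilon>N1: "\<epsilon>\<^sup>2 * N \<le> \<epsilon> * N / 2" by (simp add: power2_eq_square)
        have "2 \<le> \<epsilon>\<^sup>2 * N" using large by (simp only: N_def)
        with \<epsilon>N1 have \<epsilon>N: "\<epsilon>\<^sup>2 * N \<le> \<epsilon> * N / 2" "4 \<le> \<epsilon> * N" by linarith+
        have ab: "real a + 1 \<le> \<epsilon> * N" "real b + 1 \<le> 2 * (\<epsilon> * N)"
        proof -
          show "real a + 1 \<le> \<epsilon> * N" using \<epsilon>N(2) unfolding a_def N_def[symmetric] by linarith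
          have "(\<epsilon> + \<epsilon>\<^sup>2) * N = \<epsilon> * N + \<epsilon>\<^sup>2 * N" by (rule distrib_right)
          moreover have "real b \<le> (\<epsilon> + \<epsilon>\<^sup>2) * N + 1"
          proof -
            have "0 \<le> (\<epsilon> + \<epsilon>\<^sup>2) * N" using \<epsilon> N0 by simp
            then show ?thesis unfolding b_def N_def[symmetric] by linarith
          qed
          ultimately show "real b + 1 \<le> 2 * (\<epsilon> * N)" using \<epsilon>N by linarith
        qed
        have "prob Ea \<le> 32 * (real a + 1) * sqrt (real m) / (\<delta>' * N)\<^sup>2"
          unfolding Ea_def by (rule loop_martingale_maximal[OF c \<mu>])
        also have "\<dots> \<le> 32 * (\<epsilon> * N) * (N * R) / (\<delta>' * N)\<^sup>2"
          using ab sm \<epsilon> N0 by (intro divide_right_mono mult_mono) auto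
        also have "\<dots> = 32 * \<epsilon> * R / \<delta>'\<^sup>2" using N0 by (simp add: power2_eq_square)
        finally have pa: "prob Ea \<le> 32 * \<epsilon> * R / \<delta>'\<^sup>2" .
        have "prob Eb \<le> 32 * (real b + 1) * sqrt (real m) / (\<delta>' * N)\<^sup>2"
          unfolding Eb_def by (rule loop_martingale_maximal[OF c \<mu>])
        also have "\<dots> \<le> 32 * (2 * (\<epsilon> * N)) * (N * R) / (\<delta>' * N)\<^sup>2"
          using ab sm \<epsilon> N0 by (intro divide_right_mono mult_mono) auto
        also have "\<dots> = 64 * \<epsilon> * R / \<delta>'\<^sup>2" using N0 by (simp add: power2_eq_square)
        finally have pb: "prob Eb \<le> 64 * \<epsilon> * R / \<delta>'\<^sup>2" .
        have "prob EL \<le> 2 * sqrt (real m) / (H * N)"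
          unfolding EL_def by (rule prob_loops_large) (use H N0 in simp)
        also have "\<dots> \<le> 2 * (N * R) / (H * N)" using sm H N0 by (intro divide_right_mono mult_left_mono) auto
        also have "\<dots> = 2 * R / H" using N0 by simp
        finally have pL: "prob EL \<le> \<kappa> / 2" using H by linarith
        have "prob A \<le> prob (space M - regular) + (prob Ea + prob Eb + prob EL)"
          unfolding A_def using E_sets
          by (intro order_trans[OF measure_Un_le] add_mono order_refl) auto
        also have "\<dots> \<le> 32 * \<epsilon> * R / \<delta>'\<^sup>2 + 64 * \<epsilon> * R / \<delta>'\<^sup>2 + \<kappa> / 2" using pa pb pL prob_not_regular by linarith
        also have "32 * \<epsilon> * R / \<delta>'\<^sup>2 + 64 * \<epsilon> * R / \<delta>'\<^sup>2 = 96 * \<epsilon> * R / \<delta>'\<^sup>2" by (simp add: add_divide_distrib[symmetric])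
        finally have probA: "prob A \<le> \<kappa>" using \<epsilon>R by linarith
        have good: "loop_clock n (path \<omega>) t \<le> H \<and>
            \<bar>smooth_occupation \<epsilon> (rescaled (real n) (path \<omega>)) t - loop_clock n (path \<omega>) t\<bar> \<le> \<delta>"
          if w: "\<omega> \<in> space M - A" and t: "t \<in> {0..T}" for \<omega> t
        proof -
          define z where "z = path \<omega>"
          have "\<omega> \<in> regular" using w by (auto simp: A_def)
          then have jump: "\<bar>z (Suc k) - z k\<bar> \<le> 1" for k by (simp add: regular_def z_def)
          have loops_mono: "real (loops_at_0 z i) \<le> real (loops_at_0 z k)" if "i \<le> k" for i k
            using that by (induction rule: dec_induct) auto
          have "real (loops_at_0 z m) \<le> H * N" using w by (auto simp: A_def EL_def z_def)
          then have loops: "real (loops_at_0 z k) \<le> H * sqrt (real n)" if "k \<le> m" for k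
            using loops_mono[OF that] by (simp add: N_def)
          let ?F = "smooth_occupation \<epsilon> (rescaled (real n) z)"
          have near: "\<bar>?F (real k / real n) - real (loops_at_0 z k) / sqrt (real n)\<bar> \<le> \<delta>' + \<delta>'" if "k \<le> m" for k
          proof -
            have "\<bar>loop_martingale a k z\<bar> < \<delta>' * sqrt (real n)" "\<bar>loop_martingale b k z\<bar> < \<delta>' * sqrt (real n)"
              using w that unfolding A_def Ea_def Eb_def z_def N_def by fastforce+
            from loop_clock_near_smooth_occupation[OF jump n \<epsilon>(1,2) large a_def b_def \<delta>' H(1) this loops[OF that]]
            show ?thesis using \<epsilon>H by linarith
          qed
          define k where "k = nat \<lfloor>real n * t\<rfloor>"
          have nt: "0 \<le> real n * t" "real n * t \<le> real n * T" using t by (auto intro: mult_left_mono)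
          have km: "Suc k \<le> m" unfolding k_def m_def using nt by (simp add: nat_mono floor_mono)
          have kt: "real k / real n \<le> t" "t \<le> real (Suc k) / real n"
            using nat_floor_bounds[OF nt(1)] n by (simp_all add: k_def divide_le_eq le_divide_eq mult.commute)
          have y: "continuous_on {0..} (rescaled (real n) z)" by (rule continuous_on_rescaled) simp
          have F: "?F (real k / real n) \<le> ?F t" "?F t \<le> ?F (real (Suc k) / real n)"
            using kt t by (auto intro!: smooth_occupation_mono[OF \<epsilon>(1) y] simp del: of_nat_Suc)
          have L: "real (loops_at_0 z k) / N \<le> loop_clock n z t" "loop_clock n z t \<le> real (loops_at_0 z (Suc k)) / N"
            using loop_clock_bounds[where t = t and z = z and n = n] t unfolding k_def N_def by auto
          have "real (loops_at_0 z (Suc k)) / N \<le> (real (loops_at_0 z k) + 1) / N"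
            using N0 by (intro divide_right_mono) auto
          then have inc: "real (loops_at_0 z (Suc k)) / N \<le> real (loops_at_0 z k) / N + 1 / N" by (simp add: add_divide_distrib)
          have "real (loops_at_0 z (Suc k)) / N \<le> H" using loops[OF km] N0 by (simp add: divide_le_eq N_def)
          then have "loop_clock n z t \<le> H" using L by linarith
          moreover have "\<bar>?F t - loop_clock n z t\<bar> \<le> \<delta>' + \<delta>' + \<delta>'"
            using near[of k] near[OF km] km F L inc N1 unfolding N_def[symmetric] by linarith
          ultimately show ?thesis by (simp add: z_def \<delta>'_def)
        qed
        show ?case using A probA good by blast
      qed
    qed
  qed
  show ?thesis by (rule that[OF H(1) main])
qed

end

section \<open>The comb walk\<close>

text \<open>The time change of the comb with the local time of the second coordinate replaced by its continuous
  approximation.\<close>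

definition time_change :: "real \<Rightarrow> (real \<Rightarrow> real \<times> real) \<Rightarrow> real \<Rightarrow> real \<times> real" where
  "time_change \<epsilon> f = path_pair (\<lambda>t. fst (f (smooth_occupation \<epsilon> (\<lambda>s. snd (f s)) t))) (\<lambda>t. snd (f t))"

lemma continuous_on_compose_clock:
  fixes x :: "real \<Rightarrow> real"
  assumes "continuous_on {0..} x" "continuous_on {0..} L" "\<And>t. 0 \<le> t \<Longrightarrow> 0 \<le> L t"
  shows "continuous_on {0..} (\<lambda>t. x (L t))"
proof (rule continuous_on_compose2[OF assms(1,2)])
  show "L ` {0..} \<subseteq> {0..}" using assms(3) by auto
qed

lemma cpaths_components:
  fixes f :: "real \<Rightarrow> real \<times> real"
  assumes "f \<in> cpaths" shows "continuous_on {0..} (\<lambda>t. fst (f t))" "continuous_on {0..} (\<lambda>t. snd (f t))"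
proof -
  have "continuous_on {0..} f" using assms unfolding cpaths_def by blast
  then show "continuous_on {0..} (\<lambda>t. fst (f t))" "continuous_on {0..} (\<lambda>t. snd (f t))"
    by (rule continuous_on_fst, rule continuous_on_snd)
qed

lemma time_change_in_cpaths:
  assumes "0 < \<epsilon>" "f \<in> cpaths" shows "time_change \<epsilon> f \<in> cpaths"
  unfolding time_change_def
proof (rule path_pair_in_cpaths)
  note f = cpaths_components[OF assms(2)]
  show "continuous_on {0..} (\<lambda>t. fst (f (smooth_occupation \<epsilon> (\<lambda>s. snd (f s)) t)))"
    by (rule continuous_on_compose_clock[OF f(1) continuous_on_smooth_occupation[OF assms(1) f(2)]
          smooth_occupation_nonneg[OF assms(1) f(2)]])
  show "continuous_on {0..} (\<lambda>t. snd (f t))" by (rule f(2))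
qed

lemma time_change_path_pair:
  assumes "0 < \<epsilon>" "continuous_on {0..} y"
  shows "time_change \<epsilon> (path_pair x y) = path_pair (\<lambda>t. x (smooth_occupation \<epsilon> y t)) y"
proof
  fix t
  show "time_change \<epsilon> (path_pair x y) t = path_pair (\<lambda>t. x (smooth_occupation \<epsilon> y t)) y t"
  proof (cases "0 \<le> t")
    case True
    have "smooth_occupation \<epsilon> (\<lambda>s. snd (path_pair x y s)) t = smooth_occupation \<epsilon> y t"
      by (rule smooth_occupation_cong) simp
    then show ?thesis using True smooth_occupation_nonneg[OF assms True] by (simp add: time_change_def)
  qed (simp add: time_change_def path_pair_def)
qed

text \<open>The first coordinate after the time change moves for two reasons, a change of the path and a change of
  the clock; the second one is absorbed by the uniform continuity of the limit path on the range of
  the clock.\<close>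

lemma time_change_continuous:
  fixes \<phi> :: "(real \<Rightarrow> real \<times> real) \<Rightarrow> real"
  assumes lip: "horizon_lipschitz T K \<phi>" and \<epsilon>: "0 < \<epsilon>"
  shows "continuous_map path_topology euclideanreal (\<lambda>f. \<phi> (time_change \<epsilon> f))"
  unfolding continuous_map_path_topology_iff
proof (intro ballI allI impI)
  fix f :: "real \<Rightarrow> real \<times> real" and e :: real assume f: "f \<in> cpaths" and e: "0 < e"
  have T: "0 \<le> T" and K: "0 \<le> K" using lip by (auto simp: horizon_lipschitz_def)
  define d where "d = e / (4 * (K + 1))"
  have d: "0 < d" "K * (3 * d) < e"
  proof -
    show d0: "0 < d" using e K by (simp add: d_def)
    have "K + 1 \<noteq> 0" using K by simp
    then have "(K + 1) * (4 * d) = e" unfolding d_def by (simp add: divide_simps)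
    moreover have "0 \<le> K * d" using K d0 by simp
    ultimately show "K * (3 * d) < e" using d0 by (simp add: algebra_simps)
  qed
  \<comment> \<open>The clocks take values in \<open>[0, S]\<close> up to the horizon, and \<open>C\<close> is their Lipschitz constant as functions
    of the second coordinate.\<close>
  define S where "S = T / (2 * \<epsilon>)"
  have S: "0 \<le> S" using T \<epsilon> by (simp add: S_def)
  have "uniformly_continuous_on {0..S} (\<lambda>t. fst (f t))"
    using cpaths_components(1)[OF f] by (intro compact_uniformly_continuous) (auto elim!: continuous_on_subset)
  then obtain \<eta> where \<eta>: "0 < \<eta>" and osc: "\<And>s t. s \<in> {0..S} \<Longrightarrow> t \<in> {0..S} \<Longrightarrow> dist t s < \<eta> \<Longrightarrow> dist (fst (f t)) (fst (f s)) < d"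
    unfolding uniformly_continuous_on_def using d(1) by metis
  define C where "C = T / \<epsilon>\<^sup>2 / (2 * \<epsilon>)"
  have C: "0 \<le> C" using T \<epsilon> by (simp add: C_def)
  define \<beta> where "\<beta> = min d (\<eta> / (2 * (C + 1)))"
  have \<beta>: "0 < \<beta>" "\<beta> \<le> d" "C * \<beta> < \<eta>"
  proof -
    show "0 < \<beta>" "\<beta> \<le> d" using d \<eta> C by (auto simp: \<beta>_def)
    have "C * \<beta> \<le> C * (\<eta> / (2 * (C + 1)))" using C by (intro mult_left_mono) (auto simp: \<beta>_def)
    also have "\<dots> < \<eta>"
    proof -
      have "0 < \<eta> * C + 2 * \<eta>" using C \<eta> by (simp add: add_nonneg_pos)
      then have "C * \<eta> < \<eta> * (2 * (C + 1))" by (simp add: algebra_simps)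
      then show ?thesis using C by (simp add: divide_less_eq)
    qed
    finally show "C * \<beta> < \<eta>" .
  qed
  show "\<exists>T' \<epsilon>'. \<epsilon>' > 0 \<and> (\<forall>g\<in>cpaths. (\<forall>t\<in>{0..T'}. dist (f t) (g t) < \<epsilon>') \<longrightarrow>
      \<bar>\<phi> (time_change \<epsilon> g) - \<phi> (time_change \<epsilon> f)\<bar> < e)"
  proof (rule exI[of _ "max T S"], rule exI[of _ \<beta>], intro conjI ballI impI)
    show "0 < \<beta>" by fact
    fix g :: "real \<Rightarrow> real \<times> real" assume g: "g \<in> cpaths" and close: "\<forall>t\<in>{0..max T S}. dist (f t) (g t) < \<beta>"
    have near: "dist (f t) (g t) < \<beta>" if "0 \<le> t" "t \<le> max T S" for t
      using bspec[OF close, of t] that by simp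
    have comp1: "\<bar>fst (f t) - fst (g t)\<bar> < \<beta>" if "0 \<le> t" "t \<le> max T S" for t
      using le_less_trans[OF dist_fst_le near[OF that]] by (simp only: dist_real_def)
    have comp2: "\<bar>snd (f t) - snd (g t)\<bar> < \<beta>" if "0 \<le> t" "t \<le> max T S" for t
      using le_less_trans[OF dist_snd_le near[OF that]] by (simp only: dist_real_def)
    let ?F = "smooth_occupation \<epsilon> (\<lambda>s. snd (f s))" and ?G = "smooth_occupation \<epsilon> (\<lambda>s. snd (g s))"
    have "\<bar>\<phi> (time_change \<epsilon> g) - \<phi> (time_change \<epsilon> f)\<bar> \<le> K * (3 * d)"
    proof (rule horizon_lipschitzD[OF lip time_change_in_cpaths[OF \<epsilon> g] time_change_in_cpaths[OF \<epsilon> f]])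
      fix t assume t: "0 \<le> t" "t \<le> T"
      have bound: "0 \<le> smooth_occupation \<epsilon> y t" "smooth_occupation \<epsilon> y t \<le> S" if y: "continuous_on {0..} y" for y
      proof -
        show "0 \<le> smooth_occupation \<epsilon> y t" by (rule smooth_occupation_nonneg[OF \<epsilon> y t(1)])
        have "smooth_occupation \<epsilon> y t \<le> t / (2 * \<epsilon>)" using smooth_occupation_lipschitz[OF \<epsilon> y _ t(1)] by simp
        also have "\<dots> \<le> S" unfolding S_def using t \<epsilon> by (intro divide_right_mono) auto
        finally show "smooth_occupation \<epsilon> y t \<le> S" .
      qed
      note F = bound[OF cpaths_components(2)[OF f]] and G = bound[OF cpaths_components(2)[OF g]]
      have "\<bar>?G t - ?F t\<bar> \<le> T * \<beta> / \<epsilon>\<^sup>2 / (2 * \<epsilon>)"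
        by (rule smooth_occupation_close[OF \<epsilon> cpaths_components(2)[OF g] cpaths_components(2)[OF f] t])
          (rule less_imp_le, subst abs_minus_commute, rule comp2, simp_all)
      also have "\<dots> = C * \<beta>" by (simp add: C_def)
      finally have "dist (?G t) (?F t) < \<eta>" using \<beta> by (simp add: dist_real_def)
      then have "\<bar>fst (f (?G t)) - fst (f (?F t))\<bar> < d" using osc[of "?F t" "?G t"] F G by (simp add: dist_real_def)
      moreover have "\<bar>fst (f (?G t)) - fst (g (?G t))\<bar> < \<beta>" using G by (intro comp1) auto
      ultimately have 1: "\<bar>fst (g (?G t)) - fst (f (?F t))\<bar> \<le> d + d" using \<beta>(2) by linarith
      have 2: "\<bar>snd (g t) - snd (f t)\<bar> \<le> d" using comp2[of t] t \<beta>(2) by (simp add: abs_minus_commute le_max_iff_disj)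
      show "dist (time_change \<epsilon> g t) (time_change \<epsilon> f t) \<le> 3 * d"
        unfolding time_change_def path_pair_apply[OF t(1)]
        by (rule order_trans[OF dist_pair_le]) (use 1 2 in linarith)
    qed
    with d show "\<bar>\<phi> (time_change \<epsilon> g) - \<phi> (time_change \<epsilon> f)\<bar> < e" by linarith
  qed
qed

locale comb_walk = two_walks M N "1/2" "1/4" X Y W B "\<lambda>n. sqrt (real n)" "\<lambda>n. real n"
  for M :: "'a measure" and N :: "'b measure" and X Y and W B :: "real \<Rightarrow> 'b \<Rightarrow> real" +
  fixes L :: "real \<Rightarrow> 'b \<Rightarrow> real"
  assumes L: "local_time_at_0 N B L"
begin

definition comb_pair :: "nat \<Rightarrow> 'a \<Rightarrow> real \<Rightarrow> real \<times> real" where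
  "comb_pair n \<omega> = path_pair (\<lambda>t. rescaled (sqrt (real n)) (X.path \<omega>) (loop_clock n (Y.path \<omega>) t)) (rescaled (real n) (Y.path \<omega>))"

definition limit_pair :: "'b \<Rightarrow> real \<Rightarrow> real \<times> real" where
  "limit_pair \<omega> = path_pair (\<lambda>t. W (L t \<omega>) \<omega>) (\<lambda>t. B t \<omega>)"

lemma local_time_properties:
  shows "0 \<le> t \<Longrightarrow> L t \<in> borel_measurable N"
    and "\<omega> \<in> space N \<Longrightarrow> continuous_on {0..} (\<lambda>t. L t \<omega>)"
    and "\<omega> \<in> space N \<Longrightarrow> 0 \<le> t \<Longrightarrow> 0 \<le> L t \<omega>"
  using L by (simp_all add: local_time_at_0_def)

lemma limit_pair_measurable: "limit_pair \<in> N \<rightarrow>\<^sub>M borel_sets_of path_topology"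
  unfolding limit_pair_def
proof (rule random_path_pairI)
  show "continuous_on {0..} (\<lambda>t. W (L t \<omega>) \<omega>)" if "\<omega> \<in> space N" for \<omega>
    using continuous_on_compose_clock[OF brownian_continuous(1)[OF that] local_time_properties(2)[OF that]]
      local_time_properties(3)[OF that] by blast
  show "(\<lambda>\<omega>. W (L t \<omega>) \<omega>) \<in> borel_measurable N" if "0 \<le> t" for t
    by (rule measurable_process_at_random_time)
      (use that in \<open>auto intro: brownian_measurable brownian_continuous local_time_properties\<close>)
qed (auto intro: brownian_measurable brownian_continuous)

lemma comb_pair_measurable: "comb_pair n \<in> M \<rightarrow>\<^sub>M borel_sets_of path_topology"
  unfolding comb_pair_def
proof (rule random_path_pairI)
  show "continuous_on {0..} (\<lambda>t. rescaled (sqrt (real n)) (X.path \<omega>) (loop_clock n (Y.path \<omega>) t))" for \<omega>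
    by (rule continuous_on_compose_clock[OF continuous_on_rescaled continuous_on_loop_clock loop_clock_nonneg]) auto
  show "(\<lambda>\<omega>. rescaled (sqrt (real n)) (X.path \<omega>) (loop_clock n (Y.path \<omega>) t)) \<in> borel_measurable M" for t
    unfolding rescaled_def loop_clock_def
  proof (intro borel_measurable_divide measurable_lin_interp borel_measurable_times borel_measurable_const)
    show "(\<lambda>\<omega>. real_of_int (X k \<omega>)) \<in> borel_measurable M" for k
      by (rule measurable_compose[OF X.Z_measurable]) simp
    show "(\<lambda>\<omega>. real (loops_at_0 (Y.path \<omega>) k)) \<in> borel_measurable M" for k
      by (rule Y.borel_measurable_past[OF depends_upto_comp2[OF depends_upto_loops depends_upto_const, of k "\<lambda>x _. real x"]])
  qed
qed (auto intro: continuous_on_rescaled Y.measurable_rescaled)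

text \<open>The local time is only given as an almost sure limit at each fixed time. Countably many times can be
  treated at once, and the rational ones suffice by monotonicity.\<close>

lemma time_change_tendsto:
  assumes lip: "horizon_lipschitz T K \<phi>" and C: "\<And>f. f \<in> cpaths \<Longrightarrow> \<bar>\<phi> f\<bar> \<le> C"
  shows "(\<lambda>j. \<integral>\<omega>. \<phi> (time_change (inverse (real (Suc j))) (brownian_pair \<omega>)) \<partial>N) \<longlonglongrightarrow> (\<integral>\<omega>. \<phi> (limit_pair \<omega>) \<partial>N)"
proof (rule tendsto_integral_path_functional[OF _ lip C limit_pair_measurable])
  have T: "0 \<le> T" using lip by (simp add: horizon_lipschitz_def)
  have pos: "0 < inverse (real (Suc j))" for j by simp
  show "prob_space N" by unfold_locales
  show "(\<lambda>\<omega>. \<phi> (time_change (inverse (real (Suc j))) (brownian_pair \<omega>))) \<in> borel_measurable N" for j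
    by (rule measurable_compose[OF brownian_pair_measurable measurable_continuous_functional[OF time_change_continuous[OF lip pos]]])
  show "time_change (inverse (real (Suc j))) (brownian_pair \<omega>) \<in> cpaths" if "\<omega> \<in> space N" for j \<omega>
    by (rule time_change_in_cpaths[OF pos random_path_in_cpaths[OF brownian_pair_measurable that]])
  have "AE \<omega> in N. \<forall>q\<in>{q \<in> \<rat>. 0 \<le> q}. ((\<lambda>\<epsilon>. 1 / (2 * \<epsilon>) * (LBINT s:{0..q}. indicator {s. \<bar>B s \<omega>\<bar> \<le> \<epsilon>} s)) \<longlongrightarrow> L q \<omega>) (at_right 0)"
  proof (subst AE_ball_countable)
    show "countable {q \<in> \<rat>. (0::real) \<le> q}" using countable_rat by (rule countable_subset[rotated]) auto
    show "\<forall>q\<in>{q \<in> \<rat>. 0 \<le> q}. AE \<omega> in N. ((\<lambda>\<epsilon>. 1 / (2 * \<epsilon>) * (LBINT s:{0..q}. indicator {s. \<bar>B s \<omega>\<bar> \<le> \<epsilon>} s)) \<longlongrightarrow> L q \<omega>) (at_right 0)"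
      using L unfolding local_time_at_0_def by blast
  qed
  then show "AE \<omega> in N. \<forall>e>0. \<forall>\<^sub>F j in sequentially. \<forall>t\<in>{0..T}.
      dist (time_change (inverse (real (Suc j))) (brownian_pair \<omega>) t) (limit_pair \<omega> t) \<le> e"
    using AE_space
  proof eventually_elim
    case (elim \<omega>)
    define F where "F j = smooth_occupation (inverse (real (Suc j))) (\<lambda>t. B t \<omega>)" for j
    note Wc = brownian_continuous(1)[OF elim(2)] and Bc = brownian_continuous(2)[OF elim(2)]
    note Lc = local_time_properties(2)[OF elim(2)] and L0 = local_time_properties(3)[OF elim(2)]
    have Fconv: "\<forall>\<^sub>F j in sequentially. \<forall>t\<in>{0..T}. \<bar>F j t - L t \<omega>\<bar> \<le> e" if "0 < e" for e
    proof (rule monotone_convergence_locally_uniform[OF _ Lc _ that T])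
      show "F j s \<le> F j t" if "0 \<le> s" "s \<le> t" for j s t
        unfolding F_def by (rule smooth_occupation_mono[OF pos Bc that])
      show "(\<lambda>j. F j q) \<longlonglongrightarrow> L q \<omega>" if "q \<in> \<rat>" "0 \<le> q" for q
        unfolding F_def by (rule smooth_occupation_tendsto_local_time[OF Bc that(2)]) (use elim(1) that in auto)
    qed
    have "compact ((\<lambda>t. L t \<omega>) ` {0..T})" using Lc by (intro compact_continuous_image) (auto elim!: continuous_on_subset)
    then obtain H where H: "\<And>t. t \<in> {0..T} \<Longrightarrow> L t \<omega> \<le> H"
      using compact_imp_bounded bounded_iff by (metis (no_types, lifting) abs_le_D1 imageI real_norm_def)
    show ?case
    proof (intro allI impI)
      fix e :: real assume e: "0 < e"
      have "uniformly_continuous_on {0..H + 1} (\<lambda>t. W t \<omega>)"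
        using Wc by (intro compact_uniformly_continuous) (auto elim!: continuous_on_subset)
      then obtain d where d: "0 < d" and osc: "\<And>s t. s \<in> {0..H + 1} \<Longrightarrow> t \<in> {0..H + 1} \<Longrightarrow> dist t s < d \<Longrightarrow> dist (W t \<omega>) (W s \<omega>) < e"
        unfolding uniformly_continuous_on_def using e by metis
      have "0 < min 1 (d / 2)" using d by simp
      from Fconv[OF this]
      show "\<forall>\<^sub>F j in sequentially. \<forall>t\<in>{0..T}. dist (time_change (inverse (real (Suc j))) (brownian_pair \<omega>) t) (limit_pair \<omega> t) \<le> e"
      proof eventually_elim
        case (elim j)
        show ?case
        proof
          fix t assume t: "t \<in> {0..T}"
          then have t0: "0 \<le> t" by simp
          have FL: "\<bar>F j t - L t \<omega>\<bar> \<le> min 1 (d / 2)" using elim t by blast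
          have F0: "0 \<le> F j t" unfolding F_def by (rule smooth_occupation_nonneg[OF pos Bc t0])
          have "dist (W (F j t) \<omega>) (W (L t \<omega>) \<omega>) < e"
            using FL F0 H[OF t] L0[OF t0] d by (intro osc) (auto simp: dist_real_def)
          then have "\<bar>W (F j t) \<omega> - W (L t \<omega>) \<omega>\<bar> + \<bar>B t \<omega> - B t \<omega>\<bar> \<le> e" by (simp add: dist_real_def)
          then show "dist (time_change (inverse (real (Suc j))) (brownian_pair \<omega>) t) (limit_pair \<omega> t) \<le> e"
            unfolding brownian_pair_def limit_pair_def time_change_path_pair[OF pos Bc] path_pair_apply[OF t0] F_def[symmetric]
            by (rule order_trans[OF dist_pair_le])
        qed
      qed
    qed
  qed
qed

text \<open>The walk \<open>X\<close>, scaled on the time scale \<open>sqrt n\<close>, is run by two clocks that are uniformly close; since its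
  modulus of continuity is controlled uniformly in \<open>n\<close>, the two paths are close.\<close>

lemma comb_pair_near_time_change:
  assumes lip: "horizon_lipschitz T K \<phi>" and C: "\<And>f. f \<in> cpaths \<Longrightarrow> \<bar>\<phi> f\<bar> \<le> C" and e: "0 < e"
  shows "\<forall>\<^sub>F j in sequentially. \<forall>\<^sub>F n in sequentially.
    \<bar>(\<integral>\<omega>. \<phi> (comb_pair n \<omega>) \<partial>M) - (\<integral>\<omega>. \<phi> (time_change (inverse (real (Suc j))) (walk_pair n \<omega>)) \<partial>M)\<bar> \<le> e"
proof -
  have T: "0 \<le> T" and K: "0 \<le> K" using lip by (auto simp: horizon_lipschitz_def)
  have C0: "0 \<le> C" using C[OF polygon_pair_in_cpaths[of 1 0 "\<lambda>_. 0"]] by linarith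
  define \<eta> where "\<eta> = e / (2 * (K + 1))"
  define \<kappa> where "\<kappa> = e / (8 * (C + 1))"
  have \<eta>0: "0 < \<eta>" and \<kappa>0: "0 < \<kappa>" using e K C0 by (auto simp: \<eta>_def \<kappa>_def)
  have "K + 1 \<noteq> 0" "C + 1 \<noteq> 0" using K C0 by auto
  then have "(K + 1) * \<eta> = e / 2" "(C + 1) * \<kappa> = e / 8" unfolding \<eta>_def \<kappa>_def by (simp_all add: divide_simps)
  then have \<eta>: "K * \<eta> \<le> e / 2" and \<kappa>: "2 * C * (\<kappa> + \<kappa>) \<le> e / 2"
    using \<eta>0 \<kappa>0 by (simp_all add: algebra_simps)
  obtain H where H: "1 \<le> H" and clock: "\<And>\<delta>. 0 < \<delta> \<Longrightarrow> \<delta> \<le> 1 \<Longrightarrow> \<forall>\<^sub>F j in sequentially. \<forall>\<^sub>F n in sequentially.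
    \<exists>A\<in>sets M. measure M A \<le> \<kappa> \<and> (\<forall>\<omega>\<in>space M - A. \<forall>t\<in>{0..T}. loop_clock n (Y.path \<omega>) t \<le> H \<and>
      \<bar>smooth_occupation (inverse (real (Suc j))) (rescaled (real n) (Y.path \<omega>)) t - loop_clock n (Y.path \<omega>) t\<bar> \<le> \<delta>)"
    using Y.loop_clock_approximation[OF refl T \<kappa>0] by blast
  have H1: "0 \<le> H + 1" using H by simp
  obtain \<delta>0 where \<delta>0: "0 < \<delta>0" and oscX: "\<forall>\<^sub>F n in sequentially. \<exists>A\<in>sets M. measure M A \<le> \<kappa> \<and> space M - A \<subseteq> X.regular \<and>
       (\<forall>\<omega>\<in>space M - A. \<forall>s\<in>{0..H + 1}. \<forall>t\<in>{0..H + 1}. \<bar>s - t\<bar> \<le> \<delta>0 \<longrightarrow>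
          \<bar>rescaled (sqrt (real n)) (X.path \<omega>) s - rescaled (sqrt (real n)) (X.path \<omega>) t\<bar> \<le> \<eta>)"
    by (rule X.oscillation[OF rX H1 \<eta>0 \<kappa>0])
  define \<delta> where "\<delta> = min 1 \<delta>0"
  have \<delta>: "0 < \<delta>" "\<delta> \<le> 1" "\<delta> \<le> \<delta>0" using \<delta>0 by (auto simp: \<delta>_def)
  from clock[OF \<delta>(1,2)] show ?thesis
  proof eventually_elim
    case (elim j)
    define \<epsilon> where "\<epsilon> = inverse (real (Suc j))"
    have \<epsilon>: "0 < \<epsilon>" by (simp add: \<epsilon>_def)
    from elim oscX show ?case unfolding \<epsilon>_def[symmetric]
    proof eventually_elim
      case (elim n)
      obtain A1 where A1: "A1 \<in> sets M" "measure M A1 \<le> \<kappa>"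
        "\<And>\<omega> t. \<omega> \<in> space M - A1 \<Longrightarrow> t \<in> {0..T} \<Longrightarrow> loop_clock n (Y.path \<omega>) t \<le> H \<and>
           \<bar>smooth_occupation \<epsilon> (rescaled (real n) (Y.path \<omega>)) t - loop_clock n (Y.path \<omega>) t\<bar> \<le> \<delta>"
        using elim(1) by blast
      obtain A2 where A2: "A2 \<in> sets M" "measure M A2 \<le> \<kappa>"
        "\<And>\<omega> s t. \<omega> \<in> space M - A2 \<Longrightarrow> s \<in> {0..H + 1} \<Longrightarrow> t \<in> {0..H + 1} \<Longrightarrow> \<bar>s - t\<bar> \<le> \<delta>0 \<Longrightarrow>
          \<bar>rescaled (sqrt (real n)) (X.path \<omega>) s - rescaled (sqrt (real n)) (X.path \<omega>) t\<bar> \<le> \<eta>"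
        using elim(2) by blast
      have "\<bar>(\<integral>\<omega>. \<phi> (comb_pair n \<omega>) \<partial>M) - (\<integral>\<omega>. \<phi> (time_change \<epsilon> (walk_pair n \<omega>)) \<partial>M)\<bar> \<le> K * \<eta> + 2 * C * measure M (A1 \<union> A2)"
      proof (rule abs_integral_diff_le)
        show "prob_space M" by unfold_locales
        show "(\<lambda>\<omega>. \<phi> (comb_pair n \<omega>)) \<in> borel_measurable M"
          by (rule measurable_compose[OF comb_pair_measurable measurable_continuous_functional[OF horizon_lipschitz_continuous[OF lip]]])
        show "(\<lambda>\<omega>. \<phi> (time_change \<epsilon> (walk_pair n \<omega>))) \<in> borel_measurable M"
          by (rule measurable_compose[OF walk_pair_measurable measurable_continuous_functional[OF time_change_continuous[OF lip \<epsilon>]]])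
        show "A1 \<union> A2 \<in> sets M" using A1 A2 by simp
        show "\<bar>\<phi> (comb_pair n \<omega>)\<bar> \<le> C" if "\<omega> \<in> space M" for \<omega>
          by (rule C, rule random_path_in_cpaths[OF comb_pair_measurable that])
        show "\<bar>\<phi> (time_change \<epsilon> (walk_pair n \<omega>))\<bar> \<le> C" if "\<omega> \<in> space M" for \<omega>
          by (rule C, rule time_change_in_cpaths[OF \<epsilon>], rule random_path_in_cpaths[OF walk_pair_measurable that])
        show "0 \<le> K * \<eta>" using K \<eta>0 by simp
        fix \<omega> assume w: "\<omega> \<in> space M - (A1 \<union> A2)"
        then have w1: "\<omega> \<in> space M - A1" and w2: "\<omega> \<in> space M - A2" and ws: "\<omega> \<in> space M" by auto
        have y: "continuous_on {0..} (rescaled (real n) (Y.path \<omega>))" by (rule continuous_on_rescaled) simp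
        show "\<bar>\<phi> (comb_pair n \<omega>) - \<phi> (time_change \<epsilon> (walk_pair n \<omega>))\<bar> \<le> K * \<eta>"
        proof (rule horizon_lipschitzD[OF lip random_path_in_cpaths[OF comb_pair_measurable ws]
              time_change_in_cpaths[OF \<epsilon> random_path_in_cpaths[OF walk_pair_measurable ws]]])
          fix t assume t: "0 \<le> t" "t \<le> T"
          let ?F = "smooth_occupation \<epsilon> (rescaled (real n) (Y.path \<omega>)) t" and ?L = "loop_clock n (Y.path \<omega>) t"
          have LH: "?L \<le> H" "\<bar>?F - ?L\<bar> \<le> \<delta>" using A1(3)[OF w1, of t] t by auto
          have "0 \<le> ?F" by (rule smooth_occupation_nonneg[OF \<epsilon> y t(1)])
          moreover have "0 \<le> ?L" by (rule loop_clock_nonneg[OF t(1)])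
          ultimately have "\<bar>rescaled (sqrt (real n)) (X.path \<omega>) ?L - rescaled (sqrt (real n)) (X.path \<omega>) ?F\<bar> \<le> \<eta>"
            using LH \<delta> by (intro A2(3)[OF w2]) auto
          then have "\<bar>rescaled (sqrt (real n)) (X.path \<omega>) ?L - rescaled (sqrt (real n)) (X.path \<omega>) ?F\<bar>
              + \<bar>rescaled (real n) (Y.path \<omega>) t - rescaled (real n) (Y.path \<omega>) t\<bar> \<le> \<eta>" by simp
          then show "dist (comb_pair n \<omega> t) (time_change \<epsilon> (walk_pair n \<omega>) t) \<le> \<eta>"
            unfolding comb_pair_def walk_pair_def time_change_path_pair[OF \<epsilon> y] path_pair_apply[OF t(1)]
            by (rule order_trans[OF dist_pair_le])
        qed
      qed
      moreover have "measure M (A1 \<union> A2) \<le> \<kappa> + \<kappa>"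
        using measure_Un_le[OF A1(1) A2(1)] A1(2) A2(2) by linarith
      then have "2 * C * measure M (A1 \<union> A2) \<le> 2 * C * (\<kappa> + \<kappa>)" using C0 by (intro mult_left_mono) auto
      ultimately show ?case using \<eta> \<kappa> by linarith
    qed
  qed
qed

text \<open>The parameter \<open>\<epsilon> = 1/(j+1)\<close> of the smoothing is fixed such that both its effect on the limit and, for
  large \<open>n\<close>, its effect on the walks are small; then \<open>n\<close> tends to infinity.\<close>

theorem comb_pair_converges: "converges_in_law path_topology M comb_pair N limit_pair"
proof (rule converges_in_lawI_lipschitz)
  show "prob_space M" "prob_space N" by unfold_locales
  show "comb_pair n \<in> M \<rightarrow>\<^sub>M borel_sets_of path_topology" for n by (rule comb_pair_measurable)
  show "limit_pair \<in> N \<rightarrow>\<^sub>M borel_sets_of path_topology" by (rule limit_pair_measurable)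
  fix \<phi> :: "(real \<Rightarrow> real \<times> real) \<Rightarrow> real" and T K C
  assume lip: "horizon_lipschitz T K \<phi>" and C: "\<And>f. f \<in> cpaths \<Longrightarrow> \<bar>\<phi> f\<bar> \<le> C"
  show "(\<lambda>n. \<integral>\<omega>. \<phi> (comb_pair n \<omega>) \<partial>M) \<longlonglongrightarrow> (\<integral>\<omega>. \<phi> (limit_pair \<omega>) \<partial>N)"
  proof (rule tendstoI)
    fix e :: real assume e: "0 < e"
    then have e3: "0 < e / 3" by simp
    let ?\<phi> = "\<lambda>j f. \<phi> (time_change (inverse (real (Suc j))) f)"
    have "\<forall>\<^sub>F j in sequentially. (\<forall>\<^sub>F n in sequentially. \<bar>(\<integral>\<omega>. \<phi> (comb_pair n \<omega>) \<partial>M) - (\<integral>\<omega>. ?\<phi> j (walk_pair n \<omega>) \<partial>M)\<bar> \<le> e / 3)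
        \<and> dist (\<integral>\<omega>. ?\<phi> j (brownian_pair \<omega>) \<partial>N) (\<integral>\<omega>. \<phi> (limit_pair \<omega>) \<partial>N) < e / 3"
      by (rule eventually_conj[OF comb_pair_near_time_change[OF lip C e3] tendstoD[OF time_change_tendsto[OF lip C] e3]])
    then obtain j where near: "\<forall>\<^sub>F n in sequentially. \<bar>(\<integral>\<omega>. \<phi> (comb_pair n \<omega>) \<partial>M) - (\<integral>\<omega>. ?\<phi> j (walk_pair n \<omega>) \<partial>M)\<bar> \<le> e / 3"
      and lim: "dist (\<integral>\<omega>. ?\<phi> j (brownian_pair \<omega>) \<partial>N) (\<integral>\<omega>. \<phi> (limit_pair \<omega>) \<partial>N) < e / 3"
      using eventually_happens'[OF sequentially_bot] by blast
    have pos: "0 < inverse (real (Suc j))" by simp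
    have "continuous_map path_topology euclideanreal (?\<phi> j) \<and> bounded (?\<phi> j ` topspace path_topology)"
    proof
      show "continuous_map path_topology euclideanreal (?\<phi> j)" by (rule time_change_continuous[OF lip pos])
      show "bounded (?\<phi> j ` topspace path_topology)"
        unfolding bounded_iff topspace_path_topology
        by (intro exI[of _ C]) (auto intro!: C time_change_in_cpaths pos simp del: of_nat_Suc)
    qed
    then have "(\<lambda>n. \<integral>\<omega>. ?\<phi> j (walk_pair n \<omega>) \<partial>M) \<longlonglongrightarrow> (\<integral>\<omega>. ?\<phi> j (brownian_pair \<omega>) \<partial>N)"
      using walk_pair_converges unfolding converges_in_law_def by blast
    from near tendstoD[OF this e3]
    show "\<forall>\<^sub>F n in sequentially. dist (\<integral>\<omega>. \<phi> (comb_pair n \<omega>) \<partial>M) (\<integral>\<omega>. \<phi> (limit_pair \<omega>) \<partial>N) < e"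
    proof eventually_elim
      case (elim n)
      then show ?case using lim unfolding dist_real_def by linarith
    qed
  qed
qed

end

theorem theorem6p1:
  fixes M :: "'a measure" and X Y :: "nat \<Rightarrow> 'a \<Rightarrow> int"
    and N :: "'b measure" and W B L :: "real \<Rightarrow> 'b \<Rightarrow> real"
  assumes "prob_space M"
    and "markov_chain M srw_kernel X" and "AE \<omega> in M. X 0 \<omega> = 0"
    and "markov_chain M lazy_at_0_kernel Y" and "AE \<omega> in M. Y 0 \<omega> = 0"
    and "indep_chains M X Y"
    and "prob_space N"
    and "standard_brownian_motion N W" and "standard_brownian_motion N B"
    and "indep_processes N W B"
    and "local_time_at_0 N B L"
  shows "converges_in_law path_topology
    M (\<lambda>n \<omega>. \<lambda>t\<in>{0..}.
         (lin_interp (\<lambda>k. real_of_int (X k \<omega>))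
            (lin_interp (\<lambda>k. real (loops_at_0 (\<lambda>i. Y i \<omega>) k)) (real n * t)) / root 4 (real n),
          lin_interp (\<lambda>k. real_of_int (Y k \<omega>)) (real n * t) / sqrt (real n)))
    N (\<lambda>\<omega>. \<lambda>t\<in>{0..}. (W (L t \<omega>) \<omega>, B t \<omega>))"
proof -
  interpret comb_walk M N X Y W B L
  proof (intro comb_walk.intro two_walks.intro zero_lazy_walk.intro comb_walk_axioms.intro two_walks_axioms.intro zero_lazy_walk_axioms.intro)
    show "markov_chain M (zero_lazy_kernel (1/2)) X" using assms(2) by (simp add: srw_kernel_eq)
    show "markov_chain M (zero_lazy_kernel (1/4)) Y" using assms(4) by (simp add: lazy_at_0_kernel_eq)
    show "filterlim (\<lambda>n. sqrt (real n)) at_top sequentially"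
      by (rule filterlim_compose[OF sqrt_at_top filterlim_real_sequentially])
    show "filterlim (\<lambda>n. real n) at_top sequentially" by (rule filterlim_real_sequentially)
  qed (use assms in auto)
  have "(\<lambda>n \<omega>. \<lambda>t\<in>{0..}.
         (lin_interp (\<lambda>k. real_of_int (X k \<omega>))
            (lin_interp (\<lambda>k. real (loops_at_0 (\<lambda>i. Y i \<omega>) k)) (real n * t)) / root 4 (real n),
          lin_interp (\<lambda>k. real_of_int (Y k \<omega>)) (real n * t) / sqrt (real n))) = comb_pair"
  proof (intro ext)
    fix n \<omega> t
    \<comment> \<open>For \<open>n = 0\<close> both sides vanish, the clock by division by zero and the loops at time \<open>0\<close> by definition.\<close>
    have "sqrt (real n) * loop_clock n (\<lambda>i. Y i \<omega>) t = lin_interp (\<lambda>k. real (loops_at_0 (\<lambda>i. Y i \<omega>) k)) (real n * t)"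
    proof (cases "n = 0")
      case True
      have "lin_interp (\<lambda>k. real (loops_at_0 (\<lambda>i. Y i \<omega>) k)) (real 0) = 0" unfolding lin_interp_of_nat by simp
      then show ?thesis using True by simp
    qed (simp add: loop_clock_def)
    moreover have "root 4 (real n) = sqrt (sqrt (real n))"
      using real_root_mult_exp[of 2 2 "real n"] by (simp add: sqrt_def)
    ultimately show "(\<lambda>t\<in>{0..}.
         (lin_interp (\<lambda>k. real_of_int (X k \<omega>))
            (lin_interp (\<lambda>k. real (loops_at_0 (\<lambda>i. Y i \<omega>) k)) (real n * t)) / root 4 (real n),
          lin_interp (\<lambda>k. real_of_int (Y k \<omega>)) (real n * t) / sqrt (real n))) t = comb_pair n \<omega> t"
      by (simp add: comb_pair_def path_pair_def rescaled_def)
  qed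
  moreover have "(\<lambda>\<omega>. \<lambda>t\<in>{0..}. (W (L t \<omega>) \<omega>, B t \<omega>)) = limit_pair"
    by (simp add: fun_eq_iff limit_pair_def path_pair_def)
  ultimately show ?thesis using comb_pair_converges by simp
qed

end
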